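(* Suppose that $\alpha\in\mathbb{R}$ is such that $$\lim_{t\uparrow T} I_{X^{(\alpha)}}(t)=\infty$$ and $$\lim_{t\uparrow T}\int_0^t\sigma(s)^2\exp\left\{-2\alpha\int_0^s b(v)\,\mathrm{d}v\right\}\mathrm{d}s<\infty.$$ Then $$\sqrt{I_{X^{(\alpha)}}(t)}\,\big(\widehat{\alpha}_t^{(X^{(\alpha)})}-\alpha\big)\ \longrightarrow\ \zeta\qquad\text{in distribution as } t\uparrow T,$$ where $\zeta$ is a random variable with standard Cauchy distribution, i.e. with density function $\frac{1}{\pi(1+x^2)}$, $x\in\mathbb{R}$.
   Context: Let $T\in(0,\infty]$ be fixed. Let $b:[0,T)\to\mathbb{R}$ and $\sigma:[0,T)\to\mathbb{R}$ be continuous functions such that $\sigma(t)>0$ for all $t\in[0,T)$, and there exists $t_0\in(0,T)$ with $b(t)\neq0$ for all $t\in[t_0,T)$. Let $(B_t)_{t\in[0,T)}$ be a standard Wiener process on a filtered probability space $(\Omega,\mathcal{F},(\mathcal{F}_t)_{t\in[0,T)},\mathsf{P})$ constructed with the help of $B$, satisfying the usual conditions, with $\mathcal{F}=\sigma\big(\bigcup_{t\in[0,T)}\mathcal{F}_t\big)$. For $\alpha\in\mathbb{R}$, let $(X_t^{(\alpha)})_{t\in[0,T)}$ be the unique strong solution of $$\mathrm{d}X_t^{(\alpha)}=\alpha b(t)X_t^{(\alpha)}\,\mathrm{d}t+\sigma(t)\,\mathrm{d}B_t,\quad t\in[0,T),\qquad X_0^{(\alpha)}=0,$$ that is, $X_t^{(\alpha)}=\int_0^t\sigma(s)\exp\{\alpha\int_s^t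 b(u)\,\mathrm{d}u\}\,\mathrm{d}B_s$. The maximum likelihood estimator (MLE) $\widehat{\alpha}_t^{(X^{(\alpha)})}$ of $\alpha$ based on $(X_s^{(\alpha)})_{s\in[0,t]}$ is the maximizer over $\theta\in\mathbb{R}$ of the log-likelihood $\theta\int_0^t\frac{b(s)X_s^{(\alpha)}}{\sigma(s)^2}\,\mathrm{d}X_s^{(\alpha)}-\frac{\theta^2}{2}\int_0^t\frac{b(s)^2(X_s^{(\alpha)})^2}{\sigma(s)^2}\,\mathrm{d}s$; for $t\in[t_0,T)$ it exists $\mathsf{P}$-almost surely, is unique, and is given by $$\widehat{\alpha}_t^{(X^{(\alpha)})}=\frac{\int_0^t\frac{b(s)X_s^{(\alpha)}}{\sigma(s)^2}\,\mathrm{d}X_s^{(\alpha)}}{\int_0^t\frac{b(s)^2(X_s^{(\alpha)})^2}{\sigma(s)^2}\,\mathrm{d}s},\quad\text{so that}\quad \widehat{\alpha}_t^{(X^{(\alpha)})}-\alpha=\frac{\int_0^t\frac{b(s)X_s^{(\alpha)}}{\sigma(s)}\,\mathrm{d}B_s}{\int_0^t\frac{b(s)^2(X_s^{(\alpha)})^2}{\sigma(s)^2}\,\mathrm{d}s}.$$ The Fisher information for $\alpha$ contained in $(X_s^{(\alpha)})_{s\in[0,t]}$ is $$I_{X^{(\alpha)}}(t)=\int_0^t\frac{b(s)^2\,\mathsf{E}(X_s^{(\alpha)})^2}{\sigma(s)^2}\,\mathrm{d}s,\qquad \mathsf{E}(X_s^{(\alpha)})^2=\int_0^s\sigma(u)^2\exp\Big\{2\alpha\int_u^s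 b(v)\,\mathrm{d}v\Big\}\,\mathrm{d}u .$$ *)

theory Defs
  imports "HOL-Probability.Probability"
begin

section \<open>The time axis \<open>[0, T)\<close> with \<open>T \<in> (0, \<infinity>]\<close>\<close>

definition times_upto :: "ereal \<Rightarrow> real set" where
  "times_upto T = {t. 0 \<le> t \<and> ereal t < T}"

text \<open>The filter \<open>t \<up> T\<close> on the reals; the two lemmas below are the cases of infinite and finite \<open>T\<close>.\<close>

definition up_to :: "ereal \<Rightarrow> real filter" where
  "up_to T = filtercomap ereal (at_left T)"

lemma up_to_infinity: "up_to \<infinity> = at_top"
proof -
  have "eventually P (up_to \<infinity>) \<longleftrightarrow> eventually P at_top" for P
  proof
    assume "eventually P (up_to \<infinity>)"
    then obtain Q where Q: "eventually Q (at_left (\<infinity>::ereal))" "\<And>x. Q (ereal x) \<Longrightarrow> P x"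
      unfolding up_to_def eventually_filtercomap by blast
    from Q(1) have "eventually (\<lambda>x. Q (ereal x)) at_top"
      unfolding at_left_PInf eventually_filtermap .
    then show "eventually P at_top"
      by (rule eventually_mono) (rule Q(2))
  next
    assume "eventually P at_top"
    then show "eventually P (up_to \<infinity>)"
      unfolding up_to_def eventually_filtercomap at_left_PInf eventually_filtermap
      by (intro exI[of _ "\<lambda>y. P (real_of_ereal y)"]) simp
  qed
  then show ?thesis by (simp add: filter_eq_iff)
qed

lemma up_to_finite: "up_to (ereal r) = at_left r"
proof -
  have "eventually P (up_to (ereal r)) \<longleftrightarrow> eventually P (at_left r)" for P
  proof
    assume "eventually P (up_to (ereal r))"
    then obtain Q where Q: "eventually Q (at_left (ereal r))" "\<And>x. Q (ereal x) \<Longrightarrow> P x"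
      unfolding up_to_def eventually_filtercomap by blast
    from Q(1) have "eventually (\<lambda>x. Q (ereal x)) (at_left r)"
      unfolding at_left_ereal eventually_filtermap .
    then show "eventually P (at_left r)"
      by (rule eventually_mono) (rule Q(2))
  next
    assume "eventually P (at_left r)"
    then show "eventually P (up_to (ereal r))"
      unfolding up_to_def eventually_filtercomap at_left_ereal eventually_filtermap
      by (intro exI[of _ "\<lambda>y. P (real_of_ereal y)"]) simp
  qed
  then show ?thesis by (simp add: filter_eq_iff)
qed


section \<open>Filtered probability spaces and Wiener processes\<close>

text \<open>A process on \<open>[0, T)\<close> is a function \<open>real \<Rightarrow> 'a \<Rightarrow> real\<close> and a filtration a function
  \<open>real \<Rightarrow> 'a measure\<close>; only arguments in \<^term>\<open>times_upto T\<close> matter.\<close>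

definition filtered_prob_space :: "'a measure \<Rightarrow> (real \<Rightarrow> 'a measure) \<Rightarrow> ereal \<Rightarrow> bool" where
  "filtered_prob_space M F T \<longleftrightarrow>
     prob_space M \<and>
     (\<forall>t\<in>times_upto T. subalgebra M (F t)) \<and>
     (\<forall>s\<in>times_upto T. \<forall>t\<in>times_upto T. s \<le> t \<longrightarrow> sets (F s) \<subseteq> sets (F t))"

definition negligible_sets :: "'a measure \<Rightarrow> 'a set set" where
  "negligible_sets M = {A. \<exists>N\<in>null_sets M. A \<subseteq> N}"

definition usual_conditions :: "'a measure \<Rightarrow> (real \<Rightarrow> 'a measure) \<Rightarrow> ereal \<Rightarrow> bool" where
  "usual_conditions M F T \<longleftrightarrow>
     negligible_sets M \<subseteq> sets (F 0) \<and>
     (\<forall>t\<in>times_upto T. sets (F t) = (\<Inter>s\<in>{s\<in>times_upto T. t < s}. sets (F s)))"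

text \<open>The filtration constructed from \<open>B\<close>: its natural filtration augmented by the negligible sets.\<close>

definition augmented_natural_sets ::
    "'a measure \<Rightarrow> (real \<Rightarrow> 'a \<Rightarrow> real) \<Rightarrow> real \<Rightarrow> 'a set set" where
  "augmented_natural_sets M B t =
     sigma_sets (space M)
       ({B s -` A \<inter> space M | s A. 0 \<le> s \<and> s \<le> t \<and> A \<in> sets borel} \<union> negligible_sets M)"

definition continuous_adapted ::
    "'a measure \<Rightarrow> (real \<Rightarrow> 'a measure) \<Rightarrow> ereal \<Rightarrow> (real \<Rightarrow> 'a \<Rightarrow> real) \<Rightarrow> bool" where
  "continuous_adapted M F T Y \<longleftrightarrow>
     (\<forall>t\<in>times_upto T. Y t \<in> borel_measurable (F t)) \<and>
     (AE \<omega> in M. continuous_on (times_upto T) (\<lambda>t. Y t \<omega>))"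

definition wiener_process ::
    "'a measure \<Rightarrow> (real \<Rightarrow> 'a measure) \<Rightarrow> ereal \<Rightarrow> (real \<Rightarrow> 'a \<Rightarrow> real) \<Rightarrow> bool" where
  "wiener_process M F T B \<longleftrightarrow>
     continuous_adapted M F T B \<and>
     (AE \<omega> in M. B 0 \<omega> = 0) \<and>
     (\<forall>s\<in>times_upto T. \<forall>t\<in>times_upto T. s < t \<longrightarrow>
        distributed M lborel (\<lambda>\<omega>. B t \<omega> - B s \<omega>) (\<lambda>x. ennreal (normal_density 0 (sqrt (t - s)) x)) \<and>
        prob_space.indep_set M (sets (F s))
          (sets (vimage_algebra (space M) (\<lambda>\<omega>. B t \<omega> - B s \<omega>) borel)))"


section \<open>Stochastic integrals of continuous adapted integrands\<close>

text \<open>A simple process is given by a grid \<open>0 = \<tau> 0 < \<dots> < \<tau> k < T\<close> and coefficients \<open>\<xi> i\<close> that are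
  measurable at the left end point \<open>\<tau> i\<close>. It is
  \<open>\<xi> 0 \<cdot> 1{0} + (\<Sum>i<k. \<xi> i \<cdot> 1(\<tau> i, \<tau> (i+1)])\<close>.\<close>

definition is_simple_process ::
    "(real \<Rightarrow> 'a measure) \<Rightarrow> ereal \<Rightarrow> nat \<Rightarrow> (nat \<Rightarrow> real) \<Rightarrow> (nat \<Rightarrow> 'a \<Rightarrow> real) \<Rightarrow> bool" where
  "is_simple_process F T k \<tau> \<xi> \<longleftrightarrow>
     0 < k \<and> \<tau> 0 = 0 \<and> (\<forall>i<k. \<tau> i < \<tau> (Suc i)) \<and> ereal (\<tau> k) < T \<and>
     (\<forall>i<k. \<xi> i \<in> borel_measurable (F (\<tau> i)))"

definition simple_process ::
    "nat \<Rightarrow> (nat \<Rightarrow> real) \<Rightarrow> (nat \<Rightarrow> 'a \<Rightarrow> real) \<Rightarrow> real \<Rightarrow> 'a \<Rightarrow> real" where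
  "simple_process k \<tau> \<xi> t \<omega> =
     (if t = 0 then \<xi> 0 \<omega> else (\<Sum>i<k. \<xi> i \<omega> * indicator {\<tau> i<..\<tau> (Suc i)} t))"

definition simple_integral_process ::
    "nat \<Rightarrow> (nat \<Rightarrow> real) \<Rightarrow> (nat \<Rightarrow> 'a \<Rightarrow> real) \<Rightarrow> (real \<Rightarrow> 'a \<Rightarrow> real) \<Rightarrow> real \<Rightarrow> 'a \<Rightarrow> real" where
  "simple_integral_process k \<tau> \<xi> Y t \<omega> =
     (\<Sum>i<k. \<xi> i \<omega> * (Y (min t (\<tau> (Suc i))) \<omega> - Y (min t (\<tau> i)) \<omega>))"

text \<open>Convergence in probability, uniformly on every \<open>[0, t]\<close> with \<open>t < T\<close>. The exceptional event
  is covered by a measurable \<open>A\<close> (outer probability): \<^term>\<open>measure M\<close> is \<open>0\<close> on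
  non-measurable sets.\<close>

definition ucp_tendsto ::
    "'a measure \<Rightarrow> ereal \<Rightarrow> (nat \<Rightarrow> real \<Rightarrow> 'a \<Rightarrow> real) \<Rightarrow> (real \<Rightarrow> 'a \<Rightarrow> real) \<Rightarrow> bool" where
  "ucp_tendsto M T Y Z \<longleftrightarrow>
     (\<forall>t\<in>times_upto T. \<forall>\<epsilon>>0. \<forall>\<delta>>0. \<forall>\<^sub>F n in sequentially.
        \<exists>A\<in>sets M. measure M A < \<delta> \<and>
          (\<forall>\<omega>\<in>space M - A. \<forall>s\<in>{0..t}. \<bar>Y n s \<omega> - Z s \<omega>\<bar> < \<epsilon>))"

text \<open>\<open>J\<close> is (a continuous version of) the process \<open>t \<mapsto> \<integral>\<^sub>0\<^sup>t H dY\<close>: the ucp-continuous extension of the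
  elementary integral from simple processes to continuous adapted \<open>H\<close>. For a continuous
  semimartingale \<open>Y\<close> the limit does not depend on the approximating sequence, so \<open>J\<close> is unique up
  to indistinguishability; for a Wiener process \<open>Y\<close> it is the Ito integral.\<close>

definition is_stochastic_integral ::
    "'a measure \<Rightarrow> (real \<Rightarrow> 'a measure) \<Rightarrow> ereal \<Rightarrow> (real \<Rightarrow> 'a \<Rightarrow> real) \<Rightarrow> (real \<Rightarrow> 'a \<Rightarrow> real) \<Rightarrow>
     (real \<Rightarrow> 'a \<Rightarrow> real) \<Rightarrow> bool" where
  "is_stochastic_integral M F T Y H J \<longleftrightarrow>
     continuous_adapted M F T J \<and>
     (\<exists>k \<tau> \<xi>. (\<forall>n. is_simple_process F T (k n) (\<tau> n) (\<xi> n)) \<and>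
        ucp_tendsto M T (\<lambda>n. simple_process (k n) (\<tau> n) (\<xi> n)) H \<and>
        ucp_tendsto M T (\<lambda>n. simple_integral_process (k n) (\<tau> n) (\<xi> n) Y) J)"

text \<open>\<open>X\<close> solves \<open>dX\<^sub>t = a(t, X\<^sub>t) dt + g(t, X\<^sub>t) dB\<^sub>t\<close>, \<open>X\<^sub>0 = x\<^sub>0\<close>, on \<open>[0, T)\<close>; it is a strong
  solution when \<open>F\<close> is the augmented natural filtration of \<open>B\<close>.\<close>

definition sde_solution ::
    "'a measure \<Rightarrow> (real \<Rightarrow> 'a measure) \<Rightarrow> ereal \<Rightarrow> (real \<Rightarrow> 'a \<Rightarrow> real) \<Rightarrow>
     (real \<Rightarrow> real \<Rightarrow> real) \<Rightarrow> (real \<Rightarrow> real \<Rightarrow> real) \<Rightarrow> real \<Rightarrow> (real \<Rightarrow> 'a \<Rightarrow> real) \<Rightarrow> bool" where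
  "sde_solution M F T B a g x0 X \<longleftrightarrow>
     continuous_adapted M F T X \<and>
     (AE \<omega> in M. X 0 \<omega> = x0) \<and>
     (\<exists>S. is_stochastic_integral M F T B (\<lambda>t \<omega>. g t (X t \<omega>)) S \<and>
        (\<forall>t\<in>times_upto T. AE \<omega> in M.
           set_integrable lborel {0..t} (\<lambda>s. a s (X s \<omega>)) \<and>
           X t \<omega> = x0 + (LBINT s:{0..t}. a s (X s \<omega>)) + S t \<omega>))"


section \<open>Maximum likelihood estimation of the drift parameter\<close>

text \<open>\<open>S\<close> is a version of \<open>\<integral> b X / \<sigma>\<^sup>2 dX\<close>.\<close>

definition log_likelihood ::
    "(real \<Rightarrow> real) \<Rightarrow> (real \<Rightarrow> real) \<Rightarrow> (real \<Rightarrow> 'a \<Rightarrow> real) \<Rightarrow> (real \<Rightarrow> 'a \<Rightarrow> real) \<Rightarrow>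
     real \<Rightarrow> 'a \<Rightarrow> real \<Rightarrow> real" where
  "log_likelihood b \<sigma> X S t \<omega> \<theta> =
     \<theta> * S t \<omega> - \<theta>\<^sup>2 / 2 * (LBINT s:{0..t}. (b s)\<^sup>2 * (X s \<omega>)\<^sup>2 / (\<sigma> s)\<^sup>2)"

definition is_MLE ::
    "'a measure \<Rightarrow> (real \<Rightarrow> 'a measure) \<Rightarrow> ereal \<Rightarrow> (real \<Rightarrow> real) \<Rightarrow> (real \<Rightarrow> real) \<Rightarrow>
     (real \<Rightarrow> 'a \<Rightarrow> real) \<Rightarrow> real \<Rightarrow> ('a \<Rightarrow> real) \<Rightarrow> bool" where
  "is_MLE M F T b \<sigma> X t est \<longleftrightarrow>
     (\<exists>S. is_stochastic_integral M F T X (\<lambda>s \<omega>. b s * X s \<omega> / (\<sigma> s)\<^sup>2) S \<and>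
        (AE \<omega> in M. is_arg_max (log_likelihood b \<sigma> X S t \<omega>) (\<lambda>\<theta>. True) (est \<omega>)))"

definition fisher_information ::
    "'a measure \<Rightarrow> (real \<Rightarrow> real) \<Rightarrow> (real \<Rightarrow> real) \<Rightarrow> (real \<Rightarrow> 'a \<Rightarrow> real) \<Rightarrow> real \<Rightarrow> real" where
  "fisher_information M b \<sigma> X t =
     (LBINT s:{0..t}. (b s)\<^sup>2 * (\<integral>\<omega>. (X s \<omega>)\<^sup>2 \<partial>M) / (\<sigma> s)\<^sup>2)"


section \<open>Convergence in distribution\<close>

text \<open>The notion of \<^const>\<open>weak_conv_m\<close>, along an arbitrary filter.\<close>

definition converges_in_distribution ::
    "'a measure \<Rightarrow> ('t \<Rightarrow> 'a \<Rightarrow> real) \<Rightarrow> 't filter \<Rightarrow> 'b measure \<Rightarrow> ('b \<Rightarrow> real) \<Rightarrow> bool" where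
  "converges_in_distribution M Z G N \<zeta> \<longleftrightarrow>
     (\<forall>x. isCont (cdf (distr N borel \<zeta>)) x \<longrightarrow>
        ((\<lambda>t. cdf (distr M borel (Z t)) x) \<longlongrightarrow> cdf (distr N borel \<zeta>) x) G)"

lemma converges_in_distribution_sequentially:
  "converges_in_distribution M Z sequentially N \<zeta> \<longleftrightarrow>
     weak_conv_m (\<lambda>n. distr M borel (Z n)) (distr N borel \<zeta>)"
  by (simp add: converges_in_distribution_def weak_conv_m_def weak_conv_def)

definition standard_cauchy_density :: "real \<Rightarrow> real" where
  "standard_cauchy_density x = 1 / (pi * (1 + x\<^sup>2))"

end

theory Submission
  imports Defs
begin

text \<open>Let \<open>\<mu>\<close> be the discount factor \<open>exp (- \<alpha> \<integral> b)\<close>. The discounted solution \<open>Y = \<mu> X\<close> is the Wiener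
  integral \<open>\<integral> \<mu> \<sigma> dB\<close>. It has independent Gaussian increments, and its variance function \<open>V\<close> increases
  to a finite limit \<open>L\<close> by the second limit hypothesis; so \<open>Y\<close> hardly moves after a late time \<open>u\<close>. With
  \<open>h = b / (\<mu> \<sigma>\<^sup>2)\<close> and \<open>A = \<integral> h\<^sup>2 \<sigma>\<^sup>2 ds\<close>, the estimation error is the quotient of the numerator \<open>\<integral> h Y \<sigma> dB\<close>
  by the observed information \<open>J = \<integral> Y\<^sup>2 dA\<close>, and the Fisher information is \<open>\<integral> V dA\<close>. The latter
  diverges and behaves like \<open>L A\<close>, so that \<open>A\<close> diverges and everything before \<open>u\<close> becomes negligible. After
  \<open>u\<close> the process \<open>Y\<close> may be frozen: the numerator is nearly \<open>Y u\<close> times the Gaussian variable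
  \<open>\<integral> h \<sigma> dB\<close> over the interval from \<open>u\<close> to \<open>t\<close>, which is independent of \<open>Y u\<close>, and \<open>J\<close> is nearly
  \<open>(Y u)\<^sup>2 A\<close>. Hence numerator and denominator, divided by \<open>sqrt A\<close> and \<open>A\<close>, are close to
  \<open>sqrt L Y' G\<close> and \<open>L Y'\<^sup>2\<close> with independent standard normal \<open>Y'\<close> and \<open>G\<close>, and the normalized
  error is close to the Cauchy variable \<open>G / Y'\<close>.

  No theory of stochastic integration beyond its definition enters. A stochastic integral is close
  in probability to Riemann sums of its integrand along fine grids (\<open>integral_increment_approx\<close>): the
  coefficients by which the approximating simple processes differ from the integrand are
  small, and the isometry for sums of increments, applied to truncated coefficients, makes their
  sum small. Gaussian laws and independence pass to limits in probability through characteristic functions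
  (\<open>indep_normal_limit\<close>). Applied to the Wiener process, this shows that the noise \<open>\<integral> \<sigma> dB\<close> and then \<open>Y\<close> have
  independent Gaussian increments. Freezing \<open>Y\<close> is again an estimate by the isometry on Riemann sums
  (\<open>score_decomposition\<close> and \<open>information_decomposition\<close>), which \<open>joint_approx\<close> assembles.

  Division is avoided in the last step: since \<open>J > 0\<close>, the normalized error is at most \<open>x\<close> iff the
  normalized numerator minus \<open>x\<close> times the normalized denominator is nonpositive. This difference is close
  to \<open>L (Y' G - x Y'\<^sup>2)\<close>, whose law has no atom at \<open>0\<close> and gives the nonpositive numbers the Cauchy
  probability of the numbers up to \<open>x\<close> (\<open>coupled_cdf_limit\<close> and \<open>normal_ratio_Cauchy\<close>).\<close>


section \<open>Statements that hold up to a small event\<close>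

text \<open>Convergence in probability is expressed through statements that hold off an event of small
  probability. They combine like conjunctions. The exceptional event is measurable even when \<open>P\<close>
  does not define a measurable set.\<close>

definition holds_up_to :: "'a measure \<Rightarrow> real \<Rightarrow> ('a \<Rightarrow> bool) \<Rightarrow> bool" where
  "holds_up_to M \<delta> P \<longleftrightarrow> (\<exists>A\<in>sets M. measure M A \<le> \<delta> \<and> (\<forall>\<omega>\<in>space M - A. P \<omega>))"

lemma holds_up_to_mono:
  assumes "holds_up_to M \<delta> P" "\<delta> \<le> \<delta>'" "\<And>\<omega>. \<omega> \<in> space M \<Longrightarrow> P \<omega> \<Longrightarrow> Q \<omega>"
  shows "holds_up_to M \<delta>' Q"
proof -
  obtain A where "A \<in> sets M" "measure M A \<le> \<delta>" "\<forall>\<omega>\<in>space M - A. P \<omega>"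
    using assms(1) unfolding holds_up_to_def by auto
  then show ?thesis
    unfolding holds_up_to_def using assms(2,3) by (intro bexI[of _ A]) auto
qed

context prob_space
begin

lemma holds_up_to_conj:
  assumes "holds_up_to M \<delta> P" "holds_up_to M \<delta>' Q"
  shows "holds_up_to M (\<delta> + \<delta>') (\<lambda>\<omega>. P \<omega> \<and> Q \<omega>)"
proof -
  obtain A where A: "A \<in> sets M" "measure M A \<le> \<delta>" "\<forall>\<omega>\<in>space M - A. P \<omega>"
    using assms(1) unfolding holds_up_to_def by auto
  obtain A' where A': "A' \<in> sets M" "measure M A' \<le> \<delta>'" "\<forall>\<omega>\<in>space M - A'. Q \<omega>"
    using assms(2) unfolding holds_up_to_def by auto
  have "measure M (A \<union> A') \<le> \<delta> + \<delta>'"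
    using A(1,2) A'(1,2) measure_Un_le[of A M A'] by simp
  then show ?thesis
    unfolding holds_up_to_def using A A' by (intro bexI[of _ "A \<union> A'"]) auto
qed

lemma AE_holds_up_to:
  assumes "AE \<omega> in M. P \<omega>" "0 \<le> \<delta>"
  shows "holds_up_to M \<delta> P"
proof -
  obtain A where "A \<in> null_sets M" "{\<omega>\<in>space M. \<not> P \<omega>} \<subseteq> A"
    using assms(1) by (auto simp: eventually_ae_filter)
  then show ?thesis
    unfolding holds_up_to_def using assms(2)
    by (intro bexI[of _ A]) (auto simp: null_sets_def measure_def)
qed

lemma holds_up_to_Markov:
  fixes f :: "'a \<Rightarrow> real"
  assumes "integrable M f" "\<And>\<omega>. \<omega> \<in> space M \<Longrightarrow> 0 \<le> f \<omega>" "0 < c" "expectation f \<le> c * \<delta>"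
  shows "holds_up_to M \<delta> (\<lambda>\<omega>. f \<omega> < c)"
proof -
  have [measurable]: "f \<in> borel_measurable M" using assms(1) by auto
  have "measure M {\<omega>\<in>space M. f \<omega> \<ge> c} \<le> expectation f / c"
    using assms by (intro integral_Markov_inequality_measure[where A="{}"]) auto
  also have "\<dots> \<le> \<delta>" using assms(3,4) by (simp add: field_simps)
  finally show ?thesis
    unfolding holds_up_to_def by (intro bexI[of _ "{\<omega>\<in>space M. f \<omega> \<ge> c}"]) auto
qed

lemma holds_up_to_Chebyshev:
  fixes f :: "'a \<Rightarrow> real"
  assumes "integrable M (\<lambda>\<omega>. (f \<omega>)\<^sup>2)" "0 < c" "expectation (\<lambda>\<omega>. (f \<omega>)\<^sup>2) \<le> c\<^sup>2 * \<delta>"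
  shows "holds_up_to M \<delta> (\<lambda>\<omega>. \<bar>f \<omega>\<bar> \<le> c)"
proof -
  have "holds_up_to M \<delta> (\<lambda>\<omega>. (f \<omega>)\<^sup>2 < c\<^sup>2)"
    using assms by (intro holds_up_to_Markov) auto
  then show ?thesis
  proof (rule holds_up_to_mono[OF _ order_refl])
    fix \<omega> assume "(f \<omega>)\<^sup>2 < c\<^sup>2"
    then have "\<bar>f \<omega>\<bar>\<^sup>2 < c\<^sup>2" by simp
    then have "\<bar>f \<omega>\<bar> < c" by (rule power_less_imp_less_base) (use \<open>0 < c\<close> in simp)
    then show "\<bar>f \<omega>\<bar> \<le> c" by simp
  qed
qed

lemma holds_up_to_bounded:
  fixes f :: "'a \<Rightarrow> real"
  assumes [measurable]: "f \<in> borel_measurable M" and "0 < \<delta>"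
  shows "\<exists>K>0. holds_up_to M \<delta> (\<lambda>\<omega>. \<bar>f \<omega>\<bar> \<le> K)"
proof -
  define A where "A n = {\<omega>\<in>space M. real n < \<bar>f \<omega>\<bar>}" for n :: nat
  have A [measurable]: "A n \<in> sets M" for n unfolding A_def by measurable
  have "(\<Inter>n. A n) = {}"
  proof -
    have "\<omega> \<notin> (\<Inter>n. A n)" for \<omega>
    proof -
      obtain n where "\<bar>f \<omega>\<bar> \<le> real n" using real_arch_simple by blast
      then have "\<omega> \<notin> A n" by (simp add: A_def)
      then show ?thesis by blast
    qed
    then show ?thesis by blast
  qed
  moreover have "decseq A"
    by (auto simp: A_def decseq_def)
  ultimately have "(\<lambda>n. measure M (A n)) \<longlonglongrightarrow> 0"
    using finite_Lim_measure_decseq[of A] A by (auto simp: image_subset_iff)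
  then have "eventually (\<lambda>n. measure M (A n) < \<delta>) sequentially"
    using \<open>0 < \<delta>\<close> by (rule order_tendstoD)
  then obtain n where n: "measure M (A n) < \<delta>"
    by (auto simp: eventually_sequentially)
  have "holds_up_to M \<delta> (\<lambda>\<omega>. \<bar>f \<omega>\<bar> \<le> real n)"
    unfolding holds_up_to_def using n by (intro bexI[of _ "A n"]) (auto simp: A_def)
  then show ?thesis
    by (intro exI[of _ "real n + 1"]) (auto elim: holds_up_to_mono)
qed

text \<open>The exceptional events come from the Cauchy criterion. They involve only the approximating
  functions, so they are measurable whatever the limit function is.\<close>

lemma AE_tendsto_holds_up_to:
  fixes f :: "nat \<Rightarrow> 'a \<Rightarrow> real"
  assumes [measurable]: "\<And>n. f n \<in> borel_measurable M"
    and lim: "AE \<omega> in M. (\<lambda>n. f n \<omega>) \<longlonglongrightarrow> g \<omega>" and "0 < \<epsilon>" "0 < \<delta>"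
  shows "\<forall>\<^sub>F n in sequentially. holds_up_to M \<delta> (\<lambda>\<omega>. \<bar>f n \<omega> - g \<omega>\<bar> \<le> \<epsilon>)"
proof -
  define A where "A N = {\<omega>\<in>space M. \<exists>m\<in>{N..}. \<exists>n\<in>{N..}. \<epsilon> < \<bar>f n \<omega> - f m \<omega>\<bar>}" for N :: nat
  have A [measurable]: "A n \<in> sets M" for n unfolding A_def by measurable
  have dec: "decseq A"
    unfolding A_def decseq_def by (auto; meson atLeast_iff order_trans)
  have conv_out: "\<exists>N. \<omega> \<notin> A N" if "(\<lambda>n. f n \<omega>) \<longlonglongrightarrow> g \<omega>" for \<omega>
  proof -
    have "Cauchy (\<lambda>n. f n \<omega>)" using that by (intro LIMSEQ_imp_Cauchy)
    from CauchyD[OF this \<open>0 < \<epsilon>\<close>] obtain N where "\<forall>m\<ge>N. \<forall>n\<ge>N. \<bar>f m \<omega> - f n \<omega>\<bar> < \<epsilon>"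
      by (auto)
    then have "\<omega> \<notin> A N" by (force simp: A_def)
    then show ?thesis ..
  qed
  have "AE \<omega> in M. \<omega> \<notin> (\<Inter>N. A N)"
    using lim by eventually_elim (use conv_out in auto)
  then have "(\<Inter>N. A N) \<in> null_sets M"
    using A by (subst AE_iff_null_sets) auto
  then have "measure M (\<Inter>N. A N) = 0"
    by (auto simp: null_sets_def measure_def)
  then have "(\<lambda>n. measure M (A n)) \<longlonglongrightarrow> 0"
    using finite_Lim_measure_decseq[of A] A dec by (auto simp: image_subset_iff)
  then have "eventually (\<lambda>n. measure M (A n) < \<delta>) sequentially"
    using \<open>0 < \<delta>\<close> by (rule order_tendstoD)
  then show ?thesis
  proof eventually_elim
    case (elim n)
    have "holds_up_to M (measure M (A n)) (\<lambda>\<omega>. \<omega> \<notin> A n)"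
      unfolding holds_up_to_def by (intro bexI[of _ "A n"]) auto
    from holds_up_to_conj[OF this AE_holds_up_to[OF lim order_refl]]
    show "holds_up_to M \<delta> (\<lambda>\<omega>. \<bar>f n \<omega> - g \<omega>\<bar> \<le> \<epsilon>)"
    proof (rule holds_up_to_mono)
      show "measure M (A n) + 0 \<le> \<delta>" using elim by simp
      fix \<omega> assume \<omega>: "\<omega> \<in> space M" "\<omega> \<notin> A n \<and> (\<lambda>n. f n \<omega>) \<longlonglongrightarrow> g \<omega>"
      have "(\<lambda>m. \<bar>f n \<omega> - f m \<omega>\<bar>) \<longlonglongrightarrow> \<bar>f n \<omega> - g \<omega>\<bar>"
        using \<omega> by (intro tendsto_intros) auto
      moreover have "\<forall>m\<ge>n. \<bar>f n \<omega> - f m \<omega>\<bar> \<le> \<epsilon>"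
        using \<omega> by (force simp: A_def not_less)
      ultimately show "\<bar>f n \<omega> - g \<omega>\<bar> \<le> \<epsilon>"
        by (intro LIMSEQ_le_const2) auto
    qed
  qed
qed

end


section \<open>Gaussian variables independent of a sigma-algebra\<close>

text \<open>\<open>D\<close> is \<open>N(0, v)\<close>-distributed and independent of \<open>G\<close>. The encoding by characteristic functions
  admits \<open>v = 0\<close>, and it is stable under limits in probability and under sums over successive
  increments.\<close>

definition indep_normal :: "'a measure \<Rightarrow> 'a measure \<Rightarrow> real \<Rightarrow> ('a \<Rightarrow> real) \<Rightarrow> bool" where
  "indep_normal M G v D \<longleftrightarrow> D \<in> borel_measurable M \<and> 0 \<le> v \<and>
     (\<forall>u. \<forall>\<xi>\<in>borel_measurable G. (\<forall>\<omega>\<in>space M. cmod (\<xi> \<omega>) \<le> 1) \<longrightarrow>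
        (\<integral>\<omega>. \<xi> \<omega> * iexp (u * D \<omega>) \<partial>M) = (\<integral>\<omega>. \<xi> \<omega> \<partial>M) * exp (- (u\<^sup>2 * v / 2)))"

lemma indep_normal_measurable: "indep_normal M G v D \<Longrightarrow> D \<in> borel_measurable M"
  by (simp add: indep_normal_def)

lemma indep_normal_scale:
  assumes "indep_normal M G v D"
  shows "indep_normal M G (c\<^sup>2 * v) (\<lambda>\<omega>. c * D \<omega>)"
  unfolding indep_normal_def
proof (intro conjI allI ballI impI)
  show "(\<lambda>\<omega>. c * D \<omega>) \<in> borel_measurable M" "0 \<le> c\<^sup>2 * v"
    using assms by (auto simp: indep_normal_def)
  fix u \<xi> assume \<xi>: "\<xi> \<in> borel_measurable G" "\<forall>\<omega>\<in>space M. cmod (\<xi> \<omega>) \<le> 1"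
  have "(\<integral>\<omega>. \<xi> \<omega> * iexp ((u * c) * D \<omega>) \<partial>M) = (\<integral>\<omega>. \<xi> \<omega> \<partial>M) * exp (- ((u * c)\<^sup>2 * v / 2))"
    using assms \<xi> unfolding indep_normal_def by blast
  then show "(\<integral>\<omega>. \<xi> \<omega> * iexp (u * (c * D \<omega>)) \<partial>M) = (\<integral>\<omega>. \<xi> \<omega> \<partial>M) * exp (- (u\<^sup>2 * (c\<^sup>2 * v) / 2))"
    by (simp add: power_mult_distrib mult.assoc)
qed

lemma indep_normal_AE_cong:
  assumes D: "indep_normal M G v D" and D' [measurable]: "D' \<in> borel_measurable M"
    and eq: "AE \<omega> in M. D' \<omega> = D \<omega>" and G: "subalgebra M G"
  shows "indep_normal M G v D'"
  unfolding indep_normal_def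
proof (intro conjI allI ballI impI)
  have [measurable]: "D \<in> borel_measurable M" using D by (simp add: indep_normal_def)
  show "0 \<le> v" using D by (simp add: indep_normal_def)
  fix u and \<xi> :: "'a \<Rightarrow> complex"
  assume \<xi>: "\<xi> \<in> borel_measurable G" "\<forall>\<omega>\<in>space M. cmod (\<xi> \<omega>) \<le> 1"
  have [measurable]: "\<xi> \<in> borel_measurable M" using \<xi>(1) G by (rule measurable_from_subalg[rotated])
  have "(\<integral>\<omega>. \<xi> \<omega> * iexp (u * D' \<omega>) \<partial>M) = (\<integral>\<omega>. \<xi> \<omega> * iexp (u * D \<omega>) \<partial>M)"
    using eq by (intro integral_cong_AE) auto
  also have "\<dots> = (\<integral>\<omega>. \<xi> \<omega> \<partial>M) * exp (- (u\<^sup>2 * v / 2))"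
    using D \<xi> unfolding indep_normal_def by blast
  finally show "(\<integral>\<omega>. \<xi> \<omega> * iexp (u * D' \<omega>) \<partial>M) = (\<integral>\<omega>. \<xi> \<omega> \<partial>M) * exp (- (u\<^sup>2 * v / 2))" .
qed (rule D')

lemma char_centred_normal:
  "char (distr std_normal_distribution borel (\<lambda>x. s * x)) u = exp (- (u\<^sup>2 * s\<^sup>2 / 2))"
proof -
  have "char (distr std_normal_distribution borel (\<lambda>x. s * x)) u = char std_normal_distribution (u * s)"
    by (simp add: char_def integral_distr mult.assoc)
  then show ?thesis
    by (simp add: char_std_normal_distribution power_mult_distrib)
qed

lemma real_distribution_centred_normal:
  "real_distribution (distr std_normal_distribution borel (\<lambda>x. s * x))"
proof -
  interpret real_distribution std_normal_distribution by (rule real_dist_normal_dist)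
  show ?thesis by (rule real_distribution_distr) simp
qed

context prob_space
begin

lemma integrable_bounded_complex:
  fixes f :: "'a \<Rightarrow> complex"
  assumes "f \<in> borel_measurable M" "\<And>\<omega>. \<omega> \<in> space M \<Longrightarrow> cmod (f \<omega>) \<le> c"
  shows "integrable M f"
  using assms by (intro integrable_const_bound[where B=c]) auto

text \<open>Under the conditional probability given an event of \<open>G\<close>, the variable \<open>D\<close> has the same
  characteristic function as under \<open>M\<close>, hence the same law.\<close>

lemma indep_normal_conditional_law:
  assumes G: "subalgebra M G" and D: "indep_normal M G v D"
    and A: "A \<in> sets G" and S: "S \<in> sets borel"
  shows "prob (A \<inter> (D -` S \<inter> space M)) =
    prob A * measure (distr std_normal_distribution borel (\<lambda>x. sqrt v * x)) S"
proof (cases "prob A = 0")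
  case True
  have "A \<in> sets M" using A G by (auto simp: subalgebra_def)
  then have "prob (A \<inter> (D -` S \<inter> space M)) \<le> prob A"
    using D S by (intro finite_measure_mono) (auto simp: indep_normal_def)
  with True show ?thesis by (metis measure_nonneg antisym mult_zero_left)
next
  case False
  have [measurable]: "A \<in> sets M" "D \<in> borel_measurable M" "S \<in> sets borel"
    using A G D S by (auto simp: subalgebra_def indep_normal_def)
  define p where "p = prob A"
  have p: "0 < p" using False unfolding p_def by (simp add: zero_less_measure_iff)
  \<comment> \<open>the conditional probability given \<open>A\<close>\<close>
  define MA where "MA = density M (\<lambda>\<omega>. ennreal (indicator A \<omega> / p))"
  have meas_MA: "emeasure MA C = ennreal (prob (A \<inter> C) / p)" if [measurable]: "C \<in> sets M" for C
  proof -
    have "emeasure MA C = (\<integral>\<^sup>+\<omega>. ennreal (1 / p) * indicator (A \<inter> C) \<omega> \<partial>M)"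
      unfolding MA_def
      by (subst emeasure_density)
        (auto intro!: nn_integral_cong simp: indicator_def split: if_splits)
    also have "\<dots> = ennreal (1 / p) * emeasure M (A \<inter> C)"
      by (subst nn_integral_cmult_indicator) auto
    also have "\<dots> = ennreal (prob (A \<inter> C) / p)"
      using p by (simp add: emeasure_eq_measure ennreal_mult[symmetric])
    finally show ?thesis .
  qed
  have "prob_space MA"
  proof
    have sp: "space MA = space M" by (simp add: MA_def)
    have "A \<inter> space M = A" using \<open>A \<in> sets M\<close> sets.sets_into_space by auto
    then show "emeasure MA (space MA) = 1"
      unfolding sp using meas_MA[of "space M"] p by (simp add: p_def)
  qed
  then interpret MA: prob_space MA .
  have D_MA [measurable]: "D \<in> borel_measurable MA" by (simp add: MA_def)
  have "char (distr MA borel D) u = exp (- (u\<^sup>2 * v / 2))" for u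
  proof -
    have "char (distr MA borel D) u = (\<integral>\<omega>. iexp (u * D \<omega>) \<partial>MA)"
      unfolding char_def by (subst integral_distr) auto
    also have "\<dots> = (\<integral>\<omega>. (indicator A \<omega> / p) *\<^sub>R iexp (u * D \<omega>) \<partial>M)"
      unfolding MA_def using p by (subst integral_density) auto
    also have "\<dots> = (\<integral>\<omega>. (1 / p) *\<^sub>R (indicator A \<omega> * iexp (u * D \<omega>)) \<partial>M)"
      by (intro Bochner_Integration.integral_cong) (auto simp: indicator_def)
    also have "\<dots> = (1 / p) *\<^sub>R (\<integral>\<omega>. indicator A \<omega> * iexp (u * D \<omega>) \<partial>M)"
      by simp
    also have "(\<integral>\<omega>. indicator A \<omega> * iexp (u * D \<omega>) \<partial>M) = (\<integral>\<omega>. (indicator A \<omega> :: complex) \<partial>M) * complex_of_real (exp (- (u\<^sup>2 * v / 2)))"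
    proof -
      have "(indicator A :: 'a \<Rightarrow> complex) \<in> borel_measurable G" using A by measurable
      moreover have "\<forall>\<omega>\<in>space M. cmod (indicator A \<omega>) \<le> 1" by (simp add: indicator_def)
      ultimately show ?thesis
        using D[unfolded indep_normal_def, THEN conjunct2, THEN conjunct2, rule_format, of "indicator A" u]
        by blast
    qed
    also have "(\<integral>\<omega>. (indicator A \<omega> :: complex) \<partial>M) = complex_of_real p"
    proof -
      have "(\<integral>\<omega>. (indicator A \<omega> :: complex) \<partial>M) = (\<integral>\<omega>. complex_of_real (indicator A \<omega>) \<partial>M)"
        by (intro Bochner_Integration.integral_cong) (auto simp: indicator_def)
      also have "\<dots> = complex_of_real p"
        unfolding integral_complex_of_real p_def by (simp add: Int_absorb2 sets.sets_into_space)
      finally show ?thesis .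
    qed
    finally show ?thesis using p by (simp add: scaleR_conv_of_real)
  qed
  moreover have "0 \<le> v" using D by (simp add: indep_normal_def)
  ultimately have "char (distr MA borel D) =
      char (distr std_normal_distribution borel (\<lambda>x. sqrt v * x))"
    by (intro ext) (simp add: char_centred_normal)
  then have "distr MA borel D = distr std_normal_distribution borel (\<lambda>x. sqrt v * x)"
    by (intro Levy_uniqueness real_distribution_centred_normal MA.real_distribution_distr) simp
  then have "measure (distr std_normal_distribution borel (\<lambda>x. sqrt v * x)) S =
      measure (distr MA borel D) S" by simp
  also have "\<dots> = measure MA (D -` S \<inter> space M)"
    by (subst measure_distr) (auto simp: MA_def)
  also have "\<dots> = prob (A \<inter> (D -` S \<inter> space M)) / p"
    using p by (subst measure_def, subst meas_MA) (auto simp: measure_nonneg)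
  finally show ?thesis using p by (simp add: p_def)
qed

lemma indep_normal_distr:
  assumes "subalgebra M G" "indep_normal M G v D"
  shows "distr M borel D = distr std_normal_distribution borel (\<lambda>x. sqrt v * x)"
proof -
  interpret R: real_distribution "distr std_normal_distribution borel (\<lambda>x. sqrt v * x)"
    by (rule real_distribution_centred_normal)
  have [measurable]: "D \<in> borel_measurable M" using assms(2) by (simp add: indep_normal_def)
  show ?thesis
  proof (rule measure_eqI)
    fix S assume "S \<in> sets (distr M borel D)"
    then have S: "S \<in> sets borel" by simp
    have "space M \<in> sets G" using assms(1) by (metis sets.top subalgebra_def)
    from indep_normal_conditional_law[OF assms this S]
    have "prob (D -` S \<inter> space M) = measure (distr std_normal_distribution borel (\<lambda>x. sqrt v * x)) S"
      by (simp add: prob_space Int_absorb1)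
    then show "emeasure (distr M borel D) S =
        emeasure (distr std_normal_distribution borel (\<lambda>x. sqrt v * x)) S"
      using S by (simp add: emeasure_distr emeasure_eq_measure R.emeasure_eq_measure)
  qed simp
qed

lemma indep_normal_indep_set:
  assumes "subalgebra M G" "indep_normal M G v D"
  shows "indep_set (sets G) {D -` A \<inter> space M |A. A \<in> sets borel}"
proof -
  have [measurable]: "D \<in> borel_measurable M" using assms(2) by (simp add: indep_normal_def)
  have sp: "space G = space M" and GM: "sets G \<subseteq> sets M"
    using assms(1) by (auto simp: subalgebra_def)
  show ?thesis
    unfolding indep_set_def
  proof (rule indep_setsI)
    show "(case x of True \<Rightarrow> sets G | False \<Rightarrow> {D -` A \<inter> space M |A. A \<in> sets borel}) \<subseteq> events" for x
      using GM by (cases x) auto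
    fix A :: "bool \<Rightarrow> 'a set" and J :: "bool set"
    assume J: "J \<noteq> {}" "J \<subseteq> UNIV" "finite J"
      "\<forall>j\<in>J. A j \<in> (case j of True \<Rightarrow> sets G | False \<Rightarrow> {D -` A \<inter> space M |A. A \<in> sets borel})"
    consider "J = {True}" | "J = {False}" | "J = UNIV"
      using J(1) by (metis (full_types) UNIV_bool UNIV_eq_I empty_iff insert_iff subset_singletonD subsetI insertCI)
    then show "prob (\<Inter>j\<in>J. A j) = (\<Prod>j\<in>J. prob (A j))"
    proof cases
      case 3
      have AT: "A True \<in> sets G" using bspec[OF J(4), of True] 3 by simp
      have "A False \<in> {D -` A \<inter> space M |A. A \<in> sets borel}"
        using bspec[OF J(4), of False] 3 by simp
      then obtain S where AF: "A False = D -` S \<inter> space M" "S \<in> sets borel" by auto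
      have "space M \<in> sets G" using sp by (metis sets.top)
      from indep_normal_conditional_law[OF assms this AF(2)]
      have "prob (A False) = measure (distr std_normal_distribution borel (\<lambda>x. sqrt v * x)) S"
        by (simp add: prob_space AF Int_absorb1)
      then show ?thesis
        using indep_normal_conditional_law[OF assms AT AF(2)]
        by (simp add: 3 UNIV_bool AF Int_commute mult.commute)
    qed auto
  qed
qed

lemma indep_set_compose:
  fixes D :: "'a \<Rightarrow> real" and \<xi> :: "'a \<Rightarrow> 'c::topological_space"
  assumes G: "subalgebra M G" and [measurable]: "D \<in> borel_measurable M"
    and ind: "indep_set (sets G) {D -` A \<inter> space M |A. A \<in> sets borel}"
    and \<xi>: "\<xi> \<in> borel_measurable G" and f [measurable]: "f \<in> borel_measurable borel"
  shows "indep_var borel \<xi> borel (\<lambda>\<omega>. f (D \<omega>))"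
proof -
  have sp: "space G = space M" using G by (simp add: subalgebra_def)
  have \<xi>M [measurable]: "\<xi> \<in> borel_measurable M" using \<xi> G by (rule measurable_from_subalg[rotated])
  let ?S = "{D -` A \<inter> space M |A. A \<in> sets borel}"
  have sD: "sigma_sets (space M) ?S = ?S"
    using sigma_sets_vimage_commute[of D "space M" UNIV "sets borel"]
      sets.sigma_sets_eq[of "borel :: real measure"] by auto
  have 1: "sigma_sets (space M) {\<xi> -` A \<inter> space M |A. A \<in> sets borel} \<subseteq> sets G"
    using \<xi> unfolding sp[symmetric] by (intro sets.sigma_sets_subset) (auto intro: measurable_sets)
  have "{(\<lambda>\<omega>. f (D \<omega>)) -` A \<inter> space M |A. A \<in> sets borel} \<subseteq> ?S"
  proof safe
    fix A :: "'c set" assume "A \<in> sets borel"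
    then have "f -` A \<in> sets borel" using measurable_sets[OF f] by simp
    then show "\<exists>A'. (\<lambda>\<omega>. f (D \<omega>)) -` A \<inter> space M = D -` A' \<inter> space M \<and> A' \<in> sets borel"
      by (intro exI[of _ "f -` A"]) auto
  qed
  from sigma_sets_mono'[OF this]
  have 2: "sigma_sets (space M) {(\<lambda>\<omega>. f (D \<omega>)) -` A \<inter> space M |A. A \<in> sets borel} \<subseteq> ?S"
    by (rule subset_trans) (rule equalityD1[OF sD])
  have "indep_set (sigma_sets (space M) {\<xi> -` A \<inter> space M |A. A \<in> sets borel})
      (sigma_sets (space M) {(\<lambda>\<omega>. f (D \<omega>)) -` A \<inter> space M |A. A \<in> sets borel})"
    unfolding indep_set_def
    by (rule indep_sets_mono[OF ind[unfolded indep_set_def]]) (use 1 2 in \<open>auto split: bool.split\<close>)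
  then show ?thesis unfolding indep_var_eq by simp
qed

lemma indep_normal_indep_var:
  fixes \<eta> :: "'a \<Rightarrow> real"
  assumes "subalgebra M G" "indep_normal M G v D" "\<eta> \<in> borel_measurable G" "f \<in> borel_measurable borel"
  shows "indep_var borel \<eta> borel (\<lambda>\<omega>. f (D \<omega>))"
  by (rule indep_set_compose[OF assms(1) indep_normal_measurable[OF assms(2)]
        indep_normal_indep_set[OF assms(1,2)] assms(3,4)])

lemma indep_normal_moments:
  assumes "subalgebra M G" "indep_normal M G v D"
  shows "integrable M D" "expectation D = 0" "integrable M (\<lambda>\<omega>. (D \<omega>)\<^sup>2)" "expectation (\<lambda>\<omega>. (D \<omega>)\<^sup>2) = v"
proof -
  have [measurable]: "D \<in> borel_measurable M" and v: "0 \<le> v"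
    using assms(2) by (auto simp: indep_normal_def)
  note law = indep_normal_distr[OF assms]
  have i1: "integrable std_normal_distribution (\<lambda>x. sqrt v * x)"
    and i2: "integrable std_normal_distribution (\<lambda>x. (sqrt v * x)\<^sup>2)"
    using integrable_std_normal_distribution_moment[of 1] integrable_std_normal_distribution_moment[of 2]
    by (auto simp: power_mult_distrib)
  have e1: "(\<integral>x. x \<partial>std_normal_distribution) = 0"
    using integral_std_normal_distribution_moment_odd[of 1] by simp
  have e2: "(\<integral>x. x\<^sup>2 \<partial>std_normal_distribution) = 1"
    using std_normal_distribution_even_moments(1)[of 1] by simp
  have tr: "integrable M (\<lambda>\<omega>. f (D \<omega>)) \<longleftrightarrow> integrable std_normal_distribution (\<lambda>x. f (sqrt v * x))"
    "expectation (\<lambda>\<omega>. f (D \<omega>)) = (\<integral>x. f (sqrt v * x) \<partial>std_normal_distribution)"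
    if "f \<in> borel_measurable borel" for f :: "real \<Rightarrow> real"
  proof -
    have "integrable M (\<lambda>\<omega>. f (D \<omega>)) \<longleftrightarrow> integrable (distr M borel D) f"
      using that by (subst integrable_distr_eq) auto
    also have "\<dots> \<longleftrightarrow> integrable std_normal_distribution (\<lambda>x. f (sqrt v * x))"
      unfolding law using that by (subst integrable_distr_eq) auto
    finally show "integrable M (\<lambda>\<omega>. f (D \<omega>)) \<longleftrightarrow> integrable std_normal_distribution (\<lambda>x. f (sqrt v * x))" .
    have "expectation (\<lambda>\<omega>. f (D \<omega>)) = integral\<^sup>L (distr M borel D) f"
      using that by (subst integral_distr) auto
    also have "\<dots> = (\<integral>x. f (sqrt v * x) \<partial>std_normal_distribution)"
      unfolding law using that by (subst integral_distr) auto
    finally show "expectation (\<lambda>\<omega>. f (D \<omega>)) = (\<integral>x. f (sqrt v * x) \<partial>std_normal_distribution)" .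
  qed
  show "integrable M D" using tr(1)[of "\<lambda>x. x"] i1 by simp
  show "expectation D = 0" using tr(2)[of "\<lambda>x. x"] e1 by simp
  show "integrable M (\<lambda>\<omega>. (D \<omega>)\<^sup>2)" using tr(1)[of "\<lambda>x. x\<^sup>2"] i2 by simp
  show "expectation (\<lambda>\<omega>. (D \<omega>)\<^sup>2) = v" using tr(2)[of "\<lambda>x. x\<^sup>2"] e2 v by (simp add: power_mult_distrib)
qed

lemma indep_normal_weighted_moments:
  assumes "subalgebra M G" "indep_normal M G v D" "\<eta> \<in> borel_measurable G" "integrable M \<eta>"
  shows "integrable M (\<lambda>\<omega>. \<eta> \<omega> * D \<omega>)" "expectation (\<lambda>\<omega>. \<eta> \<omega> * D \<omega>) = 0"
    "integrable M (\<lambda>\<omega>. \<eta> \<omega> * (D \<omega>)\<^sup>2)" "expectation (\<lambda>\<omega>. \<eta> \<omega> * (D \<omega>)\<^sup>2) = expectation \<eta> * v"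
proof -
  note mo = indep_normal_moments[OF assms(1,2)]
  have i1: "indep_var borel \<eta> borel D"
    using indep_normal_indep_var[OF assms(1-3), of "\<lambda>x. x"] by simp
  have i2: "indep_var borel \<eta> borel (\<lambda>\<omega>. (D \<omega>)\<^sup>2)"
    using indep_normal_indep_var[OF assms(1-3), of "\<lambda>x. x\<^sup>2"] by simp
  show "integrable M (\<lambda>\<omega>. \<eta> \<omega> * D \<omega>)" "expectation (\<lambda>\<omega>. \<eta> \<omega> * D \<omega>) = 0"
    using indep_var_integrable[OF i1 assms(4) mo(1)] indep_var_lebesgue_integral[OF i1 assms(4) mo(1)] mo
    by auto
  show "integrable M (\<lambda>\<omega>. \<eta> \<omega> * (D \<omega>)\<^sup>2)" "expectation (\<lambda>\<omega>. \<eta> \<omega> * (D \<omega>)\<^sup>2) = expectation \<eta> * v"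
    using indep_var_integrable[OF i2 assms(4) mo(3)] indep_var_lebesgue_integral[OF i2 assms(4) mo(3)] mo
    by auto
qed

lemma indep_normal_of_indep_set:
  assumes G: "subalgebra M G" and D [measurable]: "D \<in> borel_measurable M"
    and ind: "indep_set (sets G) {D -` A \<inter> space M |A. A \<in> sets borel}" and "0 \<le> v"
    and law: "distr M borel D = distr std_normal_distribution borel (\<lambda>x. sqrt v * x)"
  shows "indep_normal M G v D"
  unfolding indep_normal_def
proof (intro conjI allI ballI impI)
  show "D \<in> borel_measurable M" by fact
  show "0 \<le> v" by fact
  fix u and \<xi> :: "'a \<Rightarrow> complex"
  assume \<xi>: "\<xi> \<in> borel_measurable G" "\<forall>\<omega>\<in>space M. cmod (\<xi> \<omega>) \<le> 1"
  have \<xi>M: "\<xi> \<in> borel_measurable M" using \<xi>(1) G by (rule measurable_from_subalg[rotated])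
  have "indep_var borel \<xi> borel (\<lambda>\<omega>. iexp (u * D \<omega>))"
    by (rule indep_set_compose[OF G D ind \<xi>(1)]) simp
  moreover have "integrable M \<xi>" using \<xi>M \<xi>(2) by (intro integrable_bounded_complex) auto
  moreover have "integrable M (\<lambda>\<omega>. iexp (u * D \<omega>))"
    by (intro integrable_bounded_complex[where c=1]) auto
  ultimately have "(\<integral>\<omega>. \<xi> \<omega> * iexp (u * D \<omega>) \<partial>M) = (\<integral>\<omega>. \<xi> \<omega> \<partial>M) * (\<integral>\<omega>. iexp (u * D \<omega>) \<partial>M)"
    by (rule indep_var_lebesgue_integral)
  also have "(\<integral>\<omega>. iexp (u * D \<omega>) \<partial>M) = char (distr M borel D) u"
    unfolding char_def by (subst integral_distr) auto
  also have "\<dots> = exp (- (u\<^sup>2 * v / 2))"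
    unfolding law char_centred_normal using \<open>0 \<le> v\<close> by simp
  finally show "(\<integral>\<omega>. \<xi> \<omega> * iexp (u * D \<omega>) \<partial>M) = (\<integral>\<omega>. \<xi> \<omega> \<partial>M) * exp (- (u\<^sup>2 * v / 2))" .
qed

lemma iexp_diff_le: "cmod (iexp x - iexp y) \<le> \<bar>x - y\<bar>"
proof -
  have "cmod (iexp x - iexp y) = cmod (iexp y * (iexp (x - y) - 1))"
    by (simp add: algebra_simps exp_add[symmetric] flip: exp_diff)
  also have "\<dots> = cmod (iexp (x - y) - 1)" by (simp add: norm_mult)
  also have "\<dots> \<le> \<bar>x - y\<bar>" using iexp_approx1[of "x - y" 0] by simp
  finally show ?thesis .
qed

text \<open>Limits in probability preserve \<^const>\<open>indep_normal\<close>: the two sides of its defining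
  equation are continuous under bounded convergence.\<close>

lemma indep_normal_limit:
  assumes G: "subalgebra M G" and D [measurable]: "D \<in> borel_measurable M" and v: "0 \<le> v"
    and approx: "\<And>\<epsilon>. 0 < \<epsilon> \<Longrightarrow> \<exists>D' v'. indep_normal M G v' D' \<and> \<bar>v' - v\<bar> \<le> \<epsilon> \<and>
                   holds_up_to M \<epsilon> (\<lambda>\<omega>. \<bar>D' \<omega> - D \<omega>\<bar> \<le> \<epsilon>)"
  shows "indep_normal M G v D"
  unfolding indep_normal_def
proof (intro conjI allI ballI impI)
  fix u and \<xi> :: "'a \<Rightarrow> complex"
  assume \<xi>G: "\<xi> \<in> borel_measurable G" and \<xi>1: "\<forall>\<omega>\<in>space M. cmod (\<xi> \<omega>) \<le> 1"
  have \<xi> [measurable]: "\<xi> \<in> borel_measurable M" using \<xi>G G by (rule measurable_from_subalg[rotated])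
  let ?l = "\<integral>\<omega>. \<xi> \<omega> * iexp (u * D \<omega>) \<partial>M"
  let ?r = "(\<integral>\<omega>. \<xi> \<omega> \<partial>M) * exp (- (u\<^sup>2 * v / 2))"
  have "cmod (?l - ?r) \<le> 0 + e" if "0 < e" for e
  proof -
    define \<epsilon> where "\<epsilon> = e / (\<bar>u\<bar> + 2 + u\<^sup>2)"
    have den: "0 < \<bar>u\<bar> + 2 + u\<^sup>2" by (simp add: add_nonneg_pos add_pos_nonneg)
    then have \<epsilon>: "0 < \<epsilon>" using that by (simp add: \<epsilon>_def)
    obtain D' v' A where D': "indep_normal M G v' D'" and v': "\<bar>v' - v\<bar> \<le> \<epsilon>"
      and A [measurable]: "A \<in> sets M" and PA: "prob A \<le> \<epsilon>"
      and off: "\<And>\<omega>. \<omega> \<in> space M \<Longrightarrow> \<omega> \<notin> A \<Longrightarrow> \<bar>D' \<omega> - D \<omega>\<bar> \<le> \<epsilon>"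
      using approx[OF \<epsilon>] unfolding holds_up_to_def by blast
    have [measurable]: "D' \<in> borel_measurable M" and v'0: "0 \<le> v'"
      using D' by (auto simp: indep_normal_def)
    let ?l' = "\<integral>\<omega>. \<xi> \<omega> * iexp (u * D' \<omega>) \<partial>M"
    let ?r' = "(\<integral>\<omega>. \<xi> \<omega> \<partial>M) * exp (- (u\<^sup>2 * v' / 2))"
    have eq: "?l' = ?r'" using D' \<xi>G \<xi>1 unfolding indep_normal_def by blast
    have int: "integrable M (\<lambda>\<omega>. \<xi> \<omega> * iexp (u * D \<omega>))" "integrable M (\<lambda>\<omega>. \<xi> \<omega> * iexp (u * D' \<omega>))"
      using \<xi>1 by (auto intro!: integrable_bounded_complex[where c=1] simp: norm_mult)
    have iA: "integrable M (indicat_real A)"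
      by (intro integrable_real_indicator A) (simp add: less_top[symmetric])
    have "cmod (?l' - ?l) = cmod (\<integral>\<omega>. \<xi> \<omega> * iexp (u * D' \<omega>) - \<xi> \<omega> * iexp (u * D \<omega>) \<partial>M)"
      using int by simp
    also have "\<dots> \<le> (\<integral>\<omega>. cmod (\<xi> \<omega> * iexp (u * D' \<omega>) - \<xi> \<omega> * iexp (u * D \<omega>)) \<partial>M)"
      by (rule integral_norm_bound)
    also have "\<dots> \<le> (\<integral>\<omega>. \<bar>u\<bar> * \<epsilon> + 2 * indicator A \<omega> \<partial>M)"
    proof (rule integral_mono)
      show "integrable M (\<lambda>\<omega>. cmod (\<xi> \<omega> * iexp (u * D' \<omega>) - \<xi> \<omega> * iexp (u * D \<omega>)))"
        using int by auto
      show "integrable M (\<lambda>\<omega>. \<bar>u\<bar> * \<epsilon> + 2 * indicator A \<omega>)"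
        using iA by simp
      fix \<omega> assume \<omega>: "\<omega> \<in> space M"
      have "cmod (\<xi> \<omega> * iexp (u * D' \<omega>) - \<xi> \<omega> * iexp (u * D \<omega>)) =
          cmod (\<xi> \<omega>) * cmod (iexp (u * D' \<omega>) - iexp (u * D \<omega>))"
        by (simp add: norm_mult[symmetric] algebra_simps)
      also have "\<dots> \<le> cmod (iexp (u * D' \<omega>) - iexp (u * D \<omega>))"
        using \<xi>1 \<omega> by (intro mult_left_le_one_le) auto
      also have "\<dots> \<le> \<bar>u\<bar> * \<epsilon> + 2 * indicator A \<omega>"
      proof (cases "\<omega> \<in> A")
        case True
        have "cmod (iexp (u * D' \<omega>) - iexp (u * D \<omega>)) \<le> cmod (iexp (u * D' \<omega>)) + cmod (iexp (u * D \<omega>))"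
          by (rule norm_triangle_ineq4)
        also have "\<dots> = 2" by simp
        finally show ?thesis using True \<epsilon> by (simp add: add_increasing)
      next
        case False
        have "cmod (iexp (u * D' \<omega>) - iexp (u * D \<omega>)) \<le> \<bar>u * D' \<omega> - u * D \<omega>\<bar>"
          by (rule iexp_diff_le)
        also have "\<dots> = \<bar>u\<bar> * \<bar>D' \<omega> - D \<omega>\<bar>"
          by (simp add: abs_mult right_diff_distrib[symmetric])
        also have "\<dots> \<le> \<bar>u\<bar> * \<epsilon>" using off[OF \<omega> False] by (intro mult_left_mono) auto
        finally show ?thesis using False by simp
      qed
      finally show "cmod (\<xi> \<omega> * iexp (u * D' \<omega>) - \<xi> \<omega> * iexp (u * D \<omega>)) \<le> \<bar>u\<bar> * \<epsilon> + 2 * indicator A \<omega>" .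
    qed
    also have "\<dots> = \<bar>u\<bar> * \<epsilon> + 2 * prob A"
      using iA by (simp add: prob_space Int_absorb2 sets.sets_into_space)
    also have "\<dots> \<le> \<bar>u\<bar> * \<epsilon> + 2 * \<epsilon>" using PA by simp
    finally have 1: "cmod (?l' - ?l) \<le> \<bar>u\<bar> * \<epsilon> + 2 * \<epsilon>" .
    have "cmod (?r' - ?r) = cmod (\<integral>\<omega>. \<xi> \<omega> \<partial>M) * \<bar>exp (- (u\<^sup>2 * v' / 2)) - exp (- (u\<^sup>2 * v / 2))\<bar>"
      unfolding right_diff_distrib[symmetric] norm_mult
      by (simp flip: of_real_exp of_real_diff of_real_minus of_real_mult of_real_power)
    also have "\<dots> \<le> 1 * \<bar>exp (- (u\<^sup>2 * v' / 2)) - exp (- (u\<^sup>2 * v / 2))\<bar>"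
    proof (rule mult_right_mono)
      have "cmod (\<integral>\<omega>. \<xi> \<omega> \<partial>M) \<le> (\<integral>\<omega>. cmod (\<xi> \<omega>) \<partial>M)" by (rule integral_norm_bound)
      also have "\<dots> \<le> (\<integral>\<omega>. 1 \<partial>M)"
        using \<xi>1 integrable_bounded_complex[OF \<xi>] by (intro integral_mono) auto
      finally show "cmod (\<integral>\<omega>. \<xi> \<omega> \<partial>M) \<le> 1" by (simp add: prob_space)
    qed simp
    also have "\<dots> \<le> \<bar>u\<^sup>2 * v' / 2 - u\<^sup>2 * v / 2\<bar>"
    proof -
      have lip: "\<bar>exp (- a) - exp (- b)\<bar> \<le> \<bar>a - b\<bar>" if "0 \<le> a" "a \<le> b" for a b :: real
      proof -
        have "exp (- a) - exp (- b) = exp (- a) * (1 - exp (- (b - a)))"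
          by (simp add: algebra_simps flip: exp_add)
        also have "\<dots> \<le> 1 * (1 - exp (- (b - a)))"
          using that by (intro mult_right_mono) auto
        also have "\<dots> \<le> b - a"
        proof -
          have "1 * (1 - y) \<le> - x" if "1 + x \<le> y" for x y :: real using that by simp
          from this[OF exp_ge_add_one_self[of "- (b - a)"]] show ?thesis by (simp only: minus_minus)
        qed
        finally show ?thesis using that by simp
      qed
      have nn: "0 \<le> u\<^sup>2 * v' / 2" "0 \<le> u\<^sup>2 * v / 2" using v v'0 by auto
      show ?thesis
        using lip[OF nn(1), of "u\<^sup>2 * v / 2"] lip[OF nn(2), of "u\<^sup>2 * v' / 2"]
        by (cases "u\<^sup>2 * v' / 2 \<le> u\<^sup>2 * v / 2") (auto simp: abs_minus_commute)
    qed
    also have "\<dots> = u\<^sup>2 / 2 * \<bar>v' - v\<bar>"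
      by (simp add: abs_mult right_diff_distrib[symmetric] diff_divide_distrib[symmetric])
    also have "\<dots> \<le> u\<^sup>2 * \<epsilon>" using v' \<epsilon> by (intro mult_mono) auto
    finally have 2: "cmod (?r' - ?r) \<le> u\<^sup>2 * \<epsilon>" .
    have "cmod (?l - ?r) \<le> cmod (?r' - ?r) + cmod (?l' - ?l)"
      using norm_triangle_ineq4[of "?r' - ?r" "?l' - ?l"] unfolding eq by simp
    also have "\<dots> \<le> (\<bar>u\<bar> + 2 + u\<^sup>2) * \<epsilon>" using 1 2 by (simp add: algebra_simps)
    also have "\<dots> = e" using den by (simp add: \<epsilon>_def)
    finally show ?thesis by simp
  qed
  then have "cmod (?l - ?r) \<le> 0" by (rule field_le_epsilon)
  then show "?l = ?r" by simp
qed (use v in auto)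

end


section \<open>Grids\<close>

definition grid :: "real \<Rightarrow> real \<Rightarrow> real \<Rightarrow> nat \<Rightarrow> (nat \<Rightarrow> real) \<Rightarrow> bool" where
  "grid a c \<delta> K \<rho> \<longleftrightarrow> \<rho> 0 = a \<and> \<rho> K = c \<and> (\<forall>j<K. \<rho> j \<le> \<rho> (Suc j) \<and> \<rho> (Suc j) - \<rho> j \<le> \<delta>)"

definition increment_sum :: "nat \<Rightarrow> (nat \<Rightarrow> real) \<Rightarrow> (nat \<Rightarrow> real) \<Rightarrow> (real \<Rightarrow> real) \<Rightarrow> real" where
  "increment_sum K \<rho> x z = (\<Sum>j<K. x j * (z (\<rho> (Suc j)) - z (\<rho> j)))"

lemma grid_mono:
  assumes "grid a c \<delta> K \<rho>" "i \<le> j" "j \<le> K"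
  shows "\<rho> i \<le> \<rho> j"
  using assms(2,3)
proof (induction j rule: dec_induct)
  case (step j)
  then show ?case using assms(1) unfolding grid_def by (meson Suc_le_lessD le_less_trans less_imp_le order_trans)
qed simp

lemma grid_range:
  assumes "grid a c \<delta> K \<rho>" "j \<le> K"
  shows "a \<le> \<rho> j" "\<rho> j \<le> c"
  using grid_mono[OF assms(1), of 0 j] grid_mono[OF assms(1), of j K] assms by (auto simp: grid_def)

lemma increment_sum_const:
  assumes "grid a c \<delta> K \<rho>"
  shows "increment_sum K \<rho> (\<lambda>_. x) z = x * (z c - z a)"
proof -
  have "increment_sum K \<rho> (\<lambda>_. x) z = x * (\<Sum>j<K. z (\<rho> (Suc j)) - z (\<rho> j))"
    by (simp add: increment_sum_def sum_distrib_left)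
  also have "(\<Sum>j<K. z (\<rho> (Suc j)) - z (\<rho> j)) = z c - z a"
    using sum_lessThan_telescope[of "\<lambda>j. z (\<rho> j)" K] assms by (simp add: grid_def)
  finally show ?thesis .
qed

lemma increment_sum_diff:
  "increment_sum K \<rho> x z - increment_sum K \<rho> y z = increment_sum K \<rho> (\<lambda>j. x j - y j) z"
  by (simp add: increment_sum_def sum_subtractf[symmetric] algebra_simps)

lemma increment_sum_by_parts:
  assumes "grid a c \<delta> K \<rho>"
  shows "increment_sum K \<rho> (\<lambda>j. y (\<rho> j)) z + increment_sum K \<rho> (\<lambda>j. z (\<rho> (Suc j))) y = y c * z c - y a * z a"
proof -
  have "increment_sum K \<rho> (\<lambda>j. y (\<rho> j)) z + increment_sum K \<rho> (\<lambda>j. z (\<rho> (Suc j))) y =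
      (\<Sum>j<K. y (\<rho> (Suc j)) * z (\<rho> (Suc j)) - y (\<rho> j) * z (\<rho> j))"
    by (simp add: increment_sum_def sum.distrib[symmetric] algebra_simps)
  also have "\<dots> = y c * z c - y a * z a"
    using sum_lessThan_telescope[of "\<lambda>j. y (\<rho> j) * z (\<rho> j)" K] assms by (simp add: grid_def)
  finally show ?thesis .
qed

lemma increment_sum_cong:
  assumes "\<And>j. j < K \<Longrightarrow> \<rho> j < \<rho> (Suc j) \<Longrightarrow> x j = y j" "grid a c \<delta> K \<rho>"
  shows "increment_sum K \<rho> x z = increment_sum K \<rho> y z"
  unfolding increment_sum_def
proof (rule sum.cong)
  fix j assume "j \<in> {..<K}"
  then have "\<rho> j < \<rho> (Suc j) \<or> \<rho> j = \<rho> (Suc j)" using assms(2) by (auto simp: grid_def)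
  then show "x j * (z (\<rho> (Suc j)) - z (\<rho> j)) = y j * (z (\<rho> (Suc j)) - z (\<rho> j))"
    using assms(1) \<open>j \<in> {..<K}\<close> by auto
qed simp

text \<open>Every interval of a grid is cut into \<open>m\<close> equal pieces; \<open>f j\<close> is the old interval that contains
  the \<open>j\<close>-th new one.\<close>

lemma grid_refinement:
  assumes \<tau>: "grid a c \<Delta> k \<tau>" and "0 < \<delta>"
  obtains K \<rho> f where "grid a c \<delta> K \<rho>"
    "\<And>j. j < K \<Longrightarrow> f j < k \<and> \<tau> (f j) \<le> \<rho> j \<and> \<rho> (Suc j) \<le> \<tau> (Suc (f j))"
    "\<And>x z. increment_sum K \<rho> (\<lambda>j. x (f j)) z = increment_sum k \<tau> x z"
proof -
  obtain m0 :: nat where m0: "(c - a) / \<delta> \<le> real m0" using real_arch_simple by blast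
  define m where "m = Suc m0"
  have m: "0 < m" "c - a \<le> \<delta> * real m"
    using m0 \<open>0 < \<delta>\<close> by (auto simp: m_def field_simps intro: order_trans)
  define p where "p i l = \<tau> i + real l / real m * (\<tau> (Suc i) - \<tau> i)" for i l
  define \<rho> where "\<rho> j = p (j div m) (j mod m)" for j
  have p_end: "p i m = \<tau> (Suc i)" "p i 0 = \<tau> i" for i
    using m by (auto simp: p_def)
  have \<rho>1: "\<rho> (i * m + l) = p i l" if "l < m" for i l
    using that by (simp add: \<rho>_def)
  have \<rho>2: "\<rho> (Suc (i * m + l)) = p i (Suc l)" if "l < m" for i l
  proof (cases "Suc l = m")
    case True
    then have "Suc (i * m + l) = Suc i * m + 0" by simp
    from arg_cong[OF this, of \<rho>] have "\<rho> (Suc (i * m + l)) = p (Suc i) 0"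
      unfolding \<rho>1[OF m(1)] .
    then show ?thesis using p_end True by simp
  next
    case False
    then show ?thesis using \<rho>1[of "Suc l" i] that by simp
  qed
  have dec: "\<exists>i l. j = i * m + l \<and> l < m \<and> j div m = i \<and> i < k" if "j < k * m" for j
    using m(1) that by (intro exI[of _ "j div m"] exI[of _ "j mod m"]) (auto simp: less_mult_imp_div_less)
  have step: "\<tau> i \<le> \<tau> (Suc i) \<and> \<tau> (Suc i) - \<tau> i \<le> c - a" if "i < k" for i
    using that \<tau> grid_range[OF \<tau>, of i] grid_range[OF \<tau>, of "Suc i"] by (auto simp: grid_def)
  have p_bd: "\<tau> i \<le> p i l \<and> p i l \<le> p i (Suc l) \<and> p i (Suc l) \<le> \<tau> (Suc i) \<and> p i (Suc l) - p i l \<le> \<delta>"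
    if "i < k" "l < m" for i l
  proof -
    let ?d = "\<tau> (Suc i) - \<tau> i"
    have d: "0 \<le> ?d" "?d \<le> \<delta> * real m" using step[OF that(1)] m(2) by auto
    have 1: "p i (Suc l) - p i l = ?d / real m"
      by (simp add: p_def distrib_right add_divide_distrib)
    have 2: "?d / real m \<le> \<delta>" "0 \<le> ?d / real m" using d m(1) by (simp_all add: divide_le_eq)
    have "real (Suc l) / real m * ?d \<le> 1 * ?d"
      using that(2) d by (intro mult_right_mono) (auto simp: divide_le_eq)
    then have 3: "p i (Suc l) \<le> \<tau> (Suc i)" unfolding p_def by (simp only: mult_1 le_diff_eq add.commute)
    have 4: "\<tau> i \<le> p i l" unfolding p_def using d by simp
    show ?thesis using 1 2 3 4 by simp
  qed
  show ?thesis
  proof (rule that[of "k * m" \<rho> "\<lambda>j. j div m"])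
    have "\<rho> 0 = a" using \<rho>1[of 0 0] m p_end \<tau> by (simp add: grid_def)
    moreover have "\<rho> (k * m) = c" using \<rho>1[of 0 k] m p_end \<tau> by (simp add: grid_def)
    moreover have "\<rho> j \<le> \<rho> (Suc j) \<and> \<rho> (Suc j) - \<rho> j \<le> \<delta>" if j: "j < k * m" for j
      using dec[OF j] p_bd \<rho>1 \<rho>2 by fastforce
    ultimately show "grid a c \<delta> (k * m) \<rho>" by (auto simp: grid_def)
    show "j div m < k \<and> \<tau> (j div m) \<le> \<rho> j \<and> \<rho> (Suc j) \<le> \<tau> (Suc (j div m))" if j: "j < k * m" for j
      using dec[OF j] p_bd \<rho>1 \<rho>2 by fastforce
    fix x :: "nat \<Rightarrow> real" and z :: "real \<Rightarrow> real"
    have "increment_sum (k * m) \<rho> (\<lambda>j. x (j div m)) z =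
        (\<Sum>i<k. \<Sum>j\<in>{i * m..<i * m + m}. x (j div m) * (z (\<rho> (Suc j)) - z (\<rho> j)))"
      unfolding increment_sum_def by (rule sum.nat_group[symmetric])
    also have "\<dots> = (\<Sum>i<k. x i * (z (\<tau> (Suc i)) - z (\<tau> i)))"
    proof (rule sum.cong)
      fix i
      have "(\<Sum>j\<in>{i * m..<i * m + m}. x (j div m) * (z (\<rho> (Suc j)) - z (\<rho> j))) =
          (\<Sum>l<m. x ((i * m + l) div m) * (z (\<rho> (Suc (i * m + l))) - z (\<rho> (i * m + l))))"
        using sum.shift_bounds_nat_ivl[of "\<lambda>j. x (j div m) * (z (\<rho> (Suc j)) - z (\<rho> j))" 0 "i * m" m]
        by (simp add: atLeast0LessThan add.commute)
      also have "\<dots> = (\<Sum>l<m. x i * (z (p i (Suc l)) - z (p i l)))"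
      proof (rule sum.cong)
        fix l assume "l \<in> {..<m}"
        then have l: "l < m" by simp
        then have "(i * m + l) div m = i" by simp
        then show "x ((i * m + l) div m) * (z (\<rho> (Suc (i * m + l))) - z (\<rho> (i * m + l))) =
            x i * (z (p i (Suc l)) - z (p i l))"
          by (simp only: \<rho>1[OF l] \<rho>2[OF l])
      qed simp
      also have "\<dots> = x i * (\<Sum>l<m. z (p i (Suc l)) - z (p i l))"
        by (simp add: sum_distrib_left)
      also have "\<dots> = x i * (z (\<tau> (Suc i)) - z (\<tau> i))"
        by (simp add: sum_lessThan_telescope[of "\<lambda>l. z (p i l)"] p_end)
      finally show "(\<Sum>j\<in>{i * m..<i * m + m}. x (j div m) * (z (\<rho> (Suc j)) - z (\<rho> j))) =
          x i * (z (\<tau> (Suc i)) - z (\<tau> i))" .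
    qed simp
    finally show "increment_sum (k * m) \<rho> (\<lambda>j. x (j div m)) z = increment_sum k \<tau> x z"
      by (simp add: increment_sum_def)
  qed
qed

lemma grid_exists:
  assumes "a \<le> c" "0 < \<delta>"
  obtains K \<rho> where "grid a c \<delta> K \<rho>"
proof -
  have "grid a c (c - a) 1 (\<lambda>i. if i = 0 then a else c)" using assms(1) by (simp add: grid_def)
  from grid_refinement[OF this assms(2)] that show ?thesis by metis
qed


lemma grid_weaken: "grid a c \<delta> K \<rho> \<Longrightarrow> \<delta> \<le> \<delta>' \<Longrightarrow> grid a c \<delta>' K \<rho>"
  by (force simp: grid_def)

lemma grid_sequence:
  assumes "a \<le> c"
  obtains K \<rho> where "\<And>n. grid a c (1 / real (Suc n)) (K n) (\<rho> n)"
proof -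
  have "\<exists>K \<rho>. grid a c (1 / real (Suc n)) K \<rho>" for n
    by (rule grid_exists[OF assms, of "1 / real (Suc n)"]) auto
  then show ?thesis using that by metis
qed

text \<open>Almost sure statements need a countable family of grids that is chosen before the path.\<close>

lemma grid_sequence_limit:
  fixes \<Phi> :: "nat \<Rightarrow> (nat \<Rightarrow> real) \<Rightarrow> real"
  assumes G: "\<And>n. grid a c (1 / real (Suc n)) (K n) (\<rho> n)"
    and lim: "\<And>\<epsilon>. 0 < \<epsilon> \<Longrightarrow> \<exists>\<delta>>0. \<forall>K \<rho>. grid a c \<delta> K \<rho> \<longrightarrow> \<bar>\<Phi> K \<rho> - L\<bar> \<le> \<epsilon>"
  shows "(\<lambda>n. \<Phi> (K n) (\<rho> n)) \<longlonglongrightarrow> L"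
proof (rule LIMSEQ_I)
  fix r :: real assume "0 < r"
  then obtain \<delta> where \<delta>: "0 < \<delta>" "\<And>K \<rho>. grid a c \<delta> K \<rho> \<Longrightarrow> \<bar>\<Phi> K \<rho> - L\<bar> \<le> r / 2"
    using lim[of "r / 2"] by auto
  obtain N where N: "1 / real (Suc N) < \<delta>"
    using \<delta>(1) reals_Archimedean by (auto simp: inverse_eq_divide)
  have "norm (\<Phi> (K n) (\<rho> n) - L) < r" if "N \<le> n" for n
  proof -
    have "1 / real (Suc n) \<le> \<delta>"
      using N that by (intro order_trans[OF _ less_imp_le[OF N]]) (simp add: divide_simps)
    from \<delta>(2)[OF grid_weaken[OF G this]] \<open>0 < r\<close> show ?thesis by simp
  qed
  then show "\<exists>no. \<forall>n\<ge>no. norm (\<Phi> (K n) (\<rho> n) - L) < r" by blast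
qed


section \<open>The time axis\<close>

lemma times_upto_downward: "t \<in> times_upto T \<Longrightarrow> 0 \<le> s \<Longrightarrow> s \<le> t \<Longrightarrow> s \<in> times_upto T"
  by (auto simp: times_upto_def) (metis ereal_less_eq(3) order_le_less_trans)

lemma Icc_subset_times_upto: "t \<in> times_upto T \<Longrightarrow> 0 \<le> s \<Longrightarrow> {s..t} \<subseteq> times_upto T"
  by (auto intro: times_upto_downward)

text \<open>The time axis is open on the right, so a neighbourhood of each of its points lies in a compact initial interval.\<close>

lemma continuous_on_times_upto:
  assumes "\<And>t. t \<in> times_upto T \<Longrightarrow> continuous_on {0..t} f"
  shows "continuous_on (times_upto T) f"
proof -
  have "continuous (at x within times_upto T) f" if x: "x \<in> times_upto T" for x
  proof -
    have "ereal x < T" using x by (simp add: times_upto_def)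
    then obtain z where z: "ereal x < z" "z < T" using dense by blast
    then obtain y where y: "z = ereal y" using x by (cases z) auto
    have yt: "y \<in> times_upto T" using z x by (auto simp: y times_upto_def)
    have xy: "x < y" using z by (simp add: y)
    have "continuous (at x within {0..y}) f"
      using assms[OF yt] x xy by (auto simp: continuous_on_eq_continuous_within times_upto_def)
    moreover have "at x within times_upto T = at x within {0..y}"
      using xy yt by (intro at_within_nhd[where S="{..<y}"]) (use times_upto_downward[OF yt] in \<open>auto simp: times_upto_def\<close>)
    ultimately show ?thesis by simp
  qed
  then show ?thesis by (simp add: continuous_on_eq_continuous_within)
qed

lemma up_to_eventually_ge:
  assumes "u \<in> times_upto T"
  shows "\<forall>\<^sub>F t in up_to T. t \<in> times_upto T \<and> u \<le> t"
proof (cases T)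
  case (real r)
  have u: "0 \<le> u" "u < r" using assms real by (auto simp: times_upto_def)
  have "\<forall>\<^sub>F t in at_left r. u < t \<and> t < r"
    using u by (auto simp: eventually_at_left)
  then show ?thesis
    unfolding real up_to_finite by eventually_elim (use u in \<open>auto simp: times_upto_def\<close>)
next
  case PInf
  have "\<forall>\<^sub>F t in at_top. u \<le> t" by (rule eventually_ge_at_top)
  then show ?thesis
    unfolding PInf up_to_infinity by eventually_elim (use assms in \<open>auto simp: times_upto_def\<close>)
qed (use assms in \<open>auto simp: times_upto_def\<close>)

lemma up_to_nontrivial: "0 < T \<Longrightarrow> up_to T \<noteq> bot"
  by (cases T) (auto simp: up_to_finite up_to_infinity)


section \<open>Processes with independent Gaussian increments\<close>

text \<open>Up to continuity of the paths, \<open>Z\<close> is a Brownian motion run with the deterministic clock \<open>Q\<close>.\<close>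

definition gaussian_increments ::
    "'a measure \<Rightarrow> (real \<Rightarrow> 'a measure) \<Rightarrow> ereal \<Rightarrow> (real \<Rightarrow> real) \<Rightarrow> (real \<Rightarrow> 'a \<Rightarrow> real) \<Rightarrow> bool" where
  "gaussian_increments M F T Q Z \<longleftrightarrow>
     (\<forall>t\<in>times_upto T. Z t \<in> borel_measurable (F t)) \<and>
     (\<forall>s\<in>times_upto T. \<forall>t\<in>times_upto T. s \<le> t \<longrightarrow>
        indep_normal M (F s) (Q t - Q s) (\<lambda>\<omega>. Z t \<omega> - Z s \<omega>))"

locale filtered_space = prob_space M for M :: "'a measure" +
  fixes F :: "real \<Rightarrow> 'a measure" and T :: ereal
  assumes subalg: "t \<in> times_upto T \<Longrightarrow> subalgebra M (F t)"
    and sets_mono: "s \<in> times_upto T \<Longrightarrow> t \<in> times_upto T \<Longrightarrow> s \<le> t \<Longrightarrow> sets (F s) \<subseteq> sets (F t)"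
begin

lemma F_mono: "f \<in> borel_measurable (F s) \<Longrightarrow> s \<in> times_upto T \<Longrightarrow> t \<in> times_upto T \<Longrightarrow> s \<le> t \<Longrightarrow>
    f \<in> borel_measurable (F t)"
proof -
  assume f: "f \<in> borel_measurable (F s)" and st: "s \<in> times_upto T" "t \<in> times_upto T" "s \<le> t"
  have "subalgebra (F t) (F s)"
    using subalg[OF st(1)] subalg[OF st(2)] sets_mono[OF st] unfolding subalgebra_def by simp
  then show "f \<in> borel_measurable (F t)" using f by (rule measurable_from_subalg)
qed

lemma F_M: "f \<in> borel_measurable (F t) \<Longrightarrow> t \<in> times_upto T \<Longrightarrow> f \<in> borel_measurable M"
  by (rule measurable_from_subalg[OF subalg])

lemma gaussian_increments_measurable:
  "gaussian_increments M F T Q Z \<Longrightarrow> t \<in> times_upto T \<Longrightarrow> Z t \<in> borel_measurable (F t)"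
  by (auto simp: gaussian_increments_def)

lemma gaussian_increments_var_mono:
  "gaussian_increments M F T Q Z \<Longrightarrow> s \<in> times_upto T \<Longrightarrow> t \<in> times_upto T \<Longrightarrow> s \<le> t \<Longrightarrow> Q s \<le> Q t"
  by (force simp: gaussian_increments_def indep_normal_def)

lemma grid_times:
  assumes "grid a c \<delta> K \<rho>" "0 \<le> a" "c \<in> times_upto T" "j \<le> K"
  shows "\<rho> j \<in> times_upto T"
  using grid_range[OF assms(1,4)] assms by (auto intro: times_upto_downward)

text \<open>The factor belonging to the last increment is split off; everything else is measurable at the
  start of that increment.\<close>

lemma gaussian_increment_sum:
  assumes Z: "gaussian_increments M F T Q Z" and \<rho>: "grid a c \<delta> K \<rho>" and a: "0 \<le> a" and c: "c \<in> times_upto T"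
  shows "indep_normal M (F a) (increment_sum K \<rho> (\<lambda>j. (x j)\<^sup>2) Q)
           (\<lambda>\<omega>. increment_sum K \<rho> x (\<lambda>t. Z t \<omega>))"
proof -
  have t: "\<rho> j \<in> times_upto T" if "j \<le> K" for j using grid_times[OF \<rho> a c that] .
  have ZF: "Z (\<rho> i) \<in> borel_measurable (F (\<rho> j))" if "i \<le> j" "j \<le> K" for i j
    using F_mono[OF gaussian_increments_measurable[OF Z t] t t grid_mono[OF \<rho> that]] that by simp
  have "indep_normal M (F a) (\<Sum>j<n. (x j)\<^sup>2 * (Q (\<rho> (Suc j)) - Q (\<rho> j)))
      (\<lambda>\<omega>. \<Sum>j<n. x j * (Z (\<rho> (Suc j)) \<omega> - Z (\<rho> j) \<omega>))" if "n \<le> K" for n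
    using that
  proof (induction n)
    case 0
    then show ?case by (simp add: indep_normal_def)
  next
    case (Suc n)
    let ?D = "\<lambda>\<omega>. Z (\<rho> (Suc n)) \<omega> - Z (\<rho> n) \<omega>" and ?S = "\<lambda>\<omega>. \<Sum>j<n. x j * (Z (\<rho> (Suc j)) \<omega> - Z (\<rho> j) \<omega>)"
    let ?v = "\<Sum>j<n. (x j)\<^sup>2 * (Q (\<rho> (Suc j)) - Q (\<rho> j))" and ?w = "Q (\<rho> (Suc n)) - Q (\<rho> n)"
    have n: "n < K" using Suc by simp
    then have IH: "indep_normal M (F a) ?v ?S" using Suc by simp
    have inc: "indep_normal M (F (\<rho> n)) ?w ?D"
      using Z n t[of n] t[of "Suc n"] \<rho> by (auto simp: gaussian_increments_def grid_def)
    have SF: "?S \<in> borel_measurable (F (\<rho> n))"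
      using n by (intro borel_measurable_sum borel_measurable_times borel_measurable_diff ZF) auto
    have SM: "?S \<in> borel_measurable M" "?D \<in> borel_measurable M"
      using IH inc by (auto simp: indep_normal_def)
    have vw: "0 \<le> ?v" "0 \<le> ?w" using IH inc by (auto simp: indep_normal_def)
    show ?case
      unfolding indep_normal_def
    proof (intro conjI allI ballI impI)
      show "(\<lambda>\<omega>. \<Sum>j<Suc n. x j * (Z (\<rho> (Suc j)) \<omega> - Z (\<rho> j) \<omega>)) \<in> borel_measurable M"
        using SM by simp
      show "0 \<le> (\<Sum>j<Suc n. (x j)\<^sup>2 * (Q (\<rho> (Suc j)) - Q (\<rho> j)))" using vw by simp
      fix u and \<xi> :: "'a \<Rightarrow> complex"
      assume \<xi>: "\<xi> \<in> borel_measurable (F a)" "\<forall>\<omega>\<in>space M. cmod (\<xi> \<omega>) \<le> 1"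
      have \<xi>n: "\<xi> \<in> borel_measurable (F (\<rho> n))"
        using \<xi>(1) t[of 0] t[of n] n grid_mono[OF \<rho>, of 0 n] \<rho>
        by (intro F_mono[OF \<xi>(1)]) (auto simp: grid_def)
      define \<eta> where "\<eta> \<omega> = \<xi> \<omega> * iexp (u * ?S \<omega>)" for \<omega>
      have \<eta>: "\<eta> \<in> borel_measurable (F (\<rho> n))" "\<forall>\<omega>\<in>space M. cmod (\<eta> \<omega>) \<le> 1"
      proof -
        have "(\<lambda>\<omega>. iexp (u * ?S \<omega>)) \<in> borel_measurable (F (\<rho> n))"
          by (rule measurable_compose[OF SF]) simp
        with \<xi>n show "\<eta> \<in> borel_measurable (F (\<rho> n))" unfolding \<eta>_def by (rule borel_measurable_times)
        show "\<forall>\<omega>\<in>space M. cmod (\<eta> \<omega>) \<le> 1" unfolding \<eta>_def using \<xi>(2) by (simp add: norm_mult)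
      qed
      have "(\<integral>\<omega>. \<xi> \<omega> * iexp (u * (\<Sum>j<Suc n. x j * (Z (\<rho> (Suc j)) \<omega> - Z (\<rho> j) \<omega>))) \<partial>M) =
          (\<integral>\<omega>. \<eta> \<omega> * iexp ((u * x n) * ?D \<omega>) \<partial>M)"
        by (simp add: \<eta>_def distrib_left exp_add mult.assoc)
      also have "\<dots> = (\<integral>\<omega>. \<eta> \<omega> \<partial>M) * exp (- ((u * x n)\<^sup>2 * ?w / 2))"
        using inc \<eta> unfolding indep_normal_def by blast
      also have "(\<integral>\<omega>. \<eta> \<omega> \<partial>M) = (\<integral>\<omega>. \<xi> \<omega> \<partial>M) * exp (- (u\<^sup>2 * ?v / 2))"
        unfolding \<eta>_def using IH \<xi> unfolding indep_normal_def by blast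
      also have "(\<integral>\<omega>. \<xi> \<omega> \<partial>M) * complex_of_real (exp (- (u\<^sup>2 * ?v / 2))) * complex_of_real (exp (- ((u * x n)\<^sup>2 * ?w / 2))) =
          (\<integral>\<omega>. \<xi> \<omega> \<partial>M) * complex_of_real (exp (- (u\<^sup>2 * ?v / 2)) * exp (- ((u * x n)\<^sup>2 * ?w / 2)))"
        by (simp only: of_real_mult mult.assoc)
      also have "exp (- (u\<^sup>2 * ?v / 2)) * exp (- ((u * x n)\<^sup>2 * ?w / 2)) =
          exp (- (u\<^sup>2 * (\<Sum>j<Suc n. (x j)\<^sup>2 * (Q (\<rho> (Suc j)) - Q (\<rho> j))) / 2))"
        unfolding exp_add[symmetric] by (rule arg_cong[of _ _ exp]) (simp add: power_mult_distrib, argo)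
      finally show "(\<integral>\<omega>. \<xi> \<omega> * iexp (u * (\<Sum>j<Suc n. x j * (Z (\<rho> (Suc j)) \<omega> - Z (\<rho> j) \<omega>))) \<partial>M) =
          (\<integral>\<omega>. \<xi> \<omega> \<partial>M) * exp (- (u\<^sup>2 * (\<Sum>j<Suc n. (x j)\<^sup>2 * (Q (\<rho> (Suc j)) - Q (\<rho> j))) / 2))" .
    qed
  qed
  from this[of K] show ?thesis by (simp add: increment_sum_def)
qed

text \<open>The isometry of the elementary stochastic integral: each increment is centred given the past,
  so the mixed terms vanish.\<close>

lemma increment_sum_isometry:
  assumes Z: "gaussian_increments M F T Q Z" and \<rho>: "grid a c \<delta> K \<rho>" and a: "0 \<le> a" and c: "c \<in> times_upto T"
    and \<eta>: "\<And>j. j < K \<Longrightarrow> \<eta> j \<in> borel_measurable (F (\<rho> j))"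
    and sq: "\<And>j. j < K \<Longrightarrow> integrable M (\<lambda>\<omega>. (\<eta> j \<omega>)\<^sup>2)"
  shows "integrable M (\<lambda>\<omega>. (increment_sum K \<rho> (\<lambda>j. \<eta> j \<omega>) (\<lambda>t. Z t \<omega>))\<^sup>2)"
    and "expectation (\<lambda>\<omega>. (increment_sum K \<rho> (\<lambda>j. \<eta> j \<omega>) (\<lambda>t. Z t \<omega>))\<^sup>2) =
         increment_sum K \<rho> (\<lambda>j. expectation (\<lambda>\<omega>. (\<eta> j \<omega>)\<^sup>2)) Q"
proof -
  have t: "\<rho> j \<in> times_upto T" if "j \<le> K" for j using grid_times[OF \<rho> a c that] .
  let ?S = "\<lambda>n \<omega>. \<Sum>j<n. \<eta> j \<omega> * (Z (\<rho> (Suc j)) \<omega> - Z (\<rho> j) \<omega>)"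
  have "?S n \<in> borel_measurable (F (\<rho> n)) \<and> integrable M (\<lambda>\<omega>. (?S n \<omega>)\<^sup>2) \<and>
      expectation (\<lambda>\<omega>. (?S n \<omega>)\<^sup>2) = (\<Sum>j<n. expectation (\<lambda>\<omega>. (\<eta> j \<omega>)\<^sup>2) * (Q (\<rho> (Suc j)) - Q (\<rho> j)))"
    if "n \<le> K" for n
    using that
  proof (induction n)
    case 0
    then show ?case by simp
  next
    case (Suc n)
    let ?D = "\<lambda>\<omega>. Z (\<rho> (Suc n)) \<omega> - Z (\<rho> n) \<omega>"
    have n: "n < K" "\<rho> n \<le> \<rho> (Suc n)" using Suc \<rho> by (auto simp: grid_def)
    have IH: "?S n \<in> borel_measurable (F (\<rho> n))" "integrable M (\<lambda>\<omega>. (?S n \<omega>)\<^sup>2)"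
      "expectation (\<lambda>\<omega>. (?S n \<omega>)\<^sup>2) = (\<Sum>j<n. expectation (\<lambda>\<omega>. (\<eta> j \<omega>)\<^sup>2) * (Q (\<rho> (Suc j)) - Q (\<rho> j)))"
      using Suc by auto
    have inc: "indep_normal M (F (\<rho> n)) (Q (\<rho> (Suc n)) - Q (\<rho> n)) ?D"
      using Z n t[of n] t[of "Suc n"] by (auto simp: gaussian_increments_def)
    note sub = subalg[OF t[OF less_imp_le[OF n(1)]]]
    have up: "f \<in> borel_measurable (F (\<rho> (Suc n)))" if "f \<in> borel_measurable (F (\<rho> n))" for f :: "'a \<Rightarrow> real"
      by (rule F_mono[OF that]) (use n t in auto)
    have D: "?D \<in> borel_measurable (F (\<rho> (Suc n)))"
      using up[OF gaussian_increments_measurable[OF Z t[of n]]] gaussian_increments_measurable[OF Z t[of "Suc n"]] n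
      by (intro borel_measurable_diff) auto
    have meas: "?S (Suc n) \<in> borel_measurable (F (\<rho> (Suc n)))"
      using up[OF IH(1)] up[OF \<eta>[OF n(1)]] D by simp
    have prod: "integrable M (\<lambda>\<omega>. 2 * ?S n \<omega> * \<eta> n \<omega>)"
    proof (rule Bochner_Integration.integrable_bound)
      show "integrable M (\<lambda>\<omega>. (?S n \<omega>)\<^sup>2 + (\<eta> n \<omega>)\<^sup>2)" using IH(2) sq[OF n(1)] by simp
      show "(\<lambda>\<omega>. 2 * ?S n \<omega> * \<eta> n \<omega>) \<in> borel_measurable M"
        using F_M[OF IH(1)] F_M[OF \<eta>[OF n(1)]] t n by simp
      show "AE \<omega> in M. norm (2 * ?S n \<omega> * \<eta> n \<omega>) \<le> norm ((?S n \<omega>)\<^sup>2 + (\<eta> n \<omega>)\<^sup>2)"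
      proof (rule AE_I2)
        fix \<omega>
        show "norm (2 * ?S n \<omega> * \<eta> n \<omega>) \<le> norm ((?S n \<omega>)\<^sup>2 + (\<eta> n \<omega>)\<^sup>2)"
          using sum_squares_bound[of "\<bar>?S n \<omega>\<bar>" "\<bar>\<eta> n \<omega>\<bar>"] by (simp add: abs_mult)
      qed
    qed
    note w1 = indep_normal_weighted_moments[OF sub inc _ prod]
    have pm: "(\<lambda>\<omega>. 2 * ?S n \<omega> * \<eta> n \<omega>) \<in> borel_measurable (F (\<rho> n))"
      using IH(1) \<eta>[OF n(1)] by simp
    have sm: "(\<lambda>\<omega>. (\<eta> n \<omega>)\<^sup>2) \<in> borel_measurable (F (\<rho> n))"
      using \<eta>[OF n(1)] by simp
    note w2 = indep_normal_weighted_moments[OF sub inc sm sq[OF n(1)]]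
    have ex: "(?S (Suc n) \<omega>)\<^sup>2 = (?S n \<omega>)\<^sup>2 + 2 * ?S n \<omega> * \<eta> n \<omega> * ?D \<omega> + (\<eta> n \<omega>)\<^sup>2 * (?D \<omega>)\<^sup>2" for \<omega>
      by (simp add: power2_eq_square algebra_simps)
    have "integrable M (\<lambda>\<omega>. (?S (Suc n) \<omega>)\<^sup>2)"
      unfolding ex using IH(2) w1(1)[OF pm] w2(3) by (intro Bochner_Integration.integrable_add)
    moreover have "expectation (\<lambda>\<omega>. (?S (Suc n) \<omega>)\<^sup>2) =
        expectation (\<lambda>\<omega>. (?S n \<omega>)\<^sup>2) + expectation (\<lambda>\<omega>. 2 * ?S n \<omega> * \<eta> n \<omega> * ?D \<omega>) +
        expectation (\<lambda>\<omega>. (\<eta> n \<omega>)\<^sup>2 * (?D \<omega>)\<^sup>2)"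
      unfolding ex using IH(2) w1(1)[OF pm] w2(3)
      by (subst Bochner_Integration.integral_add Bochner_Integration.integral_add)+ auto
    ultimately show ?case
      using meas IH(3) w1(2)[OF pm] w2(4) by simp
  qed
  from this[of K]
  show "integrable M (\<lambda>\<omega>. (increment_sum K \<rho> (\<lambda>j. \<eta> j \<omega>) (\<lambda>t. Z t \<omega>))\<^sup>2)"
    and "expectation (\<lambda>\<omega>. (increment_sum K \<rho> (\<lambda>j. \<eta> j \<omega>) (\<lambda>t. Z t \<omega>))\<^sup>2) =
         increment_sum K \<rho> (\<lambda>j. expectation (\<lambda>\<omega>. (\<eta> j \<omega>)\<^sup>2)) Q"
    by (auto simp: increment_sum_def)
qed

text \<open>Coefficients that are small off \<open>A\<close> are replaced by truncated ones: the truncation keeps them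
  adapted, changes nothing off \<open>A\<close>, and makes the isometry applicable.\<close>

lemma small_increment_sum:
  assumes Z: "gaussian_increments M F T Q Z" and \<rho>: "grid a c \<delta> K \<rho>" and a: "0 \<le> a" and c: "c \<in> times_upto T"
    and \<eta>: "\<And>j. j < K \<Longrightarrow> \<eta> j \<in> borel_measurable (F (\<rho> j))"
    and small: "holds_up_to M p (\<lambda>\<omega>. \<forall>j<K. \<bar>\<eta> j \<omega>\<bar> \<le> \<kappa>)" and "0 \<le> \<kappa>" "0 < \<epsilon>"
  shows "holds_up_to M (p + \<kappa>\<^sup>2 * (Q c - Q a) / \<epsilon>\<^sup>2)
           (\<lambda>\<omega>. \<bar>increment_sum K \<rho> (\<lambda>j. \<eta> j \<omega>) (\<lambda>t. Z t \<omega>)\<bar> < \<epsilon>)"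
proof -
  define \<zeta> where "\<zeta> j \<omega> = (if \<bar>\<eta> j \<omega>\<bar> \<le> \<kappa> then \<eta> j \<omega> else 0)" for j \<omega>
  have t: "\<rho> j \<in> times_upto T" if "j \<le> K" for j using grid_times[OF \<rho> a c that] .
  have \<zeta>F: "\<zeta> j \<in> borel_measurable (F (\<rho> j))" if "j < K" for j
    using \<eta>[OF that] unfolding \<zeta>_def by measurable
  have b: "(\<zeta> j \<omega>)\<^sup>2 \<le> \<kappa>\<^sup>2" for j \<omega>
    using \<open>0 \<le> \<kappa>\<close> by (auto simp: \<zeta>_def abs_le_square_iff[symmetric])
  have \<zeta>sq: "integrable M (\<lambda>\<omega>. (\<zeta> j \<omega>)\<^sup>2)" if "j < K" for j
    using F_M[OF \<zeta>F[OF that] t[of j]] that b by (intro integrable_const_bound[where B="\<kappa>\<^sup>2"]) auto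
  have "expectation (\<lambda>\<omega>. (increment_sum K \<rho> (\<lambda>j. \<zeta> j \<omega>) (\<lambda>t. Z t \<omega>))\<^sup>2) =
      (\<Sum>j<K. expectation (\<lambda>\<omega>. (\<zeta> j \<omega>)\<^sup>2) * (Q (\<rho> (Suc j)) - Q (\<rho> j)))"
    using increment_sum_isometry(2)[OF Z \<rho> a c \<zeta>F \<zeta>sq] by (simp add: increment_sum_def)
  also have "\<dots> \<le> (\<Sum>j<K. \<kappa>\<^sup>2 * (Q (\<rho> (Suc j)) - Q (\<rho> j)))"
  proof (rule sum_mono, rule mult_right_mono)
    fix j assume "j \<in> {..<K}"
    then have j: "j < K" by simp
    have "expectation (\<lambda>\<omega>. (\<zeta> j \<omega>)\<^sup>2) \<le> expectation (\<lambda>\<omega>. \<kappa>\<^sup>2)"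
      using \<zeta>sq[OF j] b by (intro integral_mono) auto
    then show "expectation (\<lambda>\<omega>. (\<zeta> j \<omega>)\<^sup>2) \<le> \<kappa>\<^sup>2" by (simp add: prob_space)
    show "0 \<le> Q (\<rho> (Suc j)) - Q (\<rho> j)"
      using gaussian_increments_var_mono[OF Z t[of j] t[of "Suc j"]] j \<rho> by (auto simp: grid_def)
  qed
  also have "\<dots> = \<kappa>\<^sup>2 * (Q c - Q a)"
    using increment_sum_const[OF \<rho>, of "\<kappa>\<^sup>2" Q] by (simp add: increment_sum_def)
  finally have "holds_up_to M (\<kappa>\<^sup>2 * (Q c - Q a) / \<epsilon>\<^sup>2)
      (\<lambda>\<omega>. (increment_sum K \<rho> (\<lambda>j. \<zeta> j \<omega>) (\<lambda>t. Z t \<omega>))\<^sup>2 < \<epsilon>\<^sup>2)"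
    using \<open>0 < \<epsilon>\<close> increment_sum_isometry(1)[OF Z \<rho> a c \<zeta>F \<zeta>sq] by (intro holds_up_to_Markov) auto
  from holds_up_to_conj[OF small this] show ?thesis
  proof (rule holds_up_to_mono)
    fix \<omega> assume *: "(\<forall>j<K. \<bar>\<eta> j \<omega>\<bar> \<le> \<kappa>) \<and> (increment_sum K \<rho> (\<lambda>j. \<zeta> j \<omega>) (\<lambda>t. Z t \<omega>))\<^sup>2 < \<epsilon>\<^sup>2"
    then have "increment_sum K \<rho> (\<lambda>j. \<zeta> j \<omega>) (\<lambda>t. Z t \<omega>) = increment_sum K \<rho> (\<lambda>j. \<eta> j \<omega>) (\<lambda>t. Z t \<omega>)"
      by (auto simp: increment_sum_def \<zeta>_def intro!: sum.cong)
    with * \<open>0 < \<epsilon>\<close> show "\<bar>increment_sum K \<rho> (\<lambda>j. \<eta> j \<omega>) (\<lambda>t. Z t \<omega>)\<bar> < \<epsilon>"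
      using abs_le_square_iff[of \<epsilon> "increment_sum K \<rho> (\<lambda>j. \<eta> j \<omega>) (\<lambda>t. Z t \<omega>)"] by (auto simp: not_le[symmetric])
  qed simp
qed

end


section \<open>Riemann sums\<close>

text \<open>The sum and the integral are compared on each grid interval separately; the error is at most
  \<open>\<kappa>\<close> times the total variation of the integrator.\<close>

lemma increment_sum_integral_error:
  fixes f w W :: "real \<Rightarrow> real"
  assumes \<rho>: "grid a c \<delta> K \<rho>" and f: "continuous_on {a..c} f" and w: "continuous_on {a..c} w"
    and W: "\<And>s t. a \<le> s \<Longrightarrow> s \<le> t \<Longrightarrow> t \<le> c \<Longrightarrow> W t - W s = integral {s..t} w"
    and close: "\<And>j s. j < K \<Longrightarrow> \<rho> j < \<rho> (Suc j) \<Longrightarrow> s \<in> {\<rho> j..\<rho> (Suc j)} \<Longrightarrow> \<bar>x j - f s\<bar> \<le> \<kappa>"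
  shows "\<bar>increment_sum K \<rho> x W - integral {a..c} (\<lambda>s. f s * w s)\<bar> \<le> \<kappa> * integral {a..c} (\<lambda>s. \<bar>w s\<bar>)"
proof -
  have sub: "integral {a..t} g - integral {a..s} g = integral {s..t} g"
    if "a \<le> s" "s \<le> t" "t \<le> c" "continuous_on {a..c} g" for s t and g :: "real \<Rightarrow> real"
  proof -
    have "g integrable_on {a..t}"
      using that by (intro integrable_continuous_interval continuous_on_subset[OF that(4)]) auto
    from Henstock_Kurzweil_Integration.integral_combine[OF that(1,2) this] show ?thesis by simp
  qed
  have absw: "continuous_on {a..c} (\<lambda>s. \<bar>w s\<bar>)" using w by (intro continuous_intros)
  have fw: "continuous_on {a..c} (\<lambda>s. f s * w s)" using f w by (intro continuous_intros)
  have "integral {a..c} (\<lambda>s. f s * w s) =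
      increment_sum K \<rho> (\<lambda>_. 1) (\<lambda>t. integral {a..t} (\<lambda>s. f s * w s))"
    using increment_sum_const[OF \<rho>, of 1 "\<lambda>t. integral {a..t} (\<lambda>s. f s * w s)"] by simp
  then have err: "increment_sum K \<rho> x W - integral {a..c} (\<lambda>s. f s * w s) =
      (\<Sum>j<K. x j * (W (\<rho> (Suc j)) - W (\<rho> j)) -
        (integral {a..\<rho> (Suc j)} (\<lambda>s. f s * w s) - integral {a..\<rho> j} (\<lambda>s. f s * w s)))"
    by (simp add: increment_sum_def sum_subtractf)
  have "\<bar>increment_sum K \<rho> x W - integral {a..c} (\<lambda>s. f s * w s)\<bar> \<le>
      (\<Sum>j<K. \<kappa> * (integral {a..\<rho> (Suc j)} (\<lambda>s. \<bar>w s\<bar>) - integral {a..\<rho> j} (\<lambda>s. \<bar>w s\<bar>)))"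
    unfolding err
  proof (rule order_trans[OF sum_abs sum_mono])
    fix j assume "j \<in> {..<K}"
    then have j: "j < K" by simp
    let ?s = "\<rho> j" and ?t = "\<rho> (Suc j)"
    have r: "a \<le> ?s" "?s \<le> ?t" "?t \<le> c"
      using grid_range[OF \<rho>, of j] grid_range[OF \<rho>, of "Suc j"] \<rho> j by (auto simp: grid_def)
    have c1: "continuous_on {?s..?t} g" if "continuous_on {a..c} g" for g :: "real \<Rightarrow> real"
      using that r by (auto intro: continuous_on_subset)
    have "x j * (W ?t - W ?s) -
        (integral {a..?t} (\<lambda>s. f s * w s) - integral {a..?s} (\<lambda>s. f s * w s)) =
        integral {?s..?t} (\<lambda>s. x j * w s) - integral {?s..?t} (\<lambda>s. f s * w s)"
      using sub[OF r fw] W[OF r] by simp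
    also have "\<dots> = integral {?s..?t} (\<lambda>s. x j * w s - f s * w s)"
      by (rule Henstock_Kurzweil_Integration.integral_diff[symmetric])
        (intro integrable_continuous_interval c1 continuous_intros f w)+
    finally have err_j: "x j * (W ?t - W ?s) -
        (integral {a..?t} (\<lambda>s. f s * w s) - integral {a..?s} (\<lambda>s. f s * w s)) =
        integral {?s..?t} (\<lambda>s. x j * w s - f s * w s)" .
    have "norm (integral {?s..?t} (\<lambda>s. x j * w s - f s * w s)) \<le> integral {?s..?t} (\<lambda>s. \<kappa> * \<bar>w s\<bar>)"
    proof (cases "?s < ?t")
      case True
      show ?thesis
      proof (rule integral_norm_bound_integral)
        show "(\<lambda>s. x j * w s - f s * w s) integrable_on {?s..?t}"
          by (intro integrable_continuous_interval c1 continuous_intros f w)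
        show "(\<lambda>s. \<kappa> * \<bar>w s\<bar>) integrable_on {?s..?t}"
          by (intro integrable_continuous_interval c1 continuous_intros w)
        fix s assume "s \<in> {?s..?t}"
        from close[OF j True this] show "norm (x j * w s - f s * w s) \<le> \<kappa> * \<bar>w s\<bar>"
          by (simp add: left_diff_distrib[symmetric] abs_mult mult_right_mono)
      qed
    next
      case False
      then have "?s = ?t" using r by simp
      then show ?thesis by simp
    qed
    also have "\<dots> = \<kappa> * (integral {a..?t} (\<lambda>s. \<bar>w s\<bar>) - integral {a..?s} (\<lambda>s. \<bar>w s\<bar>))"
      using sub[OF r absw] by simp
    finally show "\<bar>x j * (W ?t - W ?s) -
        (integral {a..?t} (\<lambda>s. f s * w s) - integral {a..?s} (\<lambda>s. f s * w s))\<bar> \<le>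
        \<kappa> * (integral {a..?t} (\<lambda>s. \<bar>w s\<bar>) - integral {a..?s} (\<lambda>s. \<bar>w s\<bar>))"
      unfolding err_j by simp
  qed
  also have "\<dots> = \<kappa> * integral {a..c} (\<lambda>s. \<bar>w s\<bar>)"
    using increment_sum_const[OF \<rho>, of \<kappa> "\<lambda>t. integral {a..t} (\<lambda>s. \<bar>w s\<bar>)"]
    by (simp add: increment_sum_def)
  finally show ?thesis .
qed

lemma increment_sum_integral_limit:
  fixes f w W :: "real \<Rightarrow> real"
  assumes f: "continuous_on {a..c} f" and w: "continuous_on {a..c} w"
    and W: "\<And>s t. a \<le> s \<Longrightarrow> s \<le> t \<Longrightarrow> t \<le> c \<Longrightarrow> W t - W s = integral {s..t} w" and "0 < \<epsilon>"
  shows "\<exists>\<delta>>0. \<forall>K \<rho> \<theta>. grid a c \<delta> K \<rho> \<longrightarrow> (\<forall>j<K. \<rho> j \<le> \<theta> j \<and> \<theta> j \<le> \<rho> (Suc j)) \<longrightarrow>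
       \<bar>increment_sum K \<rho> (\<lambda>j. f (\<theta> j)) W - integral {a..c} (\<lambda>s. f s * w s)\<bar> \<le> \<epsilon>"
proof -
  define I where "I = integral {a..c} (\<lambda>s. \<bar>w s\<bar>)"
  have I: "0 \<le> I" unfolding I_def
    by (intro integral_nonneg integrable_continuous_interval continuous_intros w) auto
  define \<epsilon>' where "\<epsilon>' = \<epsilon> / (I + 1)"
  have \<epsilon>': "0 < \<epsilon>'" using I \<open>0 < \<epsilon>\<close> by (simp add: \<epsilon>'_def)
  have "uniformly_continuous_on {a..c} f" using f by (intro compact_uniformly_continuous) auto
  then obtain d where d: "0 < d" "\<And>s t. s \<in> {a..c} \<Longrightarrow> t \<in> {a..c} \<Longrightarrow> \<bar>s - t\<bar> < d \<Longrightarrow> \<bar>f s - f t\<bar> < \<epsilon>'"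
    using \<epsilon>' unfolding uniformly_continuous_on_def dist_real_def by metis
  show ?thesis
  proof (intro exI[of _ "d / 2"] conjI allI impI)
    show "0 < d / 2" using d by simp
    fix K \<rho> \<theta> assume \<rho>: "grid a c (d / 2) K \<rho>" and \<theta>: "\<forall>j<K. \<rho> j \<le> \<theta> j \<and> \<theta> j \<le> \<rho> (Suc j)"
    have "\<bar>increment_sum K \<rho> (\<lambda>j. f (\<theta> j)) W - integral {a..c} (\<lambda>s. f s * w s)\<bar> \<le> \<epsilon>' * I"
      unfolding I_def
    proof (rule increment_sum_integral_error[OF \<rho> f w W])
      fix j s assume j: "j < K" and s: "s \<in> {\<rho> j..\<rho> (Suc j)}"
      have "a \<le> \<rho> j" "\<rho> (Suc j) \<le> c" "\<rho> (Suc j) - \<rho> j \<le> d / 2"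
        using grid_range[OF \<rho>, of j] grid_range[OF \<rho>, of "Suc j"] \<rho> j by (auto simp: grid_def)
      moreover have "\<rho> j \<le> \<theta> j" "\<theta> j \<le> \<rho> (Suc j)" using \<theta> j by auto
      ultimately have "\<bar>f (\<theta> j) - f s\<bar> < \<epsilon>'" using s d(1) by (intro d(2)) auto
      then show "\<bar>f (\<theta> j) - f s\<bar> \<le> \<epsilon>'" by simp
    qed
    also have "\<dots> \<le> \<epsilon>" using I \<open>0 < \<epsilon>\<close> by (simp add: \<epsilon>'_def field_simps)
    finally show "\<bar>increment_sum K \<rho> (\<lambda>j. f (\<theta> j)) W - integral {a..c} (\<lambda>s. f s * w s)\<bar> \<le> \<epsilon>" .
  qed
qed

lemma integral_of_continuous_diff:
  fixes w :: "real \<Rightarrow> real"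
  assumes "continuous_on {0..t} w" "0 \<le> s" "s \<le> t"
  shows "integral {0..t} w - integral {0..s} w = integral {s..t} w"
  using Henstock_Kurzweil_Integration.integral_combine[OF assms(2,3) integrable_continuous_interval[OF assms(1)]]
  by simp


lemma LBINT_continuous:
  fixes f :: "real \<Rightarrow> real"
  assumes "continuous_on {0..t} f"
  shows "(LBINT s:{0..t}. f s) = integral {0..t} f"
  using borel_integrable_atLeastAtMost'[OF assms] by (rule set_borel_integral_eq_integral)


section \<open>Stochastic integrals as limits of Riemann sums\<close>

lemma simple_process_mono:
  assumes "is_simple_process F T k \<tau> \<xi>" "i \<le> j" "j \<le> k"
  shows "\<tau> i \<le> \<tau> j"
  using assms(2,3)
proof (induction j rule: dec_induct)
  case (step j)
  then have "\<tau> j < \<tau> (Suc j)" using assms(1) by (simp add: is_simple_process_def)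
  with step show ?case by simp
qed simp

lemma simple_process_on_interval:
  assumes "is_simple_process F T k \<tau> \<xi>" "i < k" "\<tau> i < s" "s \<le> \<tau> (Suc i)"
  shows "simple_process k \<tau> \<xi> s \<omega> = \<xi> i \<omega>"
proof -
  have "\<tau> 0 = 0" using assms(1) by (simp add: is_simple_process_def)
  then have "0 < s" using simple_process_mono[OF assms(1), of 0 i] assms by simp
  have "(\<Sum>l<k. \<xi> l \<omega> * indicator {\<tau> l<..\<tau> (Suc l)} s) = (\<Sum>l<k. if l = i then \<xi> i \<omega> else 0)"
  proof (rule sum.cong)
    fix l assume "l \<in> {..<k}"
    then have l: "l < k" by simp
    consider "l = i" | "Suc l \<le> i" | "Suc i \<le> l" by linarith
    then show "\<xi> l \<omega> * indicator {\<tau> l<..\<tau> (Suc l)} s = (if l = i then \<xi> i \<omega> else 0)"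
    proof cases
      case 1 then show ?thesis using assms by simp
    next
      case 2
      then show ?thesis using simple_process_mono[OF assms(1) 2] assms by simp
    next
      case 3
      then show ?thesis using simple_process_mono[OF assms(1) 3] l assms by simp
    qed
  qed simp
  with \<open>0 < s\<close> \<open>i < k\<close> show ?thesis by (simp add: simple_process_def)
qed

lemma simple_process_after:
  assumes "is_simple_process F T k \<tau> \<xi>" "\<tau> k < s"
  shows "simple_process k \<tau> \<xi> s \<omega> = 0"
proof -
  have "\<tau> 0 = 0" using assms(1) by (simp add: is_simple_process_def)
  then have "0 < s" using simple_process_mono[OF assms(1), of 0 k] assms by simp
  have "\<xi> l \<omega> * indicator {\<tau> l<..\<tau> (Suc l)} s = 0" if "l < k" for l
    using simple_process_mono[OF assms(1), of "Suc l" k] that assms by simp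
  then have "(\<Sum>l<k. \<xi> l \<omega> * indicator {\<tau> l<..\<tau> (Suc l)} s) = 0" by (intro sum.neutral) auto
  with \<open>0 < s\<close> show ?thesis by (simp add: simple_process_def del: mult_eq_0_iff)
qed

text \<open>A simple process on the interval from \<open>a\<close> to \<open>c\<close>: its grid is clamped to the interval, and a last
  grid interval covers the times after its end.\<close>

lemma simple_process_restriction:
  assumes sp: "is_simple_process F T k \<tau> \<xi>" and ac: "0 \<le> a" "a \<le> c"
  obtains \<tau>' \<xi>' where "grid a c (c - a) (Suc k) \<tau>'"
    "\<And>i s \<omega>. i < Suc k \<Longrightarrow> \<tau>' i < s \<Longrightarrow> s \<le> \<tau>' (Suc i) \<Longrightarrow> simple_process k \<tau> \<xi> s \<omega> = \<xi>' i \<omega>"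
    "\<And>i. i < Suc k \<Longrightarrow> \<xi>' i = (\<lambda>_. 0) \<or> (i < k \<and> \<xi>' i = \<xi> i \<and> (\<tau>' i < c \<longrightarrow> \<tau> i \<le> \<tau>' i))"
    "\<And>Z \<omega>. simple_integral_process k \<tau> \<xi> Z c \<omega> - simple_integral_process k \<tau> \<xi> Z a \<omega> =
       increment_sum (Suc k) \<tau>' (\<lambda>i. \<xi>' i \<omega>) (\<lambda>t. Z t \<omega>)"
proof -
  have \<tau>0: "\<tau> 0 = 0" using sp by (simp add: is_simple_process_def)
  define \<tau>' where "\<tau>' i = (if i = Suc k then c else max a (min c (\<tau> i)))" for i
  define \<xi>' where "\<xi>' i = (if i < k then \<xi> i else (\<lambda>_. 0))" for i
  have \<tau>'_mono: "\<tau>' i \<le> \<tau>' (Suc i)" if "i < Suc k" for i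
  proof (cases "i = k")
    case False
    then have "\<tau> i \<le> \<tau> (Suc i)" using that simple_process_mono[OF sp, of i "Suc i"] by simp
    then show ?thesis using that False by (auto simp: \<tau>'_def)
  qed (use ac in \<open>auto simp: \<tau>'_def\<close>)
  have \<tau>'_range: "a \<le> \<tau>' i" "\<tau>' i \<le> c" for i using ac by (auto simp: \<tau>'_def)
  show ?thesis
  proof (rule that[of \<tau>' \<xi>'])
    show "grid a c (c - a) (Suc k) \<tau>'"
      unfolding grid_def
    proof (intro conjI allI impI)
      show "\<tau>' 0 = a" "\<tau>' (Suc k) = c" using ac \<tau>0 by (auto simp: \<tau>'_def)
      show "\<tau>' j \<le> \<tau>' (Suc j)" if "j < Suc k" for j using \<tau>'_mono[OF that] .
      show "\<tau>' (Suc j) - \<tau>' j \<le> c - a" for j using \<tau>'_range[of j] \<tau>'_range[of "Suc j"] by simp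
    qed
    show "simple_process k \<tau> \<xi> s \<omega> = \<xi>' i \<omega>" if i: "i < Suc k" and s: "\<tau>' i < s" "s \<le> \<tau>' (Suc i)" for i s \<omega>
    proof -
      have r: "a < s" "s \<le> c" using s \<tau>'_range[of i] \<tau>'_range[of "Suc i"] by auto
      show ?thesis
      proof (cases "i < k")
        case True
        have "\<tau> i < s" "s \<le> \<tau> (Suc i)"
          using s r True by (auto simp: \<tau>'_def split: if_splits)
        from simple_process_on_interval[OF sp True this] show ?thesis using True by (simp add: \<xi>'_def)
      next
        case False
        then have "i = k" using i by simp
        then have "\<tau> k < s" using s r by (auto simp: \<tau>'_def)
        from simple_process_after[OF sp this] show ?thesis using False by (simp add: \<xi>'_def)
      qed
    qed
    show "\<xi>' i = (\<lambda>_. 0) \<or> (i < k \<and> \<xi>' i = \<xi> i \<and> (\<tau>' i < c \<longrightarrow> \<tau> i \<le> \<tau>' i))" for i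
      by (auto simp: \<xi>'_def \<tau>'_def)
    fix Z :: "real \<Rightarrow> 'a \<Rightarrow> real" and \<omega>
    have clamp: "Z (min c x) \<omega> - Z (min a x) \<omega> = Z (max a (min c x)) \<omega> - Z a \<omega>" for x
      using ac by (cases "x \<le> a") (auto simp: min_def max_def)
    have "increment_sum (Suc k) \<tau>' (\<lambda>i. \<xi>' i \<omega>) (\<lambda>t. Z t \<omega>) =
        (\<Sum>i<k. \<xi> i \<omega> * (Z (max a (min c (\<tau> (Suc i)))) \<omega> - Z (max a (min c (\<tau> i))) \<omega>))"
      by (simp add: increment_sum_def \<xi>'_def \<tau>'_def)
    also have "\<dots> = simple_integral_process k \<tau> \<xi> Z c \<omega> - simple_integral_process k \<tau> \<xi> Z a \<omega>"
      unfolding simple_integral_process_def sum_subtractf[symmetric] right_diff_distrib[symmetric]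
    proof (intro sum.cong refl arg_cong2[where f="(*)"])
      fix i
      show "Z (max a (min c (\<tau> (Suc i)))) \<omega> - Z (max a (min c (\<tau> i))) \<omega> =
          Z (min c (\<tau> (Suc i))) \<omega> - Z (min c (\<tau> i)) \<omega> - (Z (min a (\<tau> (Suc i))) \<omega> - Z (min a (\<tau> i)) \<omega>)"
        using clamp[of "\<tau> (Suc i)"] clamp[of "\<tau> i"] by simp
    qed
    finally show "simple_integral_process k \<tau> \<xi> Z c \<omega> - simple_integral_process k \<tau> \<xi> Z a \<omega> =
       increment_sum (Suc k) \<tau>' (\<lambda>i. \<xi>' i \<omega>) (\<lambda>t. Z t \<omega>)" by simp
  qed
qed

lemma bound_at_left_end:
  fixes H :: "real \<Rightarrow> real"
  assumes H: "continuous_on {r..s} H" and "r < s" and bd: "\<And>u. r < u \<Longrightarrow> u \<le> s \<Longrightarrow> \<bar>x - H u\<bar> \<le> \<kappa>"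
  shows "\<bar>x - H r\<bar> \<le> \<kappa>"
proof (rule tendsto_upperbound[where F="at_right r"])
  have "(H \<longlongrightarrow> H r) (at_right r)" by (rule continuous_on_Icc_at_rightD[OF H \<open>r < s\<close>])
  then show "((\<lambda>u. \<bar>x - H u\<bar>) \<longlongrightarrow> \<bar>x - H r\<bar>) (at_right r)"
    by (intro tendsto_intros)
  show "\<forall>\<^sub>F u in at_right r. \<bar>x - H u\<bar> \<le> \<kappa>"
    using \<open>r < s\<close> bd by (auto simp: eventually_at_right intro: less_imp_le)
qed simp

text \<open>The elementary integral against an absolutely continuous path, for which no probability is needed: a
  simple process that is uniformly close to \<open>H\<close> has an integral close to that of \<open>H\<close>.\<close>

lemma simple_integral_drift:
  fixes H g :: "real \<Rightarrow> real"
  assumes sp: "is_simple_process F T k \<tau> \<xi>" and "0 \<le> t"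
    and H: "continuous_on {0..t} H" and g: "continuous_on {0..t} g"
    and close: "\<And>s. s \<in> {0..t} \<Longrightarrow> \<bar>simple_process k \<tau> \<xi> s \<omega> - H s\<bar> \<le> \<kappa>"
  shows "\<bar>simple_integral_process k \<tau> \<xi> (\<lambda>r _. integral {0..r} g) t \<omega> - integral {0..t} (\<lambda>s. H s * g s)\<bar>
    \<le> \<kappa> * integral {0..t} (\<lambda>s. \<bar>g s\<bar>)"
proof -
  let ?G = "\<lambda>r (_ :: 'a). integral {0..r} g"
  obtain \<tau>' \<xi>' where \<tau>': "grid 0 t (t - 0) (Suc k) \<tau>'"
    and value': "\<And>i s \<omega>. i < Suc k \<Longrightarrow> \<tau>' i < s \<Longrightarrow> s \<le> \<tau>' (Suc i) \<Longrightarrow> simple_process k \<tau> \<xi> s \<omega> = \<xi>' i \<omega>"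
    and J': "\<And>Z \<omega>. simple_integral_process k \<tau> \<xi> Z t \<omega> - simple_integral_process k \<tau> \<xi> Z 0 \<omega> =
       increment_sum (Suc k) \<tau>' (\<lambda>i. \<xi>' i \<omega>) (\<lambda>t. Z t \<omega>)"
    using simple_process_restriction[OF sp order_refl \<open>0 \<le> t\<close>] by metis
  have "0 \<le> \<tau> i" if "i \<le> k" for i
    using simple_process_mono[OF sp, of 0 i] sp that by (simp add: is_simple_process_def)
  then have "simple_integral_process k \<tau> \<xi> ?G 0 \<omega> = 0"
    unfolding simple_integral_process_def by (intro sum.neutral) (simp add: min_def)
  then have eq: "simple_integral_process k \<tau> \<xi> ?G t \<omega> =
      increment_sum (Suc k) \<tau>' (\<lambda>i. \<xi>' i \<omega>) (\<lambda>r. integral {0..r} g)"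
    using J'[of ?G \<omega>] by simp
  show ?thesis
    unfolding eq
  proof (rule increment_sum_integral_error[OF \<tau>' H g])
    show "integral {0..t'} g - integral {0..s'} g = integral {s'..t'} g" if "0 \<le> s'" "s' \<le> t'" "t' \<le> t" for s' t'
      using that by (intro integral_of_continuous_diff continuous_on_subset[OF g]) auto
    fix j s assume j: "j < Suc k" and lt: "\<tau>' j < \<tau>' (Suc j)" and s: "s \<in> {\<tau>' j..\<tau>' (Suc j)}"
    have r: "0 \<le> \<tau>' j" "\<tau>' (Suc j) \<le> t"
      using grid_range[OF \<tau>', of j] grid_range[OF \<tau>', of "Suc j"] j by auto
    have inner: "\<bar>\<xi>' j \<omega> - H u\<bar> \<le> \<kappa>" if "\<tau>' j < u" "u \<le> \<tau>' (Suc j)" for u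
      using close[of u] value'[OF j that, of \<omega>] r that by simp
    show "\<bar>\<xi>' j \<omega> - H s\<bar> \<le> \<kappa>"
    proof (cases "s = \<tau>' j")
      case True
      show ?thesis unfolding True
        by (rule bound_at_left_end[OF continuous_on_subset[OF H] lt inner]) (use r in auto)
    qed (use inner s in auto)
  qed
qed

lemma ucp_tendsto_holds_up_to:
  assumes "ucp_tendsto M T Y Z" "t \<in> times_upto T" "0 < \<epsilon>"
  shows "\<forall>\<^sub>F n in sequentially. holds_up_to M \<epsilon> (\<lambda>\<omega>. \<bar>Y n t \<omega> - Z t \<omega>\<bar> \<le> \<epsilon>)"
proof -
  have "\<forall>\<^sub>F n in sequentially. \<exists>A\<in>sets M. measure M A < \<epsilon> \<and>
      (\<forall>\<omega>\<in>space M - A. \<forall>s\<in>{0..t}. \<bar>Y n s \<omega> - Z s \<omega>\<bar> < \<epsilon>)"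
    using assms unfolding ucp_tendsto_def by blast
  then show ?thesis
  proof eventually_elim
    case (elim n)
    have "t \<in> {0..t}" using assms(2) by (simp add: times_upto_def)
    with elim show ?case unfolding holds_up_to_def by (meson less_imp_le)
  qed
qed

context filtered_space
begin

text \<open>The increments of a stochastic integral are approximated by Riemann sums of the integrand along
  arbitrarily fine grids. The grid refines that of an approximating simple process. On each of its
  intervals the simple process is constant and close to the integrand, at the left end
  point by continuity; so the two sums differ by a sum with small adapted coefficients.\<close>

lemma integral_increment_approx:
  assumes Z: "gaussian_increments M F T Q Z"
    and H: "\<And>t. t \<in> times_upto T \<Longrightarrow> H t \<in> borel_measurable (F t)"
    and Hc: "AE \<omega> in M. continuous_on (times_upto T) (\<lambda>t. H t \<omega>)"
    and simple: "\<And>n. is_simple_process F T (k n) (\<tau> n) (\<xi> n)"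
    and ucp: "ucp_tendsto M T (\<lambda>n. simple_process (k n) (\<tau> n) (\<xi> n)) H"
    and conv: "\<And>t \<epsilon>. t \<in> times_upto T \<Longrightarrow> 0 < \<epsilon> \<Longrightarrow> \<forall>\<^sub>F n in sequentially.
        holds_up_to M \<epsilon> (\<lambda>\<omega>. \<bar>simple_integral_process (k n) (\<tau> n) (\<xi> n) Z t \<omega> - J t \<omega>\<bar> \<le> \<epsilon>)"
    and ac: "0 \<le> a" "a \<le> c" "c \<in> times_upto T" and "0 < \<epsilon>" "0 < \<delta>"
  obtains K \<rho> where "grid a c \<delta> K \<rho>"
    "holds_up_to M \<epsilon> (\<lambda>\<omega>. \<bar>increment_sum K \<rho> (\<lambda>j. H (\<rho> j) \<omega>) (\<lambda>t. Z t \<omega>) - (J c \<omega> - J a \<omega>)\<bar> \<le> \<epsilon>)"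
proof -
  have at: "a \<in> times_upto T" using ac by (auto intro: times_upto_downward)
  define q where "q = Q c - Q a"
  have q: "0 \<le> q" using gaussian_increments_var_mono[OF Z at ac(3,2)] by (simp add: q_def)
  \<comment> \<open>chosen so that Chebyshev's inequality bounds the difference of the two sums\<close>
  define \<kappa> where "\<kappa> = sqrt (\<epsilon> ^ 3 / (36 * (q + 1)))"
  have \<kappa>: "0 < \<kappa>" using q \<open>0 < \<epsilon>\<close> by (simp add: \<kappa>_def)
  have "\<kappa>\<^sup>2 * q = \<epsilon> ^ 3 / (36 * (q + 1)) * q" using q \<open>0 < \<epsilon>\<close> by (simp add: \<kappa>_def)
  also have "\<dots> \<le> \<epsilon> ^ 3 / 36" using q \<open>0 < \<epsilon>\<close> by (simp add: field_simps)
  also have "\<dots> = \<epsilon> / 4 * (\<epsilon> / 3)\<^sup>2" by (simp add: power3_eq_cube power2_eq_square)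
  finally have \<kappa>q: "\<kappa>\<^sup>2 * q / (\<epsilon> / 3)\<^sup>2 \<le> \<epsilon> / 4" using \<open>0 < \<epsilon>\<close> by (simp add: divide_le_eq)
  have e4: "0 < \<epsilon> / 4" using \<open>0 < \<epsilon>\<close> by simp
  have "\<forall>\<^sub>F n in sequentially. \<exists>A\<in>sets M. measure M A < \<epsilon> / 4 \<and>
      (\<forall>\<omega>\<in>space M - A. \<forall>s\<in>{0..c}. \<bar>simple_process (k n) (\<tau> n) (\<xi> n) s \<omega> - H s \<omega>\<bar> < \<kappa>)"
    using ucp ac(3) \<kappa> e4 unfolding ucp_tendsto_def by blast
  with conv[OF ac(3) e4] conv[OF at e4] have "\<forall>\<^sub>F n in sequentially.
      (\<exists>A\<in>sets M. measure M A < \<epsilon> / 4 \<and>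
        (\<forall>\<omega>\<in>space M - A. \<forall>s\<in>{0..c}. \<bar>simple_process (k n) (\<tau> n) (\<xi> n) s \<omega> - H s \<omega>\<bar> < \<kappa>)) \<and>
      holds_up_to M (\<epsilon> / 4) (\<lambda>\<omega>. \<bar>simple_integral_process (k n) (\<tau> n) (\<xi> n) Z c \<omega> - J c \<omega>\<bar> \<le> \<epsilon> / 4) \<and>
      holds_up_to M (\<epsilon> / 4) (\<lambda>\<omega>. \<bar>simple_integral_process (k n) (\<tau> n) (\<xi> n) Z a \<omega> - J a \<omega>\<bar> \<le> \<epsilon> / 4)"
    by eventually_elim blast
  from eventually_happens'[OF sequentially_bot this] obtain n where n1: "\<exists>A\<in>sets M. measure M A < \<epsilon> / 4 \<and>
        (\<forall>\<omega>\<in>space M - A. \<forall>s\<in>{0..c}. \<bar>simple_process (k n) (\<tau> n) (\<xi> n) s \<omega> - H s \<omega>\<bar> < \<kappa>)"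
    and n2: "holds_up_to M (\<epsilon> / 4) (\<lambda>\<omega>. \<bar>simple_integral_process (k n) (\<tau> n) (\<xi> n) Z c \<omega> - J c \<omega>\<bar> \<le> \<epsilon> / 4)"
      "holds_up_to M (\<epsilon> / 4) (\<lambda>\<omega>. \<bar>simple_integral_process (k n) (\<tau> n) (\<xi> n) Z a \<omega> - J a \<omega>\<bar> \<le> \<epsilon> / 4)"
    by blast
  define k' \<tau>n \<xi>n where "k' = k n" and "\<tau>n = \<tau> n" and "\<xi>n = \<xi> n"
  note defs = k'_def[symmetric] \<tau>n_def[symmetric] \<xi>n_def[symmetric]
  note n1 = n1[unfolded defs] and n2 = n2[unfolded defs]
  have sp: "is_simple_process F T k' \<tau>n \<xi>n" using simple unfolding k'_def \<tau>n_def \<xi>n_def .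
  have \<tau>0: "\<tau>n 0 = 0" and kT: "\<tau>n k' \<in> times_upto T" and \<xi>F: "\<And>i. i < k' \<Longrightarrow> \<xi>n i \<in> borel_measurable (F (\<tau>n i))"
    using sp simple_process_mono[OF sp, of 0 k'] by (auto simp: is_simple_process_def times_upto_def)
  from simple_process_restriction[OF sp ac(1,2)] obtain \<tau>' \<xi>' where \<tau>': "grid a c (c - a) (Suc k') \<tau>'"
    and value': "\<And>i s \<omega>. i < Suc k' \<Longrightarrow> \<tau>' i < s \<Longrightarrow> s \<le> \<tau>' (Suc i) \<Longrightarrow> simple_process k' \<tau>n \<xi>n s \<omega> = \<xi>' i \<omega>"
    and \<xi>': "\<And>i. i < Suc k' \<Longrightarrow> \<xi>' i = (\<lambda>_. 0) \<or> (i < k' \<and> \<xi>' i = \<xi>n i \<and> (\<tau>' i < c \<longrightarrow> \<tau>n i \<le> \<tau>' i))"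
    and J': "\<And>Z \<omega>. simple_integral_process k' \<tau>n \<xi>n Z c \<omega> - simple_integral_process k' \<tau>n \<xi>n Z a \<omega> =
       increment_sum (Suc k') \<tau>' (\<lambda>i. \<xi>' i \<omega>) (\<lambda>t. Z t \<omega>)"
    by blast
  from grid_refinement[OF \<tau>' \<open>0 < \<delta>\<close>] obtain K \<rho> f where \<rho>: "grid a c \<delta> K \<rho>"
    and f: "\<And>j. j < K \<Longrightarrow> f j < Suc k' \<and> \<tau>' (f j) \<le> \<rho> j \<and> \<rho> (Suc j) \<le> \<tau>' (Suc (f j))"
    and sum_eq: "\<And>x z. increment_sum K \<rho> (\<lambda>j. x (f j)) z = increment_sum (Suc k') \<tau>' x z"
    by blast
  have \<rho>t: "\<rho> j \<in> times_upto T" if "j \<le> K" for j using grid_times[OF \<rho> ac(1,3) that] .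
  have J_eq: "simple_integral_process k' \<tau>n \<xi>n Z c \<omega> - simple_integral_process k' \<tau>n \<xi>n Z a \<omega> =
      increment_sum K \<rho> (\<lambda>j. \<xi>' (f j) \<omega>) (\<lambda>t. Z t \<omega>)" for \<omega>
    unfolding J' using sum_eq[of "\<lambda>i. \<xi>' i \<omega>"] by simp
  define \<eta> where "\<eta> j \<omega> = (if \<rho> j < \<rho> (Suc j) then \<xi>' (f j) \<omega> - H (\<rho> j) \<omega> else 0)" for j \<omega>
  have \<eta>F: "\<eta> j \<in> borel_measurable (F (\<rho> j))" if j: "j < K" for j
  proof (cases "\<rho> j < \<rho> (Suc j)")
    case True
    have "\<xi>' (f j) \<in> borel_measurable (F (\<rho> j))"
    proof (cases "\<xi>' (f j) = (\<lambda>_. 0)")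
      case False
      then have fj: "f j < k'" "\<xi>' (f j) = \<xi>n (f j)" "\<tau>' (f j) < c \<longrightarrow> \<tau>n (f j) \<le> \<tau>' (f j)"
        using \<xi>'[of "f j"] f[OF j] by auto
      have "\<tau>' (f j) < c" using f[OF j] True grid_range[OF \<rho>, of "Suc j"] j by simp
      then have le: "\<tau>n (f j) \<le> \<rho> j" using f[OF j] fj by simp
      have "0 \<le> \<tau>n (f j)" "\<tau>n (f j) \<le> \<tau>n k'"
        using simple_process_mono[OF sp, of 0 "f j"] simple_process_mono[OF sp, of "f j" k'] \<tau>0 fj by auto
      then have "\<tau>n (f j) \<in> times_upto T" using kT by (auto intro: times_upto_downward)
      from F_mono[OF \<xi>F[OF fj(1)] this \<rho>t le] j show ?thesis unfolding fj(2) by simp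
    qed simp
    then show ?thesis using True H[OF \<rho>t[of j]] j by (simp add: \<eta>_def[abs_def])
  qed (simp add: \<eta>_def[abs_def])
  have "holds_up_to M (\<epsilon> / 4) (\<lambda>\<omega>. \<forall>s\<in>{0..c}. \<bar>simple_process k' \<tau>n \<xi>n s \<omega> - H s \<omega>\<bar> < \<kappa>)"
    using n1 unfolding holds_up_to_def by (meson less_imp_le)
  from holds_up_to_conj[OF this AE_holds_up_to[OF Hc order_refl]]
  have \<eta>_small: "holds_up_to M (\<epsilon> / 4) (\<lambda>\<omega>. \<forall>j<K. \<bar>\<eta> j \<omega>\<bar> \<le> \<kappa>)"
  proof (rule holds_up_to_mono)
    fix \<omega>
    assume *: "(\<forall>s\<in>{0..c}. \<bar>simple_process k' \<tau>n \<xi>n s \<omega> - H s \<omega>\<bar> < \<kappa>) \<and> continuous_on (times_upto T) (\<lambda>t. H t \<omega>)"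
    show "\<forall>j<K. \<bar>\<eta> j \<omega>\<bar> \<le> \<kappa>"
    proof (intro allI impI)
      fix j assume j: "j < K"
      show "\<bar>\<eta> j \<omega>\<bar> \<le> \<kappa>"
      proof (cases "\<rho> j < \<rho> (Suc j)")
        case True
        have r: "a \<le> \<rho> j" "\<rho> (Suc j) \<le> c" using grid_range[OF \<rho>] j by auto
        have "continuous_on {\<rho> j..\<rho> (Suc j)} (\<lambda>t. H t \<omega>)"
          by (rule continuous_on_subset[OF conjunct2[OF *]], rule Icc_subset_times_upto) (use \<rho>t[of "Suc j"] j r ac in auto)
        then have "\<bar>\<xi>' (f j) \<omega> - H (\<rho> j) \<omega>\<bar> \<le> \<kappa>"
        proof (rule bound_at_left_end[OF _ True])
          fix s assume s: "\<rho> j < s" "s \<le> \<rho> (Suc j)"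
          then have "s \<in> {0..c}" using r ac by auto
          with * have "\<bar>simple_process k' \<tau>n \<xi>n s \<omega> - H s \<omega>\<bar> < \<kappa>" by blast
          then show "\<bar>\<xi>' (f j) \<omega> - H s \<omega>\<bar> \<le> \<kappa>" using value'[of "f j" s] f[OF j] s by simp
        qed
        then show ?thesis using True by (simp add: \<eta>_def)
      qed (use \<kappa> in \<open>simp add: \<eta>_def\<close>)
    qed
  qed simp
  have "0 < \<epsilon> / 3" using \<open>0 < \<epsilon>\<close> by simp
  from small_increment_sum[OF Z \<rho> ac(1,3) \<eta>F \<eta>_small less_imp_le[OF \<kappa>] this]
  have "holds_up_to M (\<epsilon> / 4 + \<kappa>\<^sup>2 * q / (\<epsilon> / 3)\<^sup>2)
      (\<lambda>\<omega>. \<bar>increment_sum K \<rho> (\<lambda>j. \<eta> j \<omega>) (\<lambda>t. Z t \<omega>)\<bar> < \<epsilon> / 3)"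
    by (simp add: q_def)
  from holds_up_to_conj[OF this holds_up_to_conj[OF n2]]
  have "holds_up_to M \<epsilon> (\<lambda>\<omega>. \<bar>increment_sum K \<rho> (\<lambda>j. H (\<rho> j) \<omega>) (\<lambda>t. Z t \<omega>) - (J c \<omega> - J a \<omega>)\<bar> \<le> \<epsilon>)"
  proof (rule holds_up_to_mono)
    show "\<epsilon> / 4 + \<kappa>\<^sup>2 * q / (\<epsilon> / 3)\<^sup>2 + (\<epsilon> / 4 + \<epsilon> / 4) \<le> \<epsilon>" using \<kappa>q by linarith
    fix \<omega>
    assume *: "\<bar>increment_sum K \<rho> (\<lambda>j. \<eta> j \<omega>) (\<lambda>t. Z t \<omega>)\<bar> < \<epsilon> / 3 \<and>
        \<bar>simple_integral_process k' \<tau>n \<xi>n Z c \<omega> - J c \<omega>\<bar> \<le> \<epsilon> / 4 \<and>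
        \<bar>simple_integral_process k' \<tau>n \<xi>n Z a \<omega> - J a \<omega>\<bar> \<le> \<epsilon> / 4"
    have "increment_sum K \<rho> (\<lambda>j. \<eta> j \<omega>) (\<lambda>t. Z t \<omega>) =
        increment_sum K \<rho> (\<lambda>j. \<xi>' (f j) \<omega> - H (\<rho> j) \<omega>) (\<lambda>t. Z t \<omega>)"
      by (rule increment_sum_cong[OF _ \<rho>]) (simp add: \<eta>_def)
    also have "\<dots> = increment_sum K \<rho> (\<lambda>j. \<xi>' (f j) \<omega>) (\<lambda>t. Z t \<omega>) - increment_sum K \<rho> (\<lambda>j. H (\<rho> j) \<omega>) (\<lambda>t. Z t \<omega>)"
      by (rule increment_sum_diff[symmetric])
    finally show "\<bar>increment_sum K \<rho> (\<lambda>j. H (\<rho> j) \<omega>) (\<lambda>t. Z t \<omega>) - (J c \<omega> - J a \<omega>)\<bar> \<le> \<epsilon>"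
      using * J_eq[of \<omega>] by linarith
  qed
  with \<rho> show ?thesis by (rule that)
qed

text \<open>Both the noise \<open>\<integral> \<sigma> dB\<close> and the discounted solution are limits of weighted sums of Gaussian
  increments, and so inherit their structure.\<close>

lemma gaussian_increments_limit:
  assumes Z: "gaussian_increments M F T Q Z"
    and Y: "\<And>t. t \<in> times_upto T \<Longrightarrow> Y t \<in> borel_measurable (F t)"
    and V: "\<And>s t. s \<in> times_upto T \<Longrightarrow> t \<in> times_upto T \<Longrightarrow> s \<le> t \<Longrightarrow> V s \<le> V t"
    and approx: "\<And>s t \<epsilon>. s \<in> times_upto T \<Longrightarrow> t \<in> times_upto T \<Longrightarrow> s \<le> t \<Longrightarrow> 0 < \<epsilon> \<Longrightarrow>
      \<exists>\<delta> K \<rho> x. grid s t \<delta> K \<rho> \<and> \<bar>increment_sum K \<rho> (\<lambda>j. (x j)\<^sup>2) Q - (V t - V s)\<bar> \<le> \<epsilon> \<and>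
        holds_up_to M \<epsilon> (\<lambda>\<omega>. \<bar>increment_sum K \<rho> x (\<lambda>t. Z t \<omega>) - (Y t \<omega> - Y s \<omega>)\<bar> \<le> \<epsilon>)"
  shows "gaussian_increments M F T V Y"
  unfolding gaussian_increments_def
proof (intro conjI ballI impI)
  fix s t assume st: "s \<in> times_upto T" "t \<in> times_upto T" "s \<le> t"
  have s0: "0 \<le> s" using st by (simp add: times_upto_def)
  show "indep_normal M (F s) (V t - V s) (\<lambda>\<omega>. Y t \<omega> - Y s \<omega>)"
  proof (rule indep_normal_limit[OF subalg[OF st(1)]])
    show "(\<lambda>\<omega>. Y t \<omega> - Y s \<omega>) \<in> borel_measurable M"
      using F_M[OF Y[OF st(1)] st(1)] F_M[OF Y[OF st(2)] st(2)] by simp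
    show "0 \<le> V t - V s" using V[OF st] by simp
    fix \<epsilon> :: real assume "0 < \<epsilon>"
    from approx[OF st this] obtain \<delta> K \<rho> x where *: "grid s t \<delta> K \<rho>"
      "\<bar>increment_sum K \<rho> (\<lambda>j. (x j)\<^sup>2) Q - (V t - V s)\<bar> \<le> \<epsilon>"
      "holds_up_to M \<epsilon> (\<lambda>\<omega>. \<bar>increment_sum K \<rho> x (\<lambda>t. Z t \<omega>) - (Y t \<omega> - Y s \<omega>)\<bar> \<le> \<epsilon>)" by blast
    show "\<exists>D' v'. indep_normal M (F s) v' D' \<and> \<bar>v' - (V t - V s)\<bar> \<le> \<epsilon> \<and>
        holds_up_to M \<epsilon> (\<lambda>\<omega>. \<bar>D' \<omega> - (Y t \<omega> - Y s \<omega>)\<bar> \<le> \<epsilon>)"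
      using gaussian_increment_sum[OF Z *(1) s0 st(2), of x] *(2,3) by blast
  qed
qed (rule Y)

lemma wiener_gaussian_increments:
  assumes B: "wiener_process M F T B"
  shows "gaussian_increments M F T (\<lambda>t. t) B"
  unfolding gaussian_increments_def
proof (intro conjI ballI impI)
  show Bt: "B t \<in> borel_measurable (F t)" if "t \<in> times_upto T" for t
    using B that by (simp add: wiener_process_def continuous_adapted_def)
  fix s t assume st: "s \<in> times_upto T" "t \<in> times_upto T" "s \<le> t"
  let ?D = "\<lambda>\<omega>. B t \<omega> - B s \<omega>"
  have D [measurable]: "?D \<in> borel_measurable M"
    using F_M[OF Bt[OF st(1)] st(1)] F_M[OF Bt[OF st(2)] st(2)] by simp
  show "indep_normal M (F s) (t - s) ?D"
  proof (cases "s = t")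
    case True
    then show ?thesis by (simp add: indep_normal_def)
  next
    case False
    then have "s < t" using st by simp
    then have dist: "distributed M lborel ?D (\<lambda>x. ennreal (normal_density 0 (sqrt (t - s)) x))"
      and ind: "indep_set (sets (F s)) (sets (vimage_algebra (space M) ?D borel))"
      using B st by (auto simp: wiener_process_def)
    have v: "0 < sqrt (t - s)" using \<open>s < t\<close> by simp
    show ?thesis
    proof (rule indep_normal_of_indep_set[OF subalg[OF st(1)] D])
      show "indep_set (sets (F s)) {?D -` A \<inter> space M |A. A \<in> sets borel}"
        using ind by (simp add: sets_vimage_algebra2)
      show "0 \<le> t - s" using \<open>s < t\<close> by simp
      have std: "distributed M lborel (\<lambda>\<omega>. ?D \<omega> / sqrt (t - s)) std_normal_density"
        using normal_standard_normal_convert[OF v, of ?D 0] dist by simp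
      have m [measurable]: "(\<lambda>\<omega>. ?D \<omega> / sqrt (t - s)) \<in> borel_measurable M" by measurable
      have "distr std_normal_distribution borel (\<lambda>x. sqrt (t - s) * x) =
          distr (distr M lborel (\<lambda>\<omega>. ?D \<omega> / sqrt (t - s))) borel (\<lambda>x. sqrt (t - s) * x)"
        using distributed_distr_eq_density[OF std] by simp
      also have "\<dots> = distr M borel ?D"
        using v by (subst distr_distr) (auto simp: comp_def)
      finally show "distr M borel ?D = distr std_normal_distribution borel (\<lambda>x. sqrt (t - s) * x)" by simp
    qed
  qed
qed

end


section \<open>The linear equation and its discounted solution\<close>

locale linear_sde = filtered_space M F T for M :: "'a measure" and F T +
  fixes b \<sigma> :: "real \<Rightarrow> real" and \<alpha> :: real and B X :: "real \<Rightarrow> 'a \<Rightarrow> real"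
  assumes T_pos: "0 < T"
    and b_cont: "continuous_on (times_upto T) b"
    and \<sigma>_cont: "continuous_on (times_upto T) \<sigma>"
    and \<sigma>_pos: "t \<in> times_upto T \<Longrightarrow> 0 < \<sigma> t"
    and complete: "negligible_sets M \<subseteq> sets M"
    and wiener: "wiener_process M F T B"
    and sde: "sde_solution M F T B (\<lambda>t x. \<alpha> * b t * x) (\<lambda>t x. \<sigma> t) 0 X"
begin

text \<open>The discounted solution \<open>Y = \<mu> X\<close> is the Wiener integral of \<open>\<mu> \<sigma>\<close>; its variance function is
  \<open>V\<close>, and \<open>Q\<close> is that of the Wiener integral of \<open>\<sigma>\<close>.\<close>

definition "\<mu> t = exp (- \<alpha> * integral {0..t} b)" for t
definition "Y t \<omega> = \<mu> t * X t \<omega>" for t \<omega>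
definition "Q t = integral {0..t} (\<lambda>s. (\<sigma> s)\<^sup>2)" for t
definition "V t = integral {0..t} (\<lambda>s. (\<mu> s)\<^sup>2 * (\<sigma> s)\<^sup>2)" for t

text \<open>\<open>h Y\<close> is the integrand \<open>b X / \<sigma>\<^sup>2\<close> of the score, and \<open>A\<close> is the variance function of the
  Wiener integral of \<open>h \<sigma>\<close>.\<close>

definition "h t = b t / (\<mu> t * (\<sigma> t)\<^sup>2)" for t
definition "A t = integral {0..t} (\<lambda>s. (h s)\<^sup>2 * (\<sigma> s)\<^sup>2)" for t

lemma zero_times: "0 \<in> times_upto T"
  using T_pos by (simp add: times_upto_def zero_ereal_def)

lemma \<mu>_pos [simp]: "0 < \<mu> t" "\<mu> t \<noteq> 0"
  by (simp_all add: \<mu>_def)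

lemma on_Icc: "continuous_on (times_upto T) f \<Longrightarrow> t \<in> times_upto T \<Longrightarrow> 0 \<le> s \<Longrightarrow> continuous_on {s..t} f"
  by (rule continuous_on_subset[OF _ Icc_subset_times_upto])

lemma \<mu>_cont: "t \<in> times_upto T \<Longrightarrow> continuous_on {0..t} \<mu>"
  unfolding \<mu>_def[abs_def]
  by (intro continuous_intros indefinite_integral_continuous_1 integrable_continuous_interval on_Icc b_cont) auto

lemma \<sigma>_nz: "t \<in> times_upto T \<Longrightarrow> s \<in> {0..t} \<Longrightarrow> \<sigma> s \<noteq> 0"
  using \<sigma>_pos[of s] times_upto_downward[of t T s] by fastforce

lemma h_cont: "t \<in> times_upto T \<Longrightarrow> continuous_on {0..t} h"
  unfolding h_def[abs_def]
  by (intro continuous_intros on_Icc[OF b_cont] on_Icc[OF \<sigma>_cont] \<mu>_cont) (auto dest: \<sigma>_nz)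

lemma Q_cont: "t \<in> times_upto T \<Longrightarrow> continuous_on {0..t} (\<lambda>s. (\<sigma> s)\<^sup>2)"
  by (intro continuous_intros on_Icc[OF \<sigma>_cont]) auto

lemma V_cont: "t \<in> times_upto T \<Longrightarrow> continuous_on {0..t} (\<lambda>s. (\<mu> s)\<^sup>2 * (\<sigma> s)\<^sup>2)"
  by (intro continuous_intros on_Icc[OF \<sigma>_cont] \<mu>_cont) auto

lemma A_cont: "t \<in> times_upto T \<Longrightarrow> continuous_on {0..t} (\<lambda>s. (h s)\<^sup>2 * (\<sigma> s)\<^sup>2)"
  by (intro continuous_intros on_Icc[OF \<sigma>_cont] h_cont) auto

lemma Q_diff: "t \<in> times_upto T \<Longrightarrow> 0 \<le> s \<Longrightarrow> s \<le> t \<Longrightarrow> Q t - Q s = integral {s..t} (\<lambda>s. (\<sigma> s)\<^sup>2)"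
  unfolding Q_def by (rule integral_of_continuous_diff[OF Q_cont])

lemma V_diff: "t \<in> times_upto T \<Longrightarrow> 0 \<le> s \<Longrightarrow> s \<le> t \<Longrightarrow> V t - V s = integral {s..t} (\<lambda>s. (\<mu> s)\<^sup>2 * (\<sigma> s)\<^sup>2)"
  unfolding V_def by (rule integral_of_continuous_diff[OF V_cont])

lemma A_diff: "t \<in> times_upto T \<Longrightarrow> 0 \<le> s \<Longrightarrow> s \<le> t \<Longrightarrow> A t - A s = integral {s..t} (\<lambda>s. (h s)\<^sup>2 * (\<sigma> s)\<^sup>2)"
  unfolding A_def by (rule integral_of_continuous_diff[OF A_cont])

lemma Q_mono: "t \<in> times_upto T \<Longrightarrow> 0 \<le> s \<Longrightarrow> s \<le> t \<Longrightarrow> Q s \<le> Q t"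
  using Q_diff[of t s] integral_nonneg[OF integrable_continuous_interval[OF continuous_on_subset[OF Q_cont[of t]]], of s t]
  by (simp add: subset_iff)

lemma V_mono: "t \<in> times_upto T \<Longrightarrow> 0 \<le> s \<Longrightarrow> s \<le> t \<Longrightarrow> V s \<le> V t"
  using V_diff[of t s] integral_nonneg[OF integrable_continuous_interval[OF continuous_on_subset[OF V_cont[of t]]], of s t]
  by (simp add: subset_iff)

lemma A_mono: "t \<in> times_upto T \<Longrightarrow> 0 \<le> s \<Longrightarrow> s \<le> t \<Longrightarrow> A s \<le> A t"
  using A_diff[of t s] integral_nonneg[OF integrable_continuous_interval[OF continuous_on_subset[OF A_cont[of t]]], of s t]
  by (simp add: subset_iff)

lemma zero_at_zero [simp]: "Q 0 = 0" "V 0 = 0" "A 0 = 0" "\<mu> 0 = 1"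
  by (simp_all add: Q_def V_def A_def \<mu>_def)

lemma V_nonneg: "t \<in> times_upto T \<Longrightarrow> 0 \<le> V t"
  using V_mono[of t 0] by (simp add: times_upto_def)

lemma V_pos: "t \<in> times_upto T \<Longrightarrow> 0 < t \<Longrightarrow> 0 < V t"
  using integral_less_real[of 0 t "\<lambda>_. 0" "\<lambda>s. (\<mu> s)\<^sup>2 * (\<sigma> s)\<^sup>2"] V_cont[of t] \<sigma>_nz[of t]
  by (simp add: V_def)

lemma \<mu>_diff:
  assumes "t \<in> times_upto T" "0 \<le> s" "s \<le> t"
  shows "\<mu> t - \<mu> s = integral {s..t} (\<lambda>r. - \<alpha> * b r * \<mu> r)"
proof -
  have "((\<lambda>r. - \<alpha> * b r * \<mu> r) has_integral (\<mu> t - \<mu> s)) {s..t}"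
  proof (rule fundamental_theorem_of_calculus[OF assms(3)])
    fix r assume r: "r \<in> {s..t}"
    have "((\<lambda>u. integral {0..u} b) has_vector_derivative b r) (at r within {0..t})"
      using on_Icc[OF b_cont assms(1)] r assms by (intro integral_has_vector_derivative) auto
    then have "((\<lambda>u. integral {0..u} b) has_vector_derivative b r) (at r within {s..t})"
      by (rule has_vector_derivative_within_subset) (use assms in auto)
    then have "((\<lambda>u. integral {0..u} b) has_real_derivative b r) (at r within {s..t})"
      by (simp add: has_real_derivative_iff_has_vector_derivative)
    then have "(\<mu> has_real_derivative (- \<alpha> * b r * \<mu> r)) (at r within {s..t})"
      unfolding \<mu>_def[abs_def] by (auto intro!: derivative_eq_intros)
    then show "(\<mu> has_vector_derivative (- \<alpha> * b r * \<mu> r)) (at r within {s..t})"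
      by (simp add: has_real_derivative_iff_has_vector_derivative)
  qed
  from integral_unique[OF this] show ?thesis by simp
qed

lemma X_adapted: "t \<in> times_upto T \<Longrightarrow> X t \<in> borel_measurable (F t)"
  using sde by (simp add: sde_solution_def continuous_adapted_def)

lemma X_cont: "AE \<omega> in M. continuous_on (times_upto T) (\<lambda>t. X t \<omega>)"
  using sde by (simp add: sde_solution_def continuous_adapted_def)

lemma Y_adapted: "t \<in> times_upto T \<Longrightarrow> Y t \<in> borel_measurable (F t)"
  using X_adapted[of t] unfolding Y_def[abs_def] by simp

lemma Y_measurable: "t \<in> times_upto T \<Longrightarrow> Y t \<in> borel_measurable M"
  by (rule F_M[OF Y_adapted])

lemma Y_zero: "AE \<omega> in M. Y 0 \<omega> = 0"
  using sde by (auto simp: sde_solution_def Y_def)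

text \<open>The noise \<open>S = \<integral> \<sigma> dB\<close> inherits its Gaussian increments from \<open>B\<close>, as a limit of Riemann sums of the
  deterministic function \<open>\<sigma>\<close> against \<open>B\<close>.\<close>

lemma driving_noise:
  obtains S where "gaussian_increments M F T Q S"
    "\<And>t. t \<in> times_upto T \<Longrightarrow> AE \<omega> in M. X t \<omega> = integral {0..t} (\<lambda>s. \<alpha> * b s * X s \<omega>) + S t \<omega>"
proof -
  obtain S where S: "is_stochastic_integral M F T B (\<lambda>t \<omega>. \<sigma> t) S"
    and XS: "\<And>t. t \<in> times_upto T \<Longrightarrow> AE \<omega> in M. set_integrable lborel {0..t} (\<lambda>s. \<alpha> * b s * X s \<omega>) \<and>
        X t \<omega> = 0 + (LBINT s:{0..t}. \<alpha> * b s * X s \<omega>) + S t \<omega>"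
    using sde unfolding sde_solution_def by blast
  obtain k \<tau> \<xi> where simple: "\<And>n. is_simple_process F T (k n) (\<tau> n) (\<xi> n)"
    and ucp: "ucp_tendsto M T (\<lambda>n. simple_process (k n) (\<tau> n) (\<xi> n)) (\<lambda>t \<omega>. \<sigma> t)"
    and ucpS: "ucp_tendsto M T (\<lambda>n. simple_integral_process (k n) (\<tau> n) (\<xi> n) B) S"
    using S unfolding is_stochastic_integral_def by blast
  have Sad: "S t \<in> borel_measurable (F t)" if "t \<in> times_upto T" for t
    using S that by (simp add: is_stochastic_integral_def continuous_adapted_def)
  have "gaussian_increments M F T Q S"
  proof (rule gaussian_increments_limit[OF wiener_gaussian_increments[OF wiener] Sad])
    fix s t and \<epsilon> :: real assume st: "s \<in> times_upto T" "t \<in> times_upto T" "s \<le> t" and \<epsilon>: "0 < \<epsilon>"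
    have s0: "0 \<le> s" using st by (simp add: times_upto_def)
    have c2: "continuous_on {s..t} (\<lambda>s. (\<sigma> s)\<^sup>2)" using Q_cont[OF st(2)] s0 by (auto intro: continuous_on_subset)
    have id: "t' - s' = integral {s'..t'} (\<lambda>_. 1)" if "s \<le> s'" "s' \<le> t'" "t' \<le> t" for s' t' :: real using that by simp
    obtain \<delta> where \<delta>: "0 < \<delta>" "\<And>K \<rho> \<theta>. grid s t \<delta> K \<rho> \<Longrightarrow> \<forall>j<K. \<rho> j \<le> \<theta> j \<and> \<theta> j \<le> \<rho> (Suc j) \<Longrightarrow>
       \<bar>increment_sum K \<rho> (\<lambda>j. (\<sigma> (\<theta> j))\<^sup>2) (\<lambda>t. t) - integral {s..t} (\<lambda>s. (\<sigma> s)\<^sup>2 * 1)\<bar> \<le> \<epsilon>"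
      using increment_sum_integral_limit[OF c2 continuous_on_const[of _ 1] id \<epsilon>] by blast
    obtain K \<rho> where \<rho>: "grid s t \<delta> K \<rho>"
      "holds_up_to M \<epsilon> (\<lambda>\<omega>. \<bar>increment_sum K \<rho> (\<lambda>j. \<sigma> (\<rho> j)) (\<lambda>t. B t \<omega>) - (S t \<omega> - S s \<omega>)\<bar> \<le> \<epsilon>)"
      by (rule integral_increment_approx[OF wiener_gaussian_increments[OF wiener] _ _ simple ucp
            ucp_tendsto_holds_up_to[OF ucpS] s0 st(3,2) \<epsilon> \<delta>(1)]) (use \<sigma>_cont in auto)
    have "\<bar>increment_sum K \<rho> (\<lambda>j. (\<sigma> (\<rho> j))\<^sup>2) (\<lambda>t. t) - (Q t - Q s)\<bar> \<le> \<epsilon>"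
      using \<delta>(2)[OF \<rho>(1), of \<rho>] \<rho>(1) Q_diff[OF st(2) s0 st(3)] by (simp add: grid_def)
    with \<rho> show "\<exists>\<delta> K \<rho> x. grid s t \<delta> K \<rho> \<and> \<bar>increment_sum K \<rho> (\<lambda>j. (x j)\<^sup>2) (\<lambda>t. t) - (Q t - Q s)\<bar> \<le> \<epsilon> \<and>
        holds_up_to M \<epsilon> (\<lambda>\<omega>. \<bar>increment_sum K \<rho> x (\<lambda>t. B t \<omega>) - (S t \<omega> - S s \<omega>)\<bar> \<le> \<epsilon>)"
      by (intro exI[of _ \<delta>] exI[of _ K] exI[of _ \<rho>] exI[of _ "\<lambda>j. \<sigma> (\<rho> j)"] conjI)
  qed (auto intro!: Q_mono simp: times_upto_def)
  moreover have "AE \<omega> in M. X t \<omega> = integral {0..t} (\<lambda>s. \<alpha> * b s * X s \<omega>) + S t \<omega>" if "t \<in> times_upto T" for t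
    using XS[OF that] by eventually_elim (simp add: set_borel_integral_eq_integral)
  ultimately show ?thesis using that by blast
qed

text \<open>Pathwise, integration by parts turns the Riemann sums of \<open>\<mu>\<close> against
  \<open>S = X - \<alpha> \<integral> b X\<close> into the increment of \<open>\<mu> X\<close>: the two drift contributions cancel in the
  limit because \<open>\<mu>' = - \<alpha> b \<mu>\<close>.\<close>

lemma discounted_path_limit:
  assumes x: "continuous_on (times_upto T) x" and t: "t \<in> times_upto T" and st: "0 \<le> s" "s \<le> t" and "0 < \<epsilon>"
  shows "\<exists>\<delta>>0. \<forall>K \<rho>. grid s t \<delta> K \<rho> \<longrightarrow>
    \<bar>increment_sum K \<rho> (\<lambda>j. \<mu> (\<rho> j)) (\<lambda>r. x r - integral {0..r} (\<lambda>s. \<alpha> * b s * x s)) - (\<mu> t * x t - \<mu> s * x s)\<bar> \<le> \<epsilon>"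
proof -
  let ?I = "\<lambda>r. integral {0..r} (\<lambda>s. \<alpha> * b s * x s)"
  have c: "continuous_on {s..t} x" "continuous_on {s..t} b" "continuous_on {s..t} \<mu>" "continuous_on {0..t} (\<lambda>s. \<alpha> * b s * x s)"
    using st by (auto intro!: continuous_intros on_Icc[OF x t] on_Icc[OF b_cont t] continuous_on_subset[OF \<mu>_cont[OF t]])
  have c': "continuous_on {s..t} (\<lambda>r. - \<alpha> * b r * \<mu> r)" "continuous_on {s..t} (\<lambda>r. \<alpha> * b r * x r)"
    by (intro continuous_intros c)+
  have I: "?I t' - ?I s' = integral {s'..t'} (\<lambda>s. \<alpha> * b s * x s)" if "s \<le> s'" "s' \<le> t'" "t' \<le> t" for s' t'
    using that st by (intro integral_of_continuous_diff continuous_on_subset[OF c(4)]) auto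
  have M: "\<mu> t' - \<mu> s' = integral {s'..t'} (\<lambda>r. - \<alpha> * b r * \<mu> r)" if "s \<le> s'" "s' \<le> t'" "t' \<le> t" for s' t'
    using that st t by (intro \<mu>_diff times_upto_downward[OF t]) auto
  have e2: "0 < \<epsilon> / 2" using \<open>0 < \<epsilon>\<close> by simp
  obtain \<delta>1 where \<delta>1: "0 < \<delta>1" "\<And>K \<rho> \<theta>. grid s t \<delta>1 K \<rho> \<Longrightarrow> \<forall>j<K. \<rho> j \<le> \<theta> j \<and> \<theta> j \<le> \<rho> (Suc j) \<Longrightarrow>
       \<bar>increment_sum K \<rho> (\<lambda>j. x (\<theta> j)) \<mu> - integral {s..t} (\<lambda>r. x r * (- \<alpha> * b r * \<mu> r))\<bar> \<le> \<epsilon> / 2"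
    using increment_sum_integral_limit[OF c(1) c'(1) M e2] by blast
  obtain \<delta>2 where \<delta>2: "0 < \<delta>2" "\<And>K \<rho> \<theta>. grid s t \<delta>2 K \<rho> \<Longrightarrow> \<forall>j<K. \<rho> j \<le> \<theta> j \<and> \<theta> j \<le> \<rho> (Suc j) \<Longrightarrow>
       \<bar>increment_sum K \<rho> (\<lambda>j. \<mu> (\<theta> j)) ?I - integral {s..t} (\<lambda>r. \<mu> r * (\<alpha> * b r * x r))\<bar> \<le> \<epsilon> / 2"
    using increment_sum_integral_limit[OF c(3) c'(2) I e2] by blast
  have neg: "integral {s..t} (\<lambda>r. x r * (- \<alpha> * b r * \<mu> r)) = - integral {s..t} (\<lambda>r. \<mu> r * (\<alpha> * b r * x r))"
    unfolding integral_neg[symmetric] by (rule arg_cong[of _ _ "integral {s..t}"]) (auto simp: fun_eq_iff)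
  show ?thesis
  proof (intro exI[of _ "min \<delta>1 \<delta>2"] conjI allI impI)
    show "0 < min \<delta>1 \<delta>2" using \<delta>1 \<delta>2 by simp
    fix K \<rho> assume g: "grid s t (min \<delta>1 \<delta>2) K \<rho>"
    have mono: "\<forall>j<K. \<rho> j \<le> \<rho> (Suc j)" using g by (simp add: grid_def)
    have 1: "\<bar>increment_sum K \<rho> (\<lambda>j. x (\<rho> (Suc j))) \<mu> - integral {s..t} (\<lambda>r. x r * (- \<alpha> * b r * \<mu> r))\<bar> \<le> \<epsilon> / 2"
      using \<delta>1(2)[OF grid_weaken[OF g], of "\<lambda>j. \<rho> (Suc j)"] mono by simp
    have 2: "\<bar>increment_sum K \<rho> (\<lambda>j. \<mu> (\<rho> j)) ?I - integral {s..t} (\<lambda>r. \<mu> r * (\<alpha> * b r * x r))\<bar> \<le> \<epsilon> / 2"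
      using \<delta>2(2)[OF grid_weaken[OF g], of \<rho>] mono by simp
    have "increment_sum K \<rho> (\<lambda>j. \<mu> (\<rho> j)) (\<lambda>r. x r - ?I r) =
        increment_sum K \<rho> (\<lambda>j. \<mu> (\<rho> j)) x - increment_sum K \<rho> (\<lambda>j. \<mu> (\<rho> j)) ?I"
      by (simp add: increment_sum_def sum_subtractf[symmetric] algebra_simps)
    then show "\<bar>increment_sum K \<rho> (\<lambda>j. \<mu> (\<rho> j)) (\<lambda>r. x r - ?I r) - (\<mu> t * x t - \<mu> s * x s)\<bar> \<le> \<epsilon>"
      using 1 2 increment_sum_by_parts[OF g, of \<mu> x] unfolding neg by linarith
  qed
qed

lemma gaussian_increments_Y: "gaussian_increments M F T V Y"
proof -
  obtain S where S: "gaussian_increments M F T Q S"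
    and XS: "\<And>t. t \<in> times_upto T \<Longrightarrow> AE \<omega> in M. X t \<omega> = integral {0..t} (\<lambda>s. \<alpha> * b s * X s \<omega>) + S t \<omega>"
    using driving_noise by blast
  show ?thesis
  proof (rule gaussian_increments_limit[OF S Y_adapted])
    fix s t and \<epsilon> :: real assume st: "s \<in> times_upto T" "t \<in> times_upto T" "s \<le> t" and \<epsilon>: "0 < \<epsilon>"
    have s0: "0 \<le> s" using st by (simp add: times_upto_def)
    obtain K \<rho> where G: "\<And>n. grid s t (1 / real (Suc n)) (K n) (\<rho> n)"
      using grid_sequence[OF st(3)] by blast
    have \<rho>t: "\<rho> n j \<in> times_upto T" if "j \<le> K n" for n j
      using grid_times[OF G s0 st(2) that] .
    have SM: "S (\<rho> n j) \<in> borel_measurable M" if "j \<le> K n" for n j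
      using F_M[OF gaussian_increments_measurable[OF S \<rho>t] \<rho>t] that by blast
    have "AE \<omega> in M. \<forall>n. \<forall>j\<in>{..K n}. X (\<rho> n j) \<omega> = integral {0..\<rho> n j} (\<lambda>s. \<alpha> * b s * X s \<omega>) + S (\<rho> n j) \<omega>"
      unfolding AE_all_countable using XS[OF \<rho>t] by (intro allI AE_ball_countable') auto
    with X_cont have lim: "AE \<omega> in M. (\<lambda>n. increment_sum (K n) (\<rho> n) (\<lambda>j. \<mu> (\<rho> n j)) (\<lambda>t. S t \<omega>)) \<longlonglongrightarrow> Y t \<omega> - Y s \<omega>"
    proof eventually_elim
      case (elim \<omega>)
      have "(\<lambda>n. increment_sum (K n) (\<rho> n) (\<lambda>j. \<mu> (\<rho> n j)) (\<lambda>r. X r \<omega> - integral {0..r} (\<lambda>s. \<alpha> * b s * X s \<omega>)))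
          \<longlonglongrightarrow> Y t \<omega> - Y s \<omega>"
        unfolding Y_def
        by (rule grid_sequence_limit[OF G discounted_path_limit[OF elim(1) st(2) s0 st(3)]])
      moreover have "increment_sum (K n) (\<rho> n) (\<lambda>j. \<mu> (\<rho> n j)) (\<lambda>r. X r \<omega> - integral {0..r} (\<lambda>s. \<alpha> * b s * X s \<omega>)) =
          increment_sum (K n) (\<rho> n) (\<lambda>j. \<mu> (\<rho> n j)) (\<lambda>t. S t \<omega>)" for n
        unfolding increment_sum_def
      proof (rule sum.cong)
        fix j assume "j \<in> {..<K n}"
        then have "j \<in> {..K n}" "Suc j \<in> {..K n}" by auto
        with elim(2) have "X (\<rho> n j) \<omega> = integral {0..\<rho> n j} (\<lambda>s. \<alpha> * b s * X s \<omega>) + S (\<rho> n j) \<omega>"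
          "X (\<rho> n (Suc j)) \<omega> = integral {0..\<rho> n (Suc j)} (\<lambda>s. \<alpha> * b s * X s \<omega>) + S (\<rho> n (Suc j)) \<omega>" by blast+
        then show "\<mu> (\<rho> n j) * (X (\<rho> n (Suc j)) \<omega> - integral {0..\<rho> n (Suc j)} (\<lambda>s. \<alpha> * b s * X s \<omega>) -
            (X (\<rho> n j) \<omega> - integral {0..\<rho> n j} (\<lambda>s. \<alpha> * b s * X s \<omega>))) =
            \<mu> (\<rho> n j) * (S (\<rho> n (Suc j)) \<omega> - S (\<rho> n j) \<omega>)" by simp
      qed simp
      ultimately show ?case by simp
    qed
    have ev1: "\<forall>\<^sub>F n in sequentially. holds_up_to M \<epsilon>
        (\<lambda>\<omega>. \<bar>increment_sum (K n) (\<rho> n) (\<lambda>j. \<mu> (\<rho> n j)) (\<lambda>t. S t \<omega>) - (Y t \<omega> - Y s \<omega>)\<bar> \<le> \<epsilon>)"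
      using lim \<epsilon> \<epsilon>
    proof (rule AE_tendsto_holds_up_to[rotated])
      show "(\<lambda>\<omega>. increment_sum (K n) (\<rho> n) (\<lambda>j. \<mu> (\<rho> n j)) (\<lambda>t. S t \<omega>)) \<in> borel_measurable M" for n
        unfolding increment_sum_def
        by (intro borel_measurable_sum borel_measurable_times borel_measurable_diff SM) auto
    qed
    have cv: "continuous_on {s..t} (\<lambda>r. (\<mu> r)\<^sup>2)" "continuous_on {s..t} (\<lambda>r. (\<sigma> r)\<^sup>2)"
      using s0 by (auto intro!: continuous_intros continuous_on_subset[OF \<mu>_cont[OF st(2)]] on_Icc[OF \<sigma>_cont st(2)])
    have Qd: "Q t' - Q s' = integral {s'..t'} (\<lambda>r. (\<sigma> r)\<^sup>2)" if "s \<le> s'" "s' \<le> t'" "t' \<le> t" for s' t'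
      using that s0 by (intro Q_diff times_upto_downward[OF st(2)]) auto
    have "(\<lambda>n. increment_sum (K n) (\<rho> n) (\<lambda>j. (\<mu> (\<rho> n j))\<^sup>2) Q) \<longlonglongrightarrow> V t - V s"
    proof (rule grid_sequence_limit[OF G])
      fix e :: real assume e: "0 < e"
      obtain \<delta> where \<delta>: "0 < \<delta>" "\<And>K \<rho> \<theta>. grid s t \<delta> K \<rho> \<Longrightarrow> \<forall>j<K. \<rho> j \<le> \<theta> j \<and> \<theta> j \<le> \<rho> (Suc j) \<Longrightarrow>
         \<bar>increment_sum K \<rho> (\<lambda>j. (\<mu> (\<theta> j))\<^sup>2) Q - integral {s..t} (\<lambda>r. (\<mu> r)\<^sup>2 * (\<sigma> r)\<^sup>2)\<bar> \<le> e"
        using increment_sum_integral_limit[OF cv Qd e] by blast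
      then show "\<exists>\<delta>>0. \<forall>K \<rho>. grid s t \<delta> K \<rho> \<longrightarrow> \<bar>increment_sum K \<rho> (\<lambda>j. (\<mu> (\<rho> j))\<^sup>2) Q - (V t - V s)\<bar> \<le> e"
        unfolding V_diff[OF st(2) s0 st(3)] by (intro exI[of _ \<delta>]) (auto simp: grid_def)
    qed
    then have ev2: "\<forall>\<^sub>F n in sequentially. \<bar>increment_sum (K n) (\<rho> n) (\<lambda>j. (\<mu> (\<rho> n j))\<^sup>2) Q - (V t - V s)\<bar> < \<epsilon>"
      using \<epsilon> unfolding tendsto_iff dist_real_def by blast
    from eventually_happens'[OF sequentially_bot eventually_conj[OF ev1 ev2]]
    obtain n where n: "holds_up_to M \<epsilon>
        (\<lambda>\<omega>. \<bar>increment_sum (K n) (\<rho> n) (\<lambda>j. \<mu> (\<rho> n j)) (\<lambda>t. S t \<omega>) - (Y t \<omega> - Y s \<omega>)\<bar> \<le> \<epsilon>)"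
      "\<bar>increment_sum (K n) (\<rho> n) (\<lambda>j. (\<mu> (\<rho> n j))\<^sup>2) Q - (V t - V s)\<bar> < \<epsilon>" by blast
    show "\<exists>\<delta> K \<rho> x. grid s t \<delta> K \<rho> \<and> \<bar>increment_sum K \<rho> (\<lambda>j. (x j)\<^sup>2) Q - (V t - V s)\<bar> \<le> \<epsilon> \<and>
        holds_up_to M \<epsilon> (\<lambda>\<omega>. \<bar>increment_sum K \<rho> x (\<lambda>t. S t \<omega>) - (Y t \<omega> - Y s \<omega>)\<bar> \<le> \<epsilon>)"
      using G[of n] n by (meson less_imp_le)
  qed (auto intro!: V_mono simp: times_upto_def)
qed

lemma indep_normal_Y: "s \<in> times_upto T \<Longrightarrow> t \<in> times_upto T \<Longrightarrow> s \<le> t \<Longrightarrow>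
    indep_normal M (F s) (V t - V s) (\<lambda>\<omega>. Y t \<omega> - Y s \<omega>)"
  using gaussian_increments_Y by (simp add: gaussian_increments_def)

lemma normal_Y:
  assumes t: "t \<in> times_upto T"
  shows "indep_normal M (F 0) (V t) (Y t)"
proof (rule indep_normal_AE_cong[OF _ Y_measurable[OF t] _ subalg[OF zero_times]])
  show "indep_normal M (F 0) (V t) (\<lambda>\<omega>. Y t \<omega> - Y 0 \<omega>)"
    using indep_normal_Y[OF zero_times t] t by (simp add: times_upto_def)
  show "AE \<omega> in M. Y t \<omega> = Y t \<omega> - Y 0 \<omega>" using Y_zero by eventually_elim simp
qed

lemma Y_second_moment:
  assumes "t \<in> times_upto T"
  shows "integrable M (\<lambda>\<omega>. (Y t \<omega>)\<^sup>2)" "expectation (\<lambda>\<omega>. (Y t \<omega>)\<^sup>2) = V t"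
  using indep_normal_moments(3,4)[OF subalg[OF zero_times] normal_Y[OF assms]] by auto

text \<open>\<open>E X\<^sup>2 = V / \<mu>\<^sup>2\<close>, and \<open>b\<^sup>2 / (\<mu>\<^sup>2 \<sigma>\<^sup>2) = h\<^sup>2 \<sigma>\<^sup>2\<close>.\<close>

lemma fisher_information_eq:
  assumes t: "t \<in> times_upto T"
  shows "fisher_information M b \<sigma> X t = integral {0..t} (\<lambda>s. V s * ((h s)\<^sup>2 * (\<sigma> s)\<^sup>2))"
proof -
  have "fisher_information M b \<sigma> X t = (LBINT s:{0..t}. V s * ((h s)\<^sup>2 * (\<sigma> s)\<^sup>2))"
    unfolding fisher_information_def
  proof (rule set_lebesgue_integral_cong)
    show "\<forall>s. s \<in> {0..t} \<longrightarrow> (b s)\<^sup>2 * expectation (\<lambda>\<omega>. (X s \<omega>)\<^sup>2) / (\<sigma> s)\<^sup>2 = V s * ((h s)\<^sup>2 * (\<sigma> s)\<^sup>2)"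
    proof (intro allI impI)
      fix s assume s: "s \<in> {0..t}"
      then have st: "s \<in> times_upto T" using t by (auto intro: times_upto_downward)
      have "(X s \<omega>)\<^sup>2 = (Y s \<omega>)\<^sup>2 / (\<mu> s)\<^sup>2" for \<omega> by (simp add: Y_def power_mult_distrib)
      then have "expectation (\<lambda>\<omega>. (X s \<omega>)\<^sup>2) = V s / (\<mu> s)\<^sup>2"
        using Y_second_moment(2)[OF st] by simp
      then show "(b s)\<^sup>2 * expectation (\<lambda>\<omega>. (X s \<omega>)\<^sup>2) / (\<sigma> s)\<^sup>2 = V s * ((h s)\<^sup>2 * (\<sigma> s)\<^sup>2)"
        using \<sigma>_nz[OF t s] by (simp add: h_def power_mult_distrib power_divide power2_eq_square mult_ac)
    qed
  qed simp
  also have "\<dots> = integral {0..t} (\<lambda>s. V s * ((h s)\<^sup>2 * (\<sigma> s)\<^sup>2))"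
    unfolding V_def
    by (intro LBINT_continuous continuous_on_mult A_cont t indefinite_integral_continuous_1
        integrable_continuous_interval V_cont)
  finally show ?thesis .
qed


text \<open>Measurability and moments of integrals along the paths are read off from such Riemann sums,
  which takes the place of joint measurability in time and chance.\<close>

lemma path_riemann_sums:
  assumes U: "AE \<omega> in M. continuous_on (times_upto T) (\<lambda>s. U s \<omega>)"
    and w: "continuous_on {0..t} w" and t: "t \<in> times_upto T" and st: "0 \<le> s" "s \<le> t"
    and G: "\<And>n. grid s t (1 / real (Suc n)) (K n) (\<rho> n)"
  shows "AE \<omega> in M. (\<lambda>n. increment_sum (K n) (\<rho> n) (\<lambda>j. U (\<rho> n j) \<omega>) (\<lambda>r. integral {0..r} w)) \<longlonglongrightarrow>
    integral {s..t} (\<lambda>r. U r \<omega> * w r)"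
  using U
proof eventually_elim
  case (elim \<omega>)
  show ?case
  proof (rule grid_sequence_limit[OF G])
    fix e :: real assume e: "0 < e"
    have W: "integral {0..t'} w - integral {0..s'} w = integral {s'..t'} w" if "s \<le> s'" "s' \<le> t'" "t' \<le> t" for s' t'
      using that st by (intro integral_of_continuous_diff continuous_on_subset[OF w]) auto
    have c: "continuous_on {s..t} (\<lambda>s. U s \<omega>)" "continuous_on {s..t} w"
      using on_Icc[OF elim t st(1)] continuous_on_subset[OF w, of "{s..t}"] st by auto
    obtain \<delta> where "0 < \<delta>" "\<And>K \<rho> \<theta>. grid s t \<delta> K \<rho> \<Longrightarrow> \<forall>j<K. \<rho> j \<le> \<theta> j \<and> \<theta> j \<le> \<rho> (Suc j) \<Longrightarrow>
       \<bar>increment_sum K \<rho> (\<lambda>j. U (\<theta> j) \<omega>) (\<lambda>r. integral {0..r} w) - integral {s..t} (\<lambda>r. U r \<omega> * w r)\<bar> \<le> e"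
      using increment_sum_integral_limit[OF c W e] by blast
    then show "\<exists>\<delta>>0. \<forall>K \<rho>. grid s t \<delta> K \<rho> \<longrightarrow>
        \<bar>increment_sum K \<rho> (\<lambda>j. U (\<rho> j) \<omega>) (\<lambda>r. integral {0..r} w) - integral {s..t} (\<lambda>r. U r \<omega> * w r)\<bar> \<le> e"
      by (intro exI[of _ \<delta>]) (auto simp: grid_def)
  qed
qed

lemma path_riemann_sums_measurable:
  assumes "\<And>s. s \<in> times_upto T \<Longrightarrow> U s \<in> borel_measurable M" and t: "t \<in> times_upto T" and s: "0 \<le> s"
    and G: "grid s t \<delta> K \<rho>"
  shows "(\<lambda>\<omega>. increment_sum K \<rho> (\<lambda>j. U (\<rho> j) \<omega>) W) \<in> borel_measurable M"
  unfolding increment_sum_def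
  by (intro borel_measurable_sum borel_measurable_times borel_measurable_const assms(1))
    (use grid_times[OF G s t] in auto)

lemma path_integral_bounded:
  fixes U :: "real \<Rightarrow> 'a \<Rightarrow> real"
  assumes U: "AE \<omega> in M. continuous_on (times_upto T) (\<lambda>s. U s \<omega>)"
    and Um: "\<And>s. s \<in> times_upto T \<Longrightarrow> U s \<in> borel_measurable M"
    and w: "continuous_on {0..t} w" and t: "t \<in> times_upto T" and "0 < \<delta>"
  shows "\<exists>K>0. holds_up_to M \<delta> (\<lambda>\<omega>. \<bar>integral {0..t} (\<lambda>r. U r \<omega> * w r)\<bar> \<le> K)"
proof -
  have t0: "0 \<le> t" using t by (simp add: times_upto_def)
  obtain K \<rho> where G: "\<And>n. grid 0 t (1 / real (Suc n)) (K n) (\<rho> n)" using grid_sequence[OF t0] by blast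
  let ?f = "\<lambda>n \<omega>. increment_sum (K n) (\<rho> n) (\<lambda>j. U (\<rho> n j) \<omega>) (\<lambda>r. integral {0..r} w)"
  have m: "?f n \<in> borel_measurable M" for n
    using path_riemann_sums_measurable[OF Um t order_refl G] .
  have "0 < \<delta> / 2" using \<open>0 < \<delta>\<close> by simp
  from AE_tendsto_holds_up_to[OF m path_riemann_sums[OF U w t order_refl t0 G] zero_less_one this]
  obtain n where n: "holds_up_to M (\<delta> / 2) (\<lambda>\<omega>. \<bar>?f n \<omega> - integral {0..t} (\<lambda>r. U r \<omega> * w r)\<bar> \<le> 1)"
    by (auto dest: eventually_happens'[OF sequentially_bot])
  obtain C where C: "0 < C" "holds_up_to M (\<delta> / 2) (\<lambda>\<omega>. \<bar>?f n \<omega>\<bar> \<le> C)"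
    using holds_up_to_bounded[OF m \<open>0 < \<delta> / 2\<close>] by blast
  have "holds_up_to M \<delta> (\<lambda>\<omega>. \<bar>integral {0..t} (\<lambda>r. U r \<omega> * w r)\<bar> \<le> C + 1)"
    by (rule holds_up_to_mono[OF holds_up_to_conj[OF n C(2)]]) auto
  then show ?thesis using C(1) by (intro exI[of _ "C + 1"]) auto
qed

text \<open>Estimators and path integrals are determined only up to null sets; they are measurable because
  \<open>M\<close> is complete.\<close>

lemma measurable_AE_eq:
  fixes f g :: "'a \<Rightarrow> real"
  assumes g [measurable]: "g \<in> borel_measurable M" and eq: "AE \<omega> in M. f \<omega> = g \<omega>"
  shows "f \<in> borel_measurable M"
proof (rule borel_measurableI)
  fix S :: "real set" assume "open S"
  then have [measurable]: "S \<in> sets borel" by simp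
  obtain N where N: "N \<in> null_sets M" "{\<omega>\<in>space M. f \<omega> \<noteq> g \<omega>} \<subseteq> N"
    using eq by (auto simp: eventually_ae_filter)
  have negl: "C \<in> sets M" if "C \<subseteq> N" for C
    using that N(1) complete by (auto simp: negligible_sets_def)
  have "g -` S \<inter> space M \<in> sets M" by measurable
  then have "((g -` S \<inter> space M) - N) \<union> (f -` S \<inter> space M \<inter> N) \<in> sets M"
    using negl[of "f -` S \<inter> space M \<inter> N"] negl[of N] by (intro sets.Un sets.Diff) auto
  also have "((g -` S \<inter> space M) - N) \<union> (f -` S \<inter> space M \<inter> N) = f -` S \<inter> space M"
    using N(2) by auto
  finally show "f -` S \<inter> space M \<in> sets M" .
qed

lemma measurable_AE_limit:
  fixes f :: "nat \<Rightarrow> 'a \<Rightarrow> real"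
  assumes [measurable]: "\<And>n. f n \<in> borel_measurable M" and lim: "AE \<omega> in M. (\<lambda>n. f n \<omega>) \<longlonglongrightarrow> g \<omega>"
  shows "g \<in> borel_measurable M"
proof (rule measurable_AE_eq)
  show "(\<lambda>\<omega>. lim (\<lambda>n. f n \<omega>)) \<in> borel_measurable M" by measurable
  show "AE \<omega> in M. g \<omega> = lim (\<lambda>n. f n \<omega>)" using lim by eventually_elim (simp add: limI)
qed


section \<open>Numerator and denominator of the estimation error\<close>

text \<open>\<open>J\<close> is the denominator \<open>\<integral> b\<^sup>2 X\<^sup>2 / \<sigma>\<^sup>2 ds\<close> of the estimator, the observed information. For a version \<open>R\<close> of
  \<open>\<integral> b X / \<sigma>\<^sup>2 dX\<close>, the numerator of the estimation error is \<open>R - \<alpha> J\<close>.\<close>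

definition "J t \<omega> = integral {0..t} (\<lambda>s. (Y s \<omega>)\<^sup>2 * ((h s)\<^sup>2 * (\<sigma> s)\<^sup>2))" for t \<omega>

abbreviation score_integral :: "(real \<Rightarrow> 'a \<Rightarrow> real) \<Rightarrow> bool" where
  "score_integral \<equiv> is_stochastic_integral M F T X (\<lambda>s \<omega>. b s * X s \<omega> / (\<sigma> s)\<^sup>2)"

lemma score_integrand: "b s * X s \<omega> / (\<sigma> s)\<^sup>2 = h s * Y s \<omega>"
  by (simp add: h_def Y_def)

lemma Y_cont:
  assumes "t \<in> times_upto T" "continuous_on (times_upto T) (\<lambda>s. X s \<omega>)"
  shows "continuous_on {0..t} (\<lambda>s. Y s \<omega>)"
  unfolding Y_def using assms by (intro continuous_intros \<mu>_cont on_Icc[OF assms(2)]) auto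

lemma Y_paths: "AE \<omega> in M. continuous_on (times_upto T) (\<lambda>s. Y s \<omega>)"
  using X_cont by eventually_elim (rule continuous_on_times_upto[OF Y_cont])

lemma J_riemann_sums:
  assumes t: "t \<in> times_upto T" and st: "0 \<le> s" "s \<le> t" and G: "\<And>n. grid s t (1 / real (Suc n)) (K n) (\<rho> n)"
  shows "AE \<omega> in M. (\<lambda>n. increment_sum (K n) (\<rho> n) (\<lambda>j. (Y (\<rho> n j) \<omega>)\<^sup>2) A) \<longlonglongrightarrow> J t \<omega> - J s \<omega>"
proof -
  have "AE \<omega> in M. continuous_on (times_upto T) (\<lambda>s. (Y s \<omega>)\<^sup>2)"
    using Y_paths by eventually_elim (intro continuous_intros)
  from path_riemann_sums[OF this A_cont[OF t] t st G] Y_paths show ?thesis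
  proof eventually_elim
    case (elim \<omega>)
    have "J t \<omega> - J s \<omega> = integral {s..t} (\<lambda>r. (Y r \<omega>)\<^sup>2 * ((h r)\<^sup>2 * (\<sigma> r)\<^sup>2))"
      unfolding J_def using st
      by (intro integral_of_continuous_diff continuous_on_mult A_cont t continuous_intros on_Icc[OF elim(2)]) auto
    with elim(1) show ?case by (simp add: A_def[abs_def])
  qed
qed

lemma Y_sq_measurable: "t \<in> times_upto T \<Longrightarrow> (\<lambda>\<omega>. (Y t \<omega>)\<^sup>2) \<in> borel_measurable M"
  using Y_measurable by simp

lemma J_measurable:
  assumes t: "t \<in> times_upto T"
  shows "J t \<in> borel_measurable M"
proof -
  have t0: "0 \<le> t" using t by (simp add: times_upto_def)
  obtain K \<rho> where G: "\<And>n. grid 0 t (1 / real (Suc n)) (K n) (\<rho> n)" using grid_sequence[OF t0] by blast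
  have "AE \<omega> in M. (\<lambda>n. increment_sum (K n) (\<rho> n) (\<lambda>j. (Y (\<rho> n j) \<omega>)\<^sup>2) A) \<longlonglongrightarrow> J t \<omega>"
    using J_riemann_sums[OF t order_refl t0 G] by (simp add: J_def[of 0])
  then show ?thesis
    by (rule measurable_AE_limit[rotated]) (rule path_riemann_sums_measurable[OF Y_sq_measurable t order_refl G])
qed

text \<open>Replacing \<open>dX = \<alpha> b X dt + dS\<close> by \<open>dS\<close> in the score integral subtracts \<open>\<alpha> J\<close>.\<close>

lemma score_against_noise:
  assumes S: "\<And>t. t \<in> times_upto T \<Longrightarrow> AE \<omega> in M. X t \<omega> = integral {0..t} (\<lambda>s. \<alpha> * b s * X s \<omega>) + S t \<omega>"
    and simple: "\<And>n. is_simple_process F T (k n) (\<tau> n) (\<xi> n)"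
    and ucp: "ucp_tendsto M T (\<lambda>n. simple_process (k n) (\<tau> n) (\<xi> n)) (\<lambda>s \<omega>. h s * Y s \<omega>)"
    and ucpR: "ucp_tendsto M T (\<lambda>n. simple_integral_process (k n) (\<tau> n) (\<xi> n) X) R"
    and t: "t \<in> times_upto T" and "0 < \<epsilon>"
  shows "\<forall>\<^sub>F n in sequentially. holds_up_to M \<epsilon>
    (\<lambda>\<omega>. \<bar>simple_integral_process (k n) (\<tau> n) (\<xi> n) S t \<omega> - (R t \<omega> - \<alpha> * J t \<omega>)\<bar> \<le> \<epsilon>)"
proof -
  have t0: "0 \<le> t" using t by (simp add: times_upto_def)
  have e4: "0 < \<epsilon> / 4" using \<open>0 < \<epsilon>\<close> by simp
  have "continuous_on {0..t} (\<lambda>s. \<bar>\<alpha> * b s\<bar>)" by (intro continuous_intros on_Icc[OF b_cont t]) auto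
  moreover have "AE \<omega> in M. continuous_on (times_upto T) (\<lambda>s. \<bar>X s \<omega>\<bar>)"
    using X_cont by eventually_elim (intro continuous_intros)
  moreover have "(\<lambda>\<omega>. \<bar>X s \<omega>\<bar>) \<in> borel_measurable M" if "s \<in> times_upto T" for s
    using F_M[OF X_adapted that] that by simp
  ultimately obtain C where C: "0 < C"
    "holds_up_to M (\<epsilon> / 4) (\<lambda>\<omega>. \<bar>integral {0..t} (\<lambda>r. \<bar>X r \<omega>\<bar> * \<bar>\<alpha> * b r\<bar>)\<bar> \<le> C)"
    using path_integral_bounded[where U="\<lambda>s \<omega>. \<bar>X s \<omega>\<bar>", OF _ _ _ t e4] by blast
  define \<kappa> where "\<kappa> = \<epsilon> / (4 * C)"
  have \<kappa>: "0 < \<kappa>" using C(1) \<open>0 < \<epsilon>\<close> by (simp add: \<kappa>_def)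
  have "\<forall>\<^sub>F n in sequentially. \<exists>A\<in>sets M. measure M A < \<epsilon> / 4 \<and>
      (\<forall>\<omega>\<in>space M - A. \<forall>s\<in>{0..t}. \<bar>simple_process (k n) (\<tau> n) (\<xi> n) s \<omega> - h s * Y s \<omega>\<bar> < \<kappa>)"
    using ucp t \<kappa> e4 unfolding ucp_tendsto_def by blast
  with ucp_tendsto_holds_up_to[OF ucpR t e4] show ?thesis
  proof eventually_elim
    case (elim n)
    have \<tau>: "0 \<le> \<tau> n i" if "i \<le> k n" for i
      using simple_process_mono[OF simple[of n], of 0 i] simple[of n] that by (simp add: is_simple_process_def)
    have "AE \<omega> in M. \<forall>i\<in>{..k n}. X (min t (\<tau> n i)) \<omega> =
        integral {0..min t (\<tau> n i)} (\<lambda>s. \<alpha> * b s * X s \<omega>) + S (min t (\<tau> n i)) \<omega>"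
      by (intro AE_ball_countable' S times_upto_downward[OF t]) (use t0 \<tau> in auto)
    with X_cont have ae: "AE \<omega> in M. continuous_on (times_upto T) (\<lambda>t. X t \<omega>) \<and>
        (\<forall>i\<in>{..k n}. X (min t (\<tau> n i)) \<omega> =
          integral {0..min t (\<tau> n i)} (\<lambda>s. \<alpha> * b s * X s \<omega>) + S (min t (\<tau> n i)) \<omega>)"
      by eventually_elim blast
    have close: "holds_up_to M (\<epsilon> / 4) (\<lambda>\<omega>. \<forall>s\<in>{0..t}. \<bar>simple_process (k n) (\<tau> n) (\<xi> n) s \<omega> - h s * Y s \<omega>\<bar> < \<kappa>)"
      using elim(2) unfolding holds_up_to_def by (meson less_imp_le)
    from holds_up_to_conj[OF AE_holds_up_to[OF ae order_refl]
        holds_up_to_conj[OF close holds_up_to_conj[OF C(2) elim(1)]]]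
    show ?case
    proof (rule holds_up_to_mono)
      show "0 + (\<epsilon> / 4 + (\<epsilon> / 4 + \<epsilon> / 4)) \<le> \<epsilon>" using \<open>0 < \<epsilon>\<close> by simp
      fix \<omega>
      assume *: "(continuous_on (times_upto T) (\<lambda>t. X t \<omega>) \<and>
          (\<forall>i\<in>{..k n}. X (min t (\<tau> n i)) \<omega> =
            integral {0..min t (\<tau> n i)} (\<lambda>s. \<alpha> * b s * X s \<omega>) + S (min t (\<tau> n i)) \<omega>)) \<and>
        (\<forall>s\<in>{0..t}. \<bar>simple_process (k n) (\<tau> n) (\<xi> n) s \<omega> - h s * Y s \<omega>\<bar> < \<kappa>) \<and>
        \<bar>integral {0..t} (\<lambda>r. \<bar>X r \<omega>\<bar> * \<bar>\<alpha> * b r\<bar>)\<bar> \<le> C \<and>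
        \<bar>simple_integral_process (k n) (\<tau> n) (\<xi> n) X t \<omega> - R t \<omega>\<bar> \<le> \<epsilon> / 4"
      let ?g = "\<lambda>s. \<alpha> * b s * X s \<omega>"
      have cH: "continuous_on {0..t} (\<lambda>s. h s * Y s \<omega>)" and cg: "continuous_on {0..t} ?g"
      proof -
        have cX: "continuous_on (times_upto T) (\<lambda>t. X t \<omega>)" using * by blast
        show "continuous_on {0..t} (\<lambda>s. h s * Y s \<omega>)" by (rule continuous_on_mult[OF h_cont[OF t] Y_cont[OF t cX]])
        show "continuous_on {0..t} ?g"
          by (rule continuous_on_mult[OF continuous_on_mult[OF continuous_on_const on_Icc[OF b_cont t order_refl]]
                on_Icc[OF cX t order_refl]])
      qed
      have "\<bar>simple_integral_process (k n) (\<tau> n) (\<xi> n) (\<lambda>r _. integral {0..r} ?g) t \<omega> -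
          integral {0..t} (\<lambda>s. (h s * Y s \<omega>) * ?g s)\<bar> \<le> \<kappa> * integral {0..t} (\<lambda>s. \<bar>?g s\<bar>)"
        using * by (intro simple_integral_drift[OF simple t0 cH cg]) (auto intro: less_imp_le)
      also have "\<dots> \<le> \<kappa> * C"
      proof (rule mult_left_mono)
        have "(\<lambda>s. \<bar>?g s\<bar>) = (\<lambda>r. \<bar>X r \<omega>\<bar> * \<bar>\<alpha> * b r\<bar>)" by (auto simp: abs_mult)
        then show "integral {0..t} (\<lambda>s. \<bar>?g s\<bar>) \<le> C" using * by (metis abs_le_D1)
      qed (use \<kappa> in simp)
      also have "\<dots> = \<epsilon> / 4" using C(1) by (simp add: \<kappa>_def)
      finally have 1: "\<bar>simple_integral_process (k n) (\<tau> n) (\<xi> n) (\<lambda>r _. integral {0..r} ?g) t \<omega> -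
          integral {0..t} (\<lambda>s. (h s * Y s \<omega>) * ?g s)\<bar> \<le> \<epsilon> / 4" .
      have "integral {0..t} (\<lambda>s. (h s * Y s \<omega>) * ?g s) = integral {0..t} (\<lambda>s. \<alpha> * ((Y s \<omega>)\<^sup>2 * ((h s)\<^sup>2 * (\<sigma> s)\<^sup>2)))"
      proof (rule Henstock_Kurzweil_Integration.integral_cong)
        fix s assume "s \<in> {0..t}"
        from \<sigma>_nz[OF t this] show "(h s * Y s \<omega>) * ?g s = \<alpha> * ((Y s \<omega>)\<^sup>2 * ((h s)\<^sup>2 * (\<sigma> s)\<^sup>2))"
          by (simp add: h_def Y_def power2_eq_square)
      qed
      then have 2: "integral {0..t} (\<lambda>s. (h s * Y s \<omega>) * ?g s) = \<alpha> * J t \<omega>" by (simp add: J_def)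
      have "simple_integral_process (k n) (\<tau> n) (\<xi> n) S t \<omega> =
          simple_integral_process (k n) (\<tau> n) (\<xi> n) X t \<omega> -
          simple_integral_process (k n) (\<tau> n) (\<xi> n) (\<lambda>r _. integral {0..r} ?g) t \<omega>"
        unfolding simple_integral_process_def sum_subtractf[symmetric] right_diff_distrib[symmetric]
      proof (intro sum.cong refl arg_cong2[where f="(*)"])
        fix i assume "i \<in> {..<k n}"
        then have "i \<in> {..k n}" "Suc i \<in> {..k n}" by auto
        with * have "X (min t (\<tau> n i)) \<omega> = integral {0..min t (\<tau> n i)} ?g + S (min t (\<tau> n i)) \<omega>"
          "X (min t (\<tau> n (Suc i))) \<omega> = integral {0..min t (\<tau> n (Suc i))} ?g + S (min t (\<tau> n (Suc i))) \<omega>" by blast+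
        then show "S (min t (\<tau> n (Suc i))) \<omega> - S (min t (\<tau> n i)) \<omega> =
            X (min t (\<tau> n (Suc i))) \<omega> - X (min t (\<tau> n i)) \<omega> -
            (integral {0..min t (\<tau> n (Suc i))} ?g - integral {0..min t (\<tau> n i)} ?g)" by simp
      qed
      with 1 2 * \<open>0 < \<epsilon>\<close>
      show "\<bar>simple_integral_process (k n) (\<tau> n) (\<xi> n) S t \<omega> - (R t \<omega> - \<alpha> * J t \<omega>)\<bar> \<le> \<epsilon>" by linarith
    qed
  qed
qed

text \<open>Once the drift of \<open>X\<close> has been absorbed into \<open>\<alpha> J\<close>, the integrator \<open>S\<close> has Gaussian increments, and
  the approximation by Riemann sums applies.\<close>

lemma score_increment_approx:
  assumes R: "score_integral R" and S: "gaussian_increments M F T Q S"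
    and XS: "\<And>t. t \<in> times_upto T \<Longrightarrow> AE \<omega> in M. X t \<omega> = integral {0..t} (\<lambda>s. \<alpha> * b s * X s \<omega>) + S t \<omega>"
    and ac: "0 \<le> a" "a \<le> c" "c \<in> times_upto T" and "0 < \<epsilon>" "0 < \<delta>"
  obtains K \<rho> where "grid a c \<delta> K \<rho>"
    "holds_up_to M \<epsilon> (\<lambda>\<omega>. \<bar>increment_sum K \<rho> (\<lambda>j. h (\<rho> j) * Y (\<rho> j) \<omega>) (\<lambda>t. S t \<omega>) -
       ((R c \<omega> - \<alpha> * J c \<omega>) - (R a \<omega> - \<alpha> * J a \<omega>))\<bar> \<le> \<epsilon>)"
proof -
  obtain k \<tau> \<xi> where simple: "\<And>n. is_simple_process F T (k n) (\<tau> n) (\<xi> n)"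
    and ucp: "ucp_tendsto M T (\<lambda>n. simple_process (k n) (\<tau> n) (\<xi> n)) (\<lambda>s \<omega>. h s * Y s \<omega>)"
    and ucpR: "ucp_tendsto M T (\<lambda>n. simple_integral_process (k n) (\<tau> n) (\<xi> n) X) R"
    using R unfolding is_stochastic_integral_def score_integrand by blast
  have "AE \<omega> in M. continuous_on (times_upto T) (\<lambda>s. h s * Y s \<omega>)"
    using Y_paths by eventually_elim (rule continuous_on_mult[OF continuous_on_times_upto[OF h_cont]])
  moreover have "(\<lambda>\<omega>. h t * Y t \<omega>) \<in> borel_measurable (F t)" if "t \<in> times_upto T" for t
    using Y_adapted[OF that] by simp
  ultimately show ?thesis
    using integral_increment_approx[where H="\<lambda>s \<omega>. h s * Y s \<omega>" and J="\<lambda>t \<omega>. R t \<omega> - \<alpha> * J t \<omega>",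
        OF S _ _ simple ucp score_against_noise[OF XS simple ucp ucpR] ac \<open>0 < \<epsilon>\<close> \<open>0 < \<delta>\<close>] that
    by blast
qed

text \<open>The elementary integrals vanish at time \<open>0\<close>.\<close>

lemma score_integral_start:
  assumes R: "score_integral R" and "0 < \<epsilon>"
  shows "holds_up_to M \<epsilon> (\<lambda>\<omega>. \<bar>R 0 \<omega>\<bar> \<le> \<epsilon>)"
proof -
  obtain k \<tau> \<xi> where simple: "\<And>n. is_simple_process F T (k n) (\<tau> n) (\<xi> n)"
    and ucpR: "ucp_tendsto M T (\<lambda>n. simple_integral_process (k n) (\<tau> n) (\<xi> n) X) R"
    using R unfolding is_stochastic_integral_def by blast
  have "simple_integral_process (k n) (\<tau> n) (\<xi> n) X 0 \<omega> = 0" for n \<omega>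
  proof -
    have "0 \<le> \<tau> n i" if "i \<le> k n" for i
      using simple_process_mono[OF simple[of n], of 0 i] simple[of n] that by (simp add: is_simple_process_def)
    then show ?thesis
      unfolding simple_integral_process_def by (intro sum.neutral) (simp add: min_def)
  qed
  then show ?thesis
    using ucp_tendsto_holds_up_to[OF ucpR zero_times \<open>0 < \<epsilon>\<close>] by simp
qed


section \<open>Freezing the discounted solution\<close>

lemma sqrt_diff_squared_le:
  assumes "0 \<le> p" "0 \<le> q"
  shows "(sqrt p - sqrt q)\<^sup>2 \<le> \<bar>p - q\<bar>"
proof -
  have "(sqrt p - sqrt q)\<^sup>2 = \<bar>sqrt p - sqrt q\<bar> * \<bar>sqrt p - sqrt q\<bar>" by (simp add: power2_eq_square)
  also have "\<dots> \<le> \<bar>sqrt p - sqrt q\<bar> * \<bar>sqrt p + sqrt q\<bar>"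
  proof (rule mult_left_mono)
    have "0 \<le> sqrt p" "0 \<le> sqrt q" using assms by auto
    then show "\<bar>sqrt p - sqrt q\<bar> \<le> \<bar>sqrt p + sqrt q\<bar>" by linarith
  qed simp
  also have "\<dots> = \<bar>(sqrt p - sqrt q) * (sqrt p + sqrt q)\<bar>" by (simp only: abs_mult)
  also have "(sqrt p - sqrt q) * (sqrt p + sqrt q) = p - q"
    using assms by (simp add: algebra_simps)
  finally show ?thesis .
qed

text \<open>The grid is taken so fine that also the variance of the frozen sum, with coefficients \<open>h\<close>, is close
  to its limit \<open>A c - A a\<close>.\<close>

lemma score_riemann_sum:
  assumes R: "score_integral R" and ac: "0 \<le> a" "a \<le> c" "c \<in> times_upto T" and "0 < \<epsilon>" "0 < \<eta>"
  obtains S K \<rho> \<delta> where "gaussian_increments M F T Q S" "grid a c \<delta> K \<rho>"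
    "\<bar>increment_sum K \<rho> (\<lambda>j. (h (\<rho> j))\<^sup>2) Q - (A c - A a)\<bar> \<le> \<eta>"
    "holds_up_to M \<epsilon> (\<lambda>\<omega>. \<bar>increment_sum K \<rho> (\<lambda>j. h (\<rho> j) * Y (\<rho> j) \<omega>) (\<lambda>t. S t \<omega>) -
       ((R c \<omega> - \<alpha> * J c \<omega>) - (R a \<omega> - \<alpha> * J a \<omega>))\<bar> \<le> \<epsilon>)"
proof -
  obtain S where S: "gaussian_increments M F T Q S"
    and XS: "\<And>t. t \<in> times_upto T \<Longrightarrow> AE \<omega> in M. X t \<omega> = integral {0..t} (\<lambda>s. \<alpha> * b s * X s \<omega>) + S t \<omega>"
    using driving_noise by blast
  have cv: "continuous_on {a..c} (\<lambda>r. (h r)\<^sup>2)" "continuous_on {a..c} (\<lambda>r. (\<sigma> r)\<^sup>2)"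
    using ac by (auto intro!: continuous_intros continuous_on_subset[OF h_cont[OF ac(3)]] on_Icc[OF \<sigma>_cont ac(3)])
  have Qd: "Q t' - Q s' = integral {s'..t'} (\<lambda>r. (\<sigma> r)\<^sup>2)" if "a \<le> s'" "s' \<le> t'" "t' \<le> c" for s' t'
    using that ac by (intro Q_diff times_upto_downward[OF ac(3)]) auto
  obtain \<delta> where \<delta>: "0 < \<delta>" "\<And>K \<rho> \<theta>. grid a c \<delta> K \<rho> \<Longrightarrow> \<forall>j<K. \<rho> j \<le> \<theta> j \<and> \<theta> j \<le> \<rho> (Suc j) \<Longrightarrow>
      \<bar>increment_sum K \<rho> (\<lambda>j. (h (\<theta> j))\<^sup>2) Q - integral {a..c} (\<lambda>r. (h r)\<^sup>2 * (\<sigma> r)\<^sup>2)\<bar> \<le> \<eta>"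
    using increment_sum_integral_limit[OF cv Qd \<open>0 < \<eta>\<close>] by blast
  obtain K \<rho> where \<rho>: "grid a c \<delta> K \<rho>"
    "holds_up_to M \<epsilon> (\<lambda>\<omega>. \<bar>increment_sum K \<rho> (\<lambda>j. h (\<rho> j) * Y (\<rho> j) \<omega>) (\<lambda>t. S t \<omega>) -
       ((R c \<omega> - \<alpha> * J c \<omega>) - (R a \<omega> - \<alpha> * J a \<omega>))\<bar> \<le> \<epsilon>)"
    using score_increment_approx[OF R S XS ac \<open>0 < \<epsilon>\<close> \<delta>(1)] by blast
  have "\<bar>increment_sum K \<rho> (\<lambda>j. (h (\<rho> j))\<^sup>2) Q - (A c - A a)\<bar> \<le> \<eta>"
    using \<delta>(2)[OF \<rho>(1), of \<rho>] \<rho>(1) A_diff[OF ac(3,1,2)] by (simp add: grid_def)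
  with S \<rho> show ?thesis by (intro that)
qed

lemma weighted_sum_second_moment:
  assumes S: "gaussian_increments M F T Q S" and \<rho>: "grid a c \<delta> K \<rho>" and ac: "0 \<le> a" "c \<in> times_upto T"
    and U: "\<And>j. j < K \<Longrightarrow> U j \<in> borel_measurable (F (\<rho> j))"
    and Usq: "\<And>j. j < K \<Longrightarrow> integrable M (\<lambda>\<omega>. (U j \<omega>)\<^sup>2)"
    and q: "\<And>j. j < K \<Longrightarrow> expectation (\<lambda>\<omega>. (U j \<omega>)\<^sup>2) \<le> q"
  shows "integrable M (\<lambda>\<omega>. (increment_sum K \<rho> (\<lambda>j. h (\<rho> j) * U j \<omega>) (\<lambda>t. S t \<omega>))\<^sup>2)"
    and "expectation (\<lambda>\<omega>. (increment_sum K \<rho> (\<lambda>j. h (\<rho> j) * U j \<omega>) (\<lambda>t. S t \<omega>))\<^sup>2) \<le>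
      q * increment_sum K \<rho> (\<lambda>j. (h (\<rho> j))\<^sup>2) Q"
proof -
  have m: "(\<lambda>\<omega>. h (\<rho> j) * U j \<omega>) \<in> borel_measurable (F (\<rho> j))" if "j < K" for j
    using U[OF that] by simp
  have i: "integrable M (\<lambda>\<omega>. (h (\<rho> j) * U j \<omega>)\<^sup>2)" if "j < K" for j
    using Usq[OF that] by (simp add: power_mult_distrib)
  show "integrable M (\<lambda>\<omega>. (increment_sum K \<rho> (\<lambda>j. h (\<rho> j) * U j \<omega>) (\<lambda>t. S t \<omega>))\<^sup>2)"
    by (rule increment_sum_isometry(1)[OF S \<rho> ac m i])
  have "expectation (\<lambda>\<omega>. (increment_sum K \<rho> (\<lambda>j. h (\<rho> j) * U j \<omega>) (\<lambda>t. S t \<omega>))\<^sup>2) =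
      (\<Sum>j<K. (h (\<rho> j))\<^sup>2 * expectation (\<lambda>\<omega>. (U j \<omega>)\<^sup>2) * (Q (\<rho> (Suc j)) - Q (\<rho> j)))"
    using increment_sum_isometry(2)[OF S \<rho> ac m i] by (simp add: increment_sum_def power_mult_distrib)
  also have "\<dots> \<le> (\<Sum>j<K. (h (\<rho> j))\<^sup>2 * q * (Q (\<rho> (Suc j)) - Q (\<rho> j)))"
  proof (rule sum_mono)
    fix j assume "j \<in> {..<K}"
    then have j: "j < K" by simp
    have "0 \<le> Q (\<rho> (Suc j)) - Q (\<rho> j)"
      using gaussian_increments_var_mono[OF S grid_times[OF \<rho> ac, of j] grid_times[OF \<rho> ac, of "Suc j"]] j \<rho>
      by (auto simp: grid_def)
    then show "(h (\<rho> j))\<^sup>2 * expectation (\<lambda>\<omega>. (U j \<omega>)\<^sup>2) * (Q (\<rho> (Suc j)) - Q (\<rho> j)) \<le>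
        (h (\<rho> j))\<^sup>2 * q * (Q (\<rho> (Suc j)) - Q (\<rho> j))"
      using q[OF j] by (intro mult_right_mono mult_left_mono) auto
  qed
  also have "\<dots> = q * increment_sum K \<rho> (\<lambda>j. (h (\<rho> j))\<^sup>2) Q"
    by (simp add: increment_sum_def sum_distrib_left mult_ac)
  finally show "expectation (\<lambda>\<omega>. (increment_sum K \<rho> (\<lambda>j. h (\<rho> j) * U j \<omega>) (\<lambda>t. S t \<omega>))\<^sup>2) \<le>
      q * increment_sum K \<rho> (\<lambda>j. (h (\<rho> j))\<^sup>2) Q" .
qed

text \<open>The bound does not depend on the version \<open>R\<close> of the score integral. This matters since the
  estimators at different times may come from different versions.\<close>

lemma score_bounded:
  assumes u: "u \<in> times_upto T" and "0 < \<delta>"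
  shows "\<exists>C>0. \<forall>R. score_integral R \<longrightarrow> holds_up_to M \<delta> (\<lambda>\<omega>. \<bar>R u \<omega> - \<alpha> * J u \<omega>\<bar> \<le> C)"
proof -
  have u0: "0 \<le> u" using u by (simp add: times_upto_def)
  define q where "q = V u * (A u + 1) + 1"
  have "0 \<le> A u" using A_mono[OF u order_refl u0] by simp
  then have q: "0 < q" using V_nonneg[OF u] by (simp add: q_def add_nonneg_pos)
  define c where "c = sqrt (3 * q / \<delta>)"
  have c: "0 < c" "c\<^sup>2 * (\<delta> / 3) = q" using q \<open>0 < \<delta>\<close> by (auto simp: c_def)
  have d3: "0 < \<delta> / 3" using \<open>0 < \<delta>\<close> by simp
  show ?thesis
  proof (intro exI[of _ "c + 2 * \<delta>"] conjI allI impI)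
    show "0 < c + 2 * \<delta>" using c \<open>0 < \<delta>\<close> by simp
    fix R assume R: "score_integral R"
    obtain S K \<rho> d where S: "gaussian_increments M F T Q S" and \<rho>: "grid 0 u d K \<rho>"
      and v: "\<bar>increment_sum K \<rho> (\<lambda>j. (h (\<rho> j))\<^sup>2) Q - (A u - A 0)\<bar> \<le> 1"
      and app: "holds_up_to M (\<delta> / 3) (\<lambda>\<omega>. \<bar>increment_sum K \<rho> (\<lambda>j. h (\<rho> j) * Y (\<rho> j) \<omega>) (\<lambda>t. S t \<omega>) -
        ((R u \<omega> - \<alpha> * J u \<omega>) - (R 0 \<omega> - \<alpha> * J 0 \<omega>))\<bar> \<le> \<delta> / 3)"
      by (rule score_riemann_sum[OF R order_refl u0 u d3 zero_less_one])
    have \<rho>t: "\<rho> j \<in> times_upto T" if "j < K" for j using grid_times[OF \<rho> order_refl u, of j] that by simp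
    have Vle: "V (\<rho> j) \<le> V u" if "j < K" for j
      using V_mono[OF u] grid_range[OF \<rho>, of j] that by simp
    have "expectation (\<lambda>\<omega>. (increment_sum K \<rho> (\<lambda>j. h (\<rho> j) * Y (\<rho> j) \<omega>) (\<lambda>t. S t \<omega>))\<^sup>2) \<le>
        V u * increment_sum K \<rho> (\<lambda>j. (h (\<rho> j))\<^sup>2) Q"
      using Y_second_moment(2)[OF \<rho>t] Vle
      by (intro weighted_sum_second_moment(2)[OF S \<rho> order_refl u Y_adapted[OF \<rho>t] Y_second_moment(1)[OF \<rho>t]]) auto
    also have "\<dots> \<le> V u * (A u + 1)" using v V_nonneg[OF u] by (intro mult_left_mono) auto
    also have "\<dots> \<le> c\<^sup>2 * (\<delta> / 3)" unfolding c(2) by (simp add: q_def)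
    finally have "holds_up_to M (\<delta> / 3)
        (\<lambda>\<omega>. \<bar>increment_sum K \<rho> (\<lambda>j. h (\<rho> j) * Y (\<rho> j) \<omega>) (\<lambda>t. S t \<omega>)\<bar> \<le> c)"
      using Y_second_moment(2)[OF \<rho>t] Vle c(1)
      by (intro holds_up_to_Chebyshev
          weighted_sum_second_moment(1)[OF S \<rho> order_refl u Y_adapted[OF \<rho>t] Y_second_moment(1)[OF \<rho>t]]) auto
    from holds_up_to_conj[OF this holds_up_to_conj[OF app score_integral_start[OF R d3]]]
    show "holds_up_to M \<delta> (\<lambda>\<omega>. \<bar>R u \<omega> - \<alpha> * J u \<omega>\<bar> \<le> c + 2 * \<delta>)"
    proof (rule holds_up_to_mono)
      show "\<delta> / 3 + (\<delta> / 3 + \<delta> / 3) \<le> \<delta>" by simp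
      fix \<omega>
      assume *: "\<bar>increment_sum K \<rho> (\<lambda>j. h (\<rho> j) * Y (\<rho> j) \<omega>) (\<lambda>t. S t \<omega>)\<bar> \<le> c \<and>
        \<bar>increment_sum K \<rho> (\<lambda>j. h (\<rho> j) * Y (\<rho> j) \<omega>) (\<lambda>t. S t \<omega>) -
          ((R u \<omega> - \<alpha> * J u \<omega>) - (R 0 \<omega> - \<alpha> * J 0 \<omega>))\<bar> \<le> \<delta> / 3 \<and> \<bar>R 0 \<omega>\<bar> \<le> \<delta> / 3"
      have "\<alpha> * J 0 \<omega> = 0" by (simp add: J_def)
      with * \<open>0 < \<delta>\<close> show "\<bar>R u \<omega> - \<alpha> * J u \<omega>\<bar> \<le> c + 2 * \<delta>" by linarith
    qed
  qed
qed

lemma Y_increment_moments: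
  assumes "u \<in> times_upto T" "t \<in> times_upto T" "u \<le> t"
  shows "integrable M (\<lambda>\<omega>. (Y t \<omega> - Y u \<omega>)\<^sup>2)" "expectation (\<lambda>\<omega>. (Y t \<omega> - Y u \<omega>)\<^sup>2) = V t - V u"
  using indep_normal_moments(3,4)[OF subalg[OF assms(1)] indep_normal_Y[OF assms]] by auto

text \<open>After a time \<open>u\<close> at which most of the variance \<open>L\<close> of \<open>Y\<close> is spent, \<open>Y\<close> may be replaced by its value
  at \<open>u\<close>. What remains of the score integral is \<open>Y u\<close> times a Gaussian variable that is independent
  of the past of \<open>u\<close>. The cost is controlled by the isometry, relative to \<open>A t - A u\<close>.\<close>

lemma score_decomposition:
  assumes R: "score_integral R" and L: "\<And>t. t \<in> times_upto T \<Longrightarrow> V t \<le> L"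
    and ut: "u \<in> times_upto T" "t \<in> times_upto T" "u \<le> t" and D: "A u < A t" and e: "0 < e"
    and late: "L - V u \<le> e ^ 3 / 54"
  shows "\<exists>G. indep_normal M (F u) 1 G \<and> holds_up_to M e
    (\<lambda>\<omega>. \<bar>(R t \<omega> - \<alpha> * J t \<omega>) - (R u \<omega> - \<alpha> * J u \<omega>) - Y u \<omega> * (sqrt (A t - A u) * G \<omega>)\<bar> \<le> e * sqrt (A t - A u))"
proof -
  define a where "a = A t - A u"
  have a: "0 < a" using D by (simp add: a_def)
  have u0: "0 \<le> u" using ut by (simp add: times_upto_def)
  have L0: "0 \<le> L" using V_nonneg[OF ut(1)] L[OF ut(1)] by simp
  \<comment> \<open>each of three errors will be at most \<open>c\<close>\<close>
  define c where "c = e / 3 * sqrt a"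
  have c: "0 < c" "c\<^sup>2 = (e / 3)\<^sup>2 * a" using a e by (auto simp: c_def power_mult_distrib power_divide)
  define \<eta> where "\<eta> = min (a / 2) (c\<^sup>2 * (e / 3) / (L + 1))"
  have \<eta>: "0 < \<eta>" using a c e L0 by (simp add: \<eta>_def)
  have \<eta>L: "\<eta> * L \<le> c\<^sup>2 * (e / 3)"
  proof -
    have "\<eta> * L \<le> \<eta> * (L + 1)" using \<eta> by simp
    also have "\<dots> \<le> c\<^sup>2 * (e / 3) / (L + 1) * (L + 1)" using L0 by (intro mult_right_mono) (auto simp: \<eta>_def)
    also have "\<dots> = c\<^sup>2 * (e / 3)"
    proof -
      have "x / (L + 1) * (L + 1) = x" for x using L0 by simp
      then show ?thesis .
    qed
    finally show ?thesis .
  qed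
  have mc: "0 < min (e / 3) c" using e c by simp
  obtain S K \<rho> \<delta>
    where S: "gaussian_increments M F T Q S" and \<rho>: "grid u t \<delta> K \<rho>"
      and v': "\<bar>increment_sum K \<rho> (\<lambda>j. (h (\<rho> j))\<^sup>2) Q - (A t - A u)\<bar> \<le> \<eta>"
      and app: "holds_up_to M (min (e / 3) c) (\<lambda>\<omega>. \<bar>increment_sum K \<rho> (\<lambda>j. h (\<rho> j) * Y (\<rho> j) \<omega>) (\<lambda>t. S t \<omega>) -
        ((R t \<omega> - \<alpha> * J t \<omega>) - (R u \<omega> - \<alpha> * J u \<omega>))\<bar> \<le> min (e / 3) c)"
    by (rule score_riemann_sum[OF R u0 ut(3,2) mc \<eta>])
  define v where "v = increment_sum K \<rho> (\<lambda>j. (h (\<rho> j))\<^sup>2) Q"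
  have v: "\<bar>v - a\<bar> \<le> \<eta>" using v' by (simp add: v_def a_def)
  have v_bd: "0 < v" "v \<le> 2 * a"
  proof -
    have "\<bar>v - a\<bar> \<le> a / 2" using v by (simp add: \<eta>_def)
    then show "0 < v" "v \<le> 2 * a" using a by linarith+
  qed
  have \<rho>t: "\<rho> j \<in> times_upto T" "u \<le> \<rho> j" if "j < K" for j
    using grid_times[OF \<rho> u0 ut(2), of j] grid_range[OF \<rho>, of j] that by auto
  define \<Gamma> where "\<Gamma> \<omega> = increment_sum K \<rho> (\<lambda>j. h (\<rho> j)) (\<lambda>t. S t \<omega>)" for \<omega>
  define G where "G \<omega> = 1 / sqrt v * \<Gamma> \<omega>" for \<omega>
  have "indep_normal M (F u) ((1 / sqrt v)\<^sup>2 * v) G"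
    unfolding G_def \<Gamma>_def v_def
    by (rule indep_normal_scale[OF gaussian_increment_sum[OF S \<rho> u0 ut(2)]])
  then have G: "indep_normal M (F u) 1 G" using v_bd by (simp add: power_divide)
  \<comment> \<open>the error of freezing \<open>Y\<close> at time \<open>u\<close>\<close>
  have "holds_up_to M (e / 3)
      (\<lambda>\<omega>. \<bar>increment_sum K \<rho> (\<lambda>j. h (\<rho> j) * (Y (\<rho> j) \<omega> - Y u \<omega>)) (\<lambda>t. S t \<omega>)\<bar> \<le> c)"
  proof (rule holds_up_to_Chebyshev[OF _ c(1)])
    have m: "(\<lambda>\<omega>. Y (\<rho> j) \<omega> - Y u \<omega>) \<in> borel_measurable (F (\<rho> j))" if "j < K" for j
      using Y_adapted[OF \<rho>t(1)[OF that]] F_mono[OF Y_adapted[OF ut(1)] ut(1) \<rho>t[OF that]] by simp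
    have i: "integrable M (\<lambda>\<omega>. (Y (\<rho> j) \<omega> - Y u \<omega>)\<^sup>2)"
      "expectation (\<lambda>\<omega>. (Y (\<rho> j) \<omega> - Y u \<omega>)\<^sup>2) \<le> L - V u" if "j < K" for j
      using Y_increment_moments[OF ut(1) \<rho>t[OF that]] L[OF \<rho>t(1)[OF that]] by auto
    show "integrable M (\<lambda>\<omega>. (increment_sum K \<rho> (\<lambda>j. h (\<rho> j) * (Y (\<rho> j) \<omega> - Y u \<omega>)) (\<lambda>t. S t \<omega>))\<^sup>2)"
      by (rule weighted_sum_second_moment(1)[OF S \<rho> u0 ut(2) m i])
    have "expectation (\<lambda>\<omega>. (increment_sum K \<rho> (\<lambda>j. h (\<rho> j) * (Y (\<rho> j) \<omega> - Y u \<omega>)) (\<lambda>t. S t \<omega>))\<^sup>2) \<le> (L - V u) * v"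
      unfolding v_def by (rule weighted_sum_second_moment(2)[OF S \<rho> u0 ut(2) m i])
    also have "\<dots> \<le> e ^ 3 / 54 * (2 * a)" using late v_bd L[OF ut(1)] e by (intro mult_mono) auto
    also have "\<dots> = c\<^sup>2 * (e / 3)" unfolding c(2) by (simp add: power3_eq_cube power2_eq_square)
    finally show "expectation (\<lambda>\<omega>. (increment_sum K \<rho> (\<lambda>j. h (\<rho> j) * (Y (\<rho> j) \<omega> - Y u \<omega>)) (\<lambda>t. S t \<omega>))\<^sup>2) \<le> c\<^sup>2 * (e / 3)" .
  qed
  \<comment> \<open>the error of replacing the variance \<open>v\<close> of the Riemann sum by its limit\<close>
  moreover have "holds_up_to M (e / 3) (\<lambda>\<omega>. \<bar>(sqrt v - sqrt a) * (Y u \<omega> * G \<omega>)\<bar> \<le> c)"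
  proof (rule holds_up_to_Chebyshev[OF _ c(1)])
    have m: "(\<lambda>\<omega>. (Y u \<omega>)\<^sup>2) \<in> borel_measurable (F u)" using Y_adapted[OF ut(1)] by simp
    note w = indep_normal_weighted_moments(3,4)[OF subalg[OF ut(1)] G m Y_second_moment(1)[OF ut(1)]]
    show "integrable M (\<lambda>\<omega>. ((sqrt v - sqrt a) * (Y u \<omega> * G \<omega>))\<^sup>2)"
      using w(1) by (simp add: power_mult_distrib)
    have "expectation (\<lambda>\<omega>. ((sqrt v - sqrt a) * (Y u \<omega> * G \<omega>))\<^sup>2) = (sqrt v - sqrt a)\<^sup>2 * V u"
      using w(2) Y_second_moment(2)[OF ut(1)] by (simp add: power_mult_distrib)
    also have "\<dots> \<le> \<eta> * L"
      using sqrt_diff_squared_le[of v a] v v_bd a L[OF ut(1)] V_nonneg[OF ut(1)] \<eta> by (intro mult_mono) auto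
    also note \<eta>L
    finally show "expectation (\<lambda>\<omega>. ((sqrt v - sqrt a) * (Y u \<omega> * G \<omega>))\<^sup>2) \<le> c\<^sup>2 * (e / 3)" .
  qed
  ultimately have "holds_up_to M (e / 3 + e / 3 + min (e / 3) c)
      (\<lambda>\<omega>. (\<bar>increment_sum K \<rho> (\<lambda>j. h (\<rho> j) * (Y (\<rho> j) \<omega> - Y u \<omega>)) (\<lambda>t. S t \<omega>)\<bar> \<le> c \<and>
        \<bar>(sqrt v - sqrt a) * (Y u \<omega> * G \<omega>)\<bar> \<le> c) \<and>
        \<bar>increment_sum K \<rho> (\<lambda>j. h (\<rho> j) * Y (\<rho> j) \<omega>) (\<lambda>t. S t \<omega>) -
        ((R t \<omega> - \<alpha> * J t \<omega>) - (R u \<omega> - \<alpha> * J u \<omega>))\<bar> \<le> min (e / 3) c)"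
    by (intro holds_up_to_conj app)
  then have "holds_up_to M e
    (\<lambda>\<omega>. \<bar>(R t \<omega> - \<alpha> * J t \<omega>) - (R u \<omega> - \<alpha> * J u \<omega>) - Y u \<omega> * (sqrt (A t - A u) * G \<omega>)\<bar> \<le> e * sqrt (A t - A u))"
  proof (rule holds_up_to_mono)
    fix \<omega>
    assume *: "(\<bar>increment_sum K \<rho> (\<lambda>j. h (\<rho> j) * (Y (\<rho> j) \<omega> - Y u \<omega>)) (\<lambda>t. S t \<omega>)\<bar> \<le> c \<and>
        \<bar>(sqrt v - sqrt a) * (Y u \<omega> * G \<omega>)\<bar> \<le> c) \<and>
        \<bar>increment_sum K \<rho> (\<lambda>j. h (\<rho> j) * Y (\<rho> j) \<omega>) (\<lambda>t. S t \<omega>) -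
        ((R t \<omega> - \<alpha> * J t \<omega>) - (R u \<omega> - \<alpha> * J u \<omega>))\<bar> \<le> min (e / 3) c"
    have "increment_sum K \<rho> (\<lambda>j. h (\<rho> j) * Y (\<rho> j) \<omega>) (\<lambda>t. S t \<omega>) =
        increment_sum K \<rho> (\<lambda>j. h (\<rho> j) * (Y (\<rho> j) \<omega> - Y u \<omega>)) (\<lambda>t. S t \<omega>) + Y u \<omega> * \<Gamma> \<omega>"
      by (simp add: increment_sum_def \<Gamma>_def sum_distrib_left sum.distrib[symmetric] algebra_simps)
    moreover have "\<Gamma> \<omega> = sqrt v * G \<omega>" using v_bd by (simp add: G_def)
    then have "Y u \<omega> * \<Gamma> \<omega> = (sqrt v - sqrt a) * (Y u \<omega> * G \<omega>) + Y u \<omega> * (sqrt a * G \<omega>)"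
      by (simp add: algebra_simps)
    ultimately have "\<bar>(R t \<omega> - \<alpha> * J t \<omega>) - (R u \<omega> - \<alpha> * J u \<omega>) - Y u \<omega> * (sqrt a * G \<omega>)\<bar> \<le> c + c + c"
      using * by linarith
    also have "c + c + c = e * sqrt a" by (simp add: c_def)
    finally show "\<bar>(R t \<omega> - \<alpha> * J t \<omega>) - (R u \<omega> - \<alpha> * J u \<omega>) - Y u \<omega> * (sqrt (A t - A u) * G \<omega>)\<bar> \<le> e * sqrt (A t - A u)"
      by (simp add: a_def)
  qed simp
  with G show ?thesis by blast
qed

text \<open>The corresponding statement for \<open>J\<close>. The error has a small first moment because \<open>Y\<close> has small
  increments after \<open>u\<close> in second moment.\<close>

lemma information_decomposition:
  assumes L: "\<And>t. t \<in> times_upto T \<Longrightarrow> V t \<le> L"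
    and ut: "u \<in> times_upto T" "t \<in> times_upto T" "u \<le> t" and D: "A u < A t" and e: "0 < e"
    and late: "(1 + 8 * (L + 1) / e\<^sup>2) * (L - V u) \<le> e\<^sup>2 / 8"
  shows "holds_up_to M e (\<lambda>\<omega>. \<bar>J t \<omega> - J u \<omega> - (Y u \<omega>)\<^sup>2 * (A t - A u)\<bar> \<le> e * (A t - A u))"
proof -
  define a where "a = A t - A u"
  have a: "0 < a" using D by (simp add: a_def)
  have u0: "0 \<le> u" using ut by (simp add: times_upto_def)
  have L0: "0 \<le> L" using V_nonneg[OF ut(1)] L[OF ut(1)] by simp
  \<comment> \<open>the weight in \<open>\<bar>p\<^sup>2 - q\<^sup>2\<bar> \<le> (1 + 1 / \<kappa>) (p - q)\<^sup>2 + \<kappa> q\<^sup>2\<close>\<close>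
  define \<kappa> where "\<kappa> = e\<^sup>2 / (8 * (L + 1))"
  have \<kappa>: "0 < \<kappa>" "1 / \<kappa> = 8 * (L + 1) / e\<^sup>2" using e L0 by (auto simp: \<kappa>_def)
  have \<kappa>L: "\<kappa> * L \<le> e\<^sup>2 / 8" using e L0 by (simp add: \<kappa>_def field_simps)
  obtain K \<rho> where grid: "\<And>n. grid u t (1 / real (Suc n)) (K n) (\<rho> n)" using grid_sequence[OF ut(3)] by blast
  have m: "(\<lambda>\<omega>. increment_sum (K n) (\<rho> n) (\<lambda>j. (Y (\<rho> n j) \<omega>)\<^sup>2) A) \<in> borel_measurable M" for n
    by (rule path_riemann_sums_measurable[OF Y_sq_measurable ut(2) u0 grid])
  have "0 < e / 2 * a" "0 < e / 2" using a e by auto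
  from eventually_happens'[OF sequentially_bot AE_tendsto_holds_up_to[OF m J_riemann_sums[OF ut(2) u0 ut(3) grid] this]]
  obtain n where n: "holds_up_to M (e / 2)
      (\<lambda>\<omega>. \<bar>increment_sum (K n) (\<rho> n) (\<lambda>j. (Y (\<rho> n j) \<omega>)\<^sup>2) A - (J t \<omega> - J u \<omega>)\<bar> \<le> e / 2 * a)" by blast
  note g = grid[of n]
  have \<rho>t: "\<rho> n j \<in> times_upto T" "u \<le> \<rho> n j" if "j < K n" for j
    using grid_times[OF g u0 ut(2), of j] grid_range[OF g, of j] that by auto
  have dA: "0 \<le> A (\<rho> n (Suc j)) - A (\<rho> n j)" if "j < K n" for j
  proof -
    have "\<rho> n (Suc j) \<in> times_upto T" using grid_times[OF g u0 ut(2), of "Suc j"] that by simp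
    moreover have "0 \<le> \<rho> n j" "\<rho> n j \<le> \<rho> n (Suc j)" using \<rho>t[OF that] g that u0 by (auto simp: grid_def)
    ultimately show ?thesis using A_mono by simp
  qed
  \<comment> \<open>a nonnegative bound for the error, to which Markov's inequality applies\<close>
  define f where "f \<omega> = increment_sum (K n) (\<rho> n) (\<lambda>j. (1 + 1 / \<kappa>) * (Y (\<rho> n j) \<omega> - Y u \<omega>)\<^sup>2 + \<kappa> * (Y u \<omega>)\<^sup>2) A" for \<omega>
  have quad: "\<bar>p\<^sup>2 - q\<^sup>2\<bar> \<le> (1 + 1 / \<kappa>) * (p - q)\<^sup>2 + \<kappa> * q\<^sup>2" for p q :: real
  proof -
    let ?d = "p - q"
    have "0 \<le> (\<bar>?d\<bar> - \<kappa> * \<bar>q\<bar>)\<^sup>2 / \<kappa>" using \<kappa> by simp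
    also have "\<dots> = 1 / \<kappa> * ?d\<^sup>2 - 2 * (\<bar>?d\<bar> * \<bar>q\<bar>) + \<kappa> * q\<^sup>2"
      using \<kappa>(1) by (simp add: power2_eq_square field_simps)
    finally have "2 * (\<bar>?d\<bar> * \<bar>q\<bar>) \<le> 1 / \<kappa> * ?d\<^sup>2 + \<kappa> * q\<^sup>2" by simp
    moreover have "p\<^sup>2 - q\<^sup>2 = ?d\<^sup>2 + 2 * (?d * q)" by (simp add: power2_eq_square algebra_simps)
    then have "\<bar>p\<^sup>2 - q\<^sup>2\<bar> \<le> ?d\<^sup>2 + 2 * (\<bar>?d\<bar> * \<bar>q\<bar>)"
      using abs_triangle_ineq[of "?d\<^sup>2" "2 * (?d * q)"] by (simp add: abs_mult)
    ultimately show ?thesis by (simp add: distrib_right)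
  qed
  have term_nonneg: "0 \<le> (1 + 1 / \<kappa>) * (Y (\<rho> n j) \<omega> - Y u \<omega>)\<^sup>2 + \<kappa> * (Y u \<omega>)\<^sup>2" for j \<omega>
    using \<kappa>(1) by (intro add_nonneg_nonneg mult_nonneg_nonneg) auto
  have int: "integrable M (\<lambda>\<omega>. (1 + 1 / \<kappa>) * (Y (\<rho> n j) \<omega> - Y u \<omega>)\<^sup>2 + \<kappa> * (Y u \<omega>)\<^sup>2)"
    and ex: "expectation (\<lambda>\<omega>. (1 + 1 / \<kappa>) * (Y (\<rho> n j) \<omega> - Y u \<omega>)\<^sup>2 + \<kappa> * (Y u \<omega>)\<^sup>2) \<le> e\<^sup>2 / 4"
    if "j < K n" for j
  proof -
    note mo = Y_increment_moments[OF ut(1) \<rho>t[OF that]] and mo' = Y_second_moment[OF ut(1)]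
    show "integrable M (\<lambda>\<omega>. (1 + 1 / \<kappa>) * (Y (\<rho> n j) \<omega> - Y u \<omega>)\<^sup>2 + \<kappa> * (Y u \<omega>)\<^sup>2)"
      using mo(1) mo'(1) by (intro Bochner_Integration.integrable_add integrable_mult_right)
    have "expectation (\<lambda>\<omega>. (1 + 1 / \<kappa>) * (Y (\<rho> n j) \<omega> - Y u \<omega>)\<^sup>2 + \<kappa> * (Y u \<omega>)\<^sup>2) =
        (1 + 1 / \<kappa>) * (V (\<rho> n j) - V u) + \<kappa> * V u"
      using mo mo' by (subst Bochner_Integration.integral_add) auto
    also have "\<dots> \<le> (1 + 1 / \<kappa>) * (L - V u) + \<kappa> * L"
      using L[OF \<rho>t(1)[OF that]] L[OF ut(1)] \<kappa>(1) by (intro add_mono mult_left_mono) auto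
    also have "\<dots> \<le> e\<^sup>2 / 8 + e\<^sup>2 / 8" using late \<kappa>L unfolding \<kappa>(2) by (intro add_mono) auto
    finally show "expectation (\<lambda>\<omega>. (1 + 1 / \<kappa>) * (Y (\<rho> n j) \<omega> - Y u \<omega>)\<^sup>2 + \<kappa> * (Y u \<omega>)\<^sup>2) \<le> e\<^sup>2 / 4" by simp
  qed
  have f_int: "integrable M f"
    unfolding f_def increment_sum_def
    by (intro Bochner_Integration.integrable_sum integrable_mult_left int) auto
  have f_nonneg: "0 \<le> f \<omega>" for \<omega>
    unfolding f_def increment_sum_def using term_nonneg dA
    by (intro sum_nonneg mult_nonneg_nonneg) auto
  have "expectation f = (\<Sum>j<K n. expectation (\<lambda>\<omega>. (1 + 1 / \<kappa>) * (Y (\<rho> n j) \<omega> - Y u \<omega>)\<^sup>2 + \<kappa> * (Y u \<omega>)\<^sup>2) *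
      (A (\<rho> n (Suc j)) - A (\<rho> n j)))"
    unfolding f_def increment_sum_def
    using int by (subst Bochner_Integration.integral_sum) auto
  also have "\<dots> \<le> (\<Sum>j<K n. e\<^sup>2 / 4 * (A (\<rho> n (Suc j)) - A (\<rho> n j)))"
    using ex dA by (intro sum_mono mult_right_mono) auto
  also have "\<dots> = e\<^sup>2 / 4 * a"
    using increment_sum_const[OF g, of "e\<^sup>2 / 4" A] by (simp add: increment_sum_def a_def)
  also have "\<dots> = e / 2 * a * (e / 2)" by (simp add: power2_eq_square)
  finally have "holds_up_to M (e / 2) (\<lambda>\<omega>. f \<omega> < e / 2 * a)"
    using a e by (intro holds_up_to_Markov[OF f_int f_nonneg]) auto
  from holds_up_to_conj[OF this n] show ?thesis
  proof (rule holds_up_to_mono)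
    fix \<omega>
    assume *: "f \<omega> < e / 2 * a \<and>
        \<bar>increment_sum (K n) (\<rho> n) (\<lambda>j. (Y (\<rho> n j) \<omega>)\<^sup>2) A - (J t \<omega> - J u \<omega>)\<bar> \<le> e / 2 * a"
    have "increment_sum (K n) (\<rho> n) (\<lambda>j. (Y (\<rho> n j) \<omega>)\<^sup>2) A - (Y u \<omega>)\<^sup>2 * a =
        increment_sum (K n) (\<rho> n) (\<lambda>j. (Y (\<rho> n j) \<omega>)\<^sup>2 - (Y u \<omega>)\<^sup>2) A"
      using increment_sum_const[OF g, of "(Y u \<omega>)\<^sup>2" A]
        increment_sum_diff[of "K n" "\<rho> n" "\<lambda>j. (Y (\<rho> n j) \<omega>)\<^sup>2" A "\<lambda>_. (Y u \<omega>)\<^sup>2"] by (simp add: a_def)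
    moreover have "\<bar>increment_sum (K n) (\<rho> n) (\<lambda>j. (Y (\<rho> n j) \<omega>)\<^sup>2 - (Y u \<omega>)\<^sup>2) A\<bar> \<le> f \<omega>"
      unfolding f_def increment_sum_def
    proof (rule order_trans[OF sum_abs sum_mono])
      fix j assume "j \<in> {..<K n}"
      then show "\<bar>((Y (\<rho> n j) \<omega>)\<^sup>2 - (Y u \<omega>)\<^sup>2) * (A (\<rho> n (Suc j)) - A (\<rho> n j))\<bar> \<le>
          ((1 + 1 / \<kappa>) * (Y (\<rho> n j) \<omega> - Y u \<omega>)\<^sup>2 + \<kappa> * (Y u \<omega>)\<^sup>2) * (A (\<rho> n (Suc j)) - A (\<rho> n j))"
        using dA[of j] quad[of "Y (\<rho> n j) \<omega>" "Y u \<omega>"] by (simp add: abs_mult mult_right_mono)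
    qed
    ultimately have "\<bar>J t \<omega> - J u \<omega> - (Y u \<omega>)\<^sup>2 * a\<bar> \<le> e / 2 * a + e / 2 * a" using * by linarith
    then show "\<bar>J t \<omega> - J u \<omega> - (Y u \<omega>)\<^sup>2 * (A t - A u)\<bar> \<le> e * (A t - A u)" by (simp add: a_def)
  qed simp
qed


section \<open>Joint limit of numerator and denominator\<close>

text \<open>The Fisher information is the integral of the increasing function \<open>V \<le> L\<close> against \<open>dA\<close>.\<close>

lemma fisher_information_bounds:
  assumes L: "\<And>t. t \<in> times_upto T \<Longrightarrow> V t \<le> L" and ut: "0 \<le> u" "u \<le> t" "t \<in> times_upto T"
  shows "V u * (A t - A u) \<le> fisher_information M b \<sigma> X t" "fisher_information M b \<sigma> X t \<le> L * A t"
proof -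
  let ?w = "\<lambda>s. (h s)\<^sup>2 * (\<sigma> s)\<^sup>2"
  have c: "continuous_on {0..t} ?w" "continuous_on {0..t} (\<lambda>s. V s * ?w s)"
    using A_cont[OF ut(3)] unfolding V_def
    by (auto intro!: continuous_intros A_cont[OF ut(3)] indefinite_integral_continuous_1
        integrable_continuous_interval V_cont[OF ut(3)])
  have c': "?w integrable_on {r..t}" "(\<lambda>s. V s * ?w s) integrable_on {r..t}" if "0 \<le> r" for r
    using that by (auto intro!: integrable_continuous_interval continuous_on_subset[OF c(1)] continuous_on_subset[OF c(2)])
  have "(\<lambda>s. V s * ?w s) integrable_on {0..u}"
    using ut by (intro integrable_continuous_interval continuous_on_subset[OF c(2)]) auto
  moreover have "0 \<le> V s" if "s \<in> {0..u}" for s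
    using that ut by (intro V_nonneg times_upto_downward[OF ut(3)]) auto
  ultimately have "0 \<le> integral {0..u} (\<lambda>s. V s * ?w s)" by (intro integral_nonneg) auto
  moreover have "V u * (A t - A u) \<le> integral {u..t} (\<lambda>s. V s * ?w s)"
  proof -
    have "V u * (A t - A u) = integral {u..t} (\<lambda>s. V u * ?w s)" using A_diff[OF ut(3,1,2)] by simp
    also have "\<dots> \<le> integral {u..t} (\<lambda>s. V s * ?w s)"
    proof (rule integral_le)
      show "(\<lambda>s. V u * ?w s) integrable_on {u..t}" using c'(1)[OF ut(1)] by (rule integrable_on_mult_right)
      show "(\<lambda>s. V s * ?w s) integrable_on {u..t}" by (rule c'(2)[OF ut(1)])
      show "V u * ?w s \<le> V s * ?w s" if "s \<in> {u..t}" for s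
        using that ut by (intro mult_right_mono V_mono times_upto_downward[OF ut(3)]) auto
    qed
    finally show ?thesis .
  qed
  moreover have "integral {0..t} (\<lambda>s. V s * ?w s) - integral {0..u} (\<lambda>s. V s * ?w s) = integral {u..t} (\<lambda>s. V s * ?w s)"
    by (rule integral_of_continuous_diff[OF c(2) ut(1,2)])
  ultimately show "V u * (A t - A u) \<le> fisher_information M b \<sigma> X t"
    unfolding fisher_information_eq[OF ut(3)] by linarith
  have "integral {0..t} (\<lambda>s. V s * ?w s) \<le> integral {0..t} (\<lambda>s. L * ?w s)"
  proof (rule integral_le)
    show "(\<lambda>s. L * ?w s) integrable_on {0..t}" using c'(1)[OF order_refl] by (rule integrable_on_mult_right)
    show "(\<lambda>s. V s * ?w s) integrable_on {0..t}" by (rule c'(2)[OF order_refl])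
    show "V s * ?w s \<le> L * ?w s" if "s \<in> {0..t}" for s
      using that ut by (intro mult_right_mono L times_upto_downward[OF ut(3)]) auto
  qed
  then show "fisher_information M b \<sigma> X t \<le> L * A t"
    unfolding fisher_information_eq[OF ut(3)] by (simp add: A_def)
qed

lemma fisher_information_ratio:
  assumes L: "\<And>t. t \<in> times_upto T \<Longrightarrow> V t \<le> L" and Vlim: "(V \<longlongrightarrow> L) (up_to T)"
    and Alim: "filterlim A at_top (up_to T)"
  shows "((\<lambda>t. fisher_information M b \<sigma> X t / A t) \<longlongrightarrow> L) (up_to T)"
proof (rule tendstoI)
  fix e :: real assume e: "0 < e"
  have "\<forall>\<^sub>F u in up_to T. L - e / 2 < V u" using e by (intro order_tendstoD(1)[OF Vlim]) simp
  with up_to_eventually_ge[OF zero_times] have "\<forall>\<^sub>F u in up_to T. (u \<in> times_upto T \<and> 0 \<le> u) \<and> L - e / 2 < V u"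
    by eventually_elim simp
  from eventually_happens'[OF up_to_nontrivial[OF T_pos] this]
  obtain u where u: "u \<in> times_upto T" "0 \<le> u" "L - e / 2 < V u" by blast
  have V: "0 \<le> V u" "V u \<le> L" using V_nonneg[OF u(1)] L[OF u(1)] by auto
  have A0: "0 \<le> A u" using A_mono[OF u(1) order_refl u(2)] by simp
  have "\<forall>\<^sub>F t in up_to T. 2 * (L * A u) / e + 1 \<le> A t" using Alim by (simp add: filterlim_at_top)
  with up_to_eventually_ge[OF u(1)] show "\<forall>\<^sub>F t in up_to T. dist (fisher_information M b \<sigma> X t / A t) L < e"
  proof eventually_elim
    case (elim t)
    have "0 \<le> 2 * (L * A u) / e" using A0 V e by simp
    then have At: "0 < A t" using elim(2) by linarith
    have "2 * (L * A u) / e < A t" using elim(2) by linarith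
    then have small: "L * A u < e / 2 * A t" using e by (simp add: field_simps)
    have "V u * A u \<le> L * A u" using V A0 by (intro mult_right_mono)
    then have "V u * A t - L * A u \<le> fisher_information M b \<sigma> X t"
      using fisher_information_bounds(1)[OF L u(2), of t] elim(1) by (simp add: right_diff_distrib)
    moreover have "(L - e / 2) * A t \<le> V u * A t" using u(3) At by (intro mult_right_mono) auto
    ultimately have "(L - e) * A t < fisher_information M b \<sigma> X t"
      using small by (simp add: left_diff_distrib)
    then have "L - e < fisher_information M b \<sigma> X t / A t" using At by (simp add: pos_less_divide_eq)
    moreover have "fisher_information M b \<sigma> X t / A t \<le> L"
      using fisher_information_bounds(2)[OF L u(2), of t] elim(1) At by (simp add: pos_divide_le_eq)
    ultimately show ?case using e by (simp add: dist_real_def)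
  qed
qed

text \<open>Frozen at a late time \<open>u\<close>, the discounted solution is \<open>sqrt L\<close> times a standard normal variable
  \<open>Y'\<close>, nearly, and the score after \<open>u\<close> contributes an independent standard normal variable \<open>G\<close>. The
  contributions up to the time \<open>u\<close> disappear in the limit, because \<open>A\<close> diverges.\<close>

lemma joint_approx:
  assumes bound: "\<forall>t\<in>times_upto T. V t \<le> L" and "0 < L" and Vlim: "(V \<longlongrightarrow> L) (up_to T)"
    and Alim: "filterlim A at_top (up_to T)" and \<kappa>: "0 < \<kappa>"
  shows "\<forall>\<^sub>F t in up_to T. \<forall>R. score_integral R \<longrightarrow> (\<exists>Y' G.
    indep_var borel Y' borel G \<and> distr M borel Y' = std_normal_distribution \<and> distr M borel G = std_normal_distribution \<and>
    integrable M (\<lambda>\<omega>. (Y' \<omega> * G \<omega>)\<^sup>2) \<and> expectation (\<lambda>\<omega>. (Y' \<omega> * G \<omega>)\<^sup>2) = 1 \<and>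
    holds_up_to M \<kappa> (\<lambda>\<omega>. \<bar>(R t \<omega> - \<alpha> * J t \<omega>) / sqrt (A t) - sqrt L * (Y' \<omega> * G \<omega>)\<bar> \<le> \<kappa> \<and>
      \<bar>J t \<omega> / A t - L * (Y' \<omega>)\<^sup>2\<bar> \<le> \<kappa>))"
proof -
  have L: "V t \<le> L" if "t \<in> times_upto T" for t using bound that by blast
  \<comment> \<open>six exceptional events will be joined\<close>
  define e where "e = \<kappa> / 6"
  have e: "0 < e" using \<kappa> by (simp add: e_def)
  define z where "z = 1 + 8 * (L + 1) / e\<^sup>2"
  have z: "0 < z" unfolding z_def using \<open>0 < L\<close> e by (intro add_pos_pos divide_pos_pos) auto
  \<comment> \<open>the first two bounds make \<open>u\<close> late enough for the two decompositions; the others are for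
    Chebyshev's and Markov's inequality when \<open>V u\<close> is replaced by \<open>L\<close>\<close>
  define d where "d = min (min (e ^ 3 / 54) (e\<^sup>2 / 8 / z)) (min (e ^ 3 / 2) (e\<^sup>2 / 2))"
  have d: "0 < d" "d \<le> e ^ 3 / 54" "d \<le> e\<^sup>2 / 8 / z" "2 * d \<le> e ^ 3" "2 * d \<le> e\<^sup>2"
  proof -
    show "0 < d" unfolding d_def using e z by simp
    show "d \<le> e ^ 3 / 54" "d \<le> e\<^sup>2 / 8 / z" unfolding d_def by linarith+
    have "d \<le> e ^ 3 / 2" "d \<le> e\<^sup>2 / 2" unfolding d_def by linarith+
    then show "2 * d \<le> e ^ 3" "2 * d \<le> e\<^sup>2" by simp_all
  qed
  have "\<forall>\<^sub>F u in up_to T. L - d < V u" using d by (intro order_tendstoD(1)[OF Vlim]) simp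
  moreover have "\<forall>\<^sub>F u in up_to T. 0 < V u" by (rule order_tendstoD(1)[OF Vlim \<open>0 < L\<close>])
  ultimately have "\<forall>\<^sub>F u in up_to T. (u \<in> times_upto T \<and> 0 \<le> u) \<and> L - d < V u \<and> 0 < V u"
    using up_to_eventually_ge[OF zero_times] by eventually_elim simp
  from eventually_happens'[OF up_to_nontrivial[OF T_pos] this]
  obtain u where u: "u \<in> times_upto T" "0 \<le> u" "L - d < V u" "0 < V u" by blast
  have late: "L - V u \<le> e ^ 3 / 54" "(1 + 8 * (L + 1) / e\<^sup>2) * (L - V u) \<le> e\<^sup>2 / 8"
  proof -
    show "L - V u \<le> e ^ 3 / 54" using u d by linarith
    have "L - V u \<le> e\<^sup>2 / 8 / z" using u d by linarith
    then show "(1 + 8 * (L + 1) / e\<^sup>2) * (L - V u) \<le> e\<^sup>2 / 8"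
      unfolding z_def[symmetric] using z by (simp add: pos_le_divide_eq mult_ac)
  qed
  have A0: "0 \<le> A u" using A_mono[OF u(1) order_refl u(2)] by simp
  obtain C where C: "0 < C" "\<And>R. score_integral R \<Longrightarrow> holds_up_to M e (\<lambda>\<omega>. \<bar>R u \<omega> - \<alpha> * J u \<omega>\<bar> \<le> C)"
    using score_bounded[OF u(1) e] by blast
  obtain C' where C': "0 < C'" "holds_up_to M e (\<lambda>\<omega>. \<bar>J u \<omega>\<bar> \<le> C')"
    using holds_up_to_bounded[OF J_measurable[OF u(1)] e] by blast
  define Y' where "Y' \<omega> = 1 / sqrt (V u) * Y u \<omega>" for \<omega>
  have Y'F: "Y' \<in> borel_measurable (F u)" unfolding Y'_def[abs_def] using Y_adapted[OF u(1)] by simp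
  have "indep_normal M (F 0) ((1 / sqrt (V u))\<^sup>2 * V u) Y'"
    unfolding Y'_def by (rule indep_normal_scale[OF normal_Y[OF u(1)]])
  then have Y'n: "indep_normal M (F 0) 1 Y'" using u(4) by (simp add: power_divide)
  have Yu: "Y u \<omega> = sqrt (V u) * Y' \<omega>" for \<omega> using u(4) by (simp add: Y'_def)
  note Y'm = indep_normal_moments[OF subalg[OF zero_times] Y'n]
  have std: "distr std_normal_distribution borel (\<lambda>x. sqrt 1 * x) = std_normal_distribution"
    by (simp add: distr_id2)
  \<comment> \<open>beyond this value of \<open>A t\<close> everything up to the time \<open>u\<close> is negligible\<close>
  define a0 where "a0 = A u + 1 + (C / e)\<^sup>2 + C' / e + L * A u / d"
  have "\<forall>\<^sub>F t in up_to T. a0 \<le> A t" using Alim by (simp add: filterlim_at_top)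
  with up_to_eventually_ge[OF u(1)] show ?thesis
  proof eventually_elim
    case (elim t)
    define a where "a = A t"
    have nn: "0 \<le> (C / e)\<^sup>2" "0 \<le> C' / e" "0 \<le> L * A u / d"
      using C(1) C'(1) e d(1) A0 \<open>0 < L\<close> by auto
    have a: "0 < a" "A u < a" "(C / e)\<^sup>2 \<le> a" "C' / e \<le> a" "L * A u / d \<le> a"
      using elim(2) nn A0 unfolding a_def a0_def by linarith+
    define r where "r = (a - A u) / a"
    have r: "0 < r" "r \<le> 1" using a A0 by (auto simp: r_def)
    have Vr: "\<bar>V u * r - L\<bar> \<le> 2 * d"
    proof -
      have "V u * (1 - r) \<le> L * (1 - r)" using L[OF u(1)] r by (intro mult_right_mono) auto
      also have "\<dots> = L * A u / a" using a(1) by (simp add: r_def field_simps)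
      also have "\<dots> \<le> d" using a(1,5) d(1) by (simp add: field_simps)
      finally have "V u - d \<le> V u * r" by (simp add: right_diff_distrib)
      moreover have "V u * r \<le> V u * 1" using r u(4) by (intro mult_left_mono) auto
      ultimately show ?thesis using u(3) L[OF u(1)] d(1) by linarith
    qed
    show ?case
    proof (intro allI impI)
      fix R assume R: "score_integral R"
      have ut: "u \<in> times_upto T" "t \<in> times_upto T" "u \<le> t" using u elim by auto
      have D: "A u < A t" using a by (simp add: a_def)
      obtain G where G: "indep_normal M (F u) 1 G" and sd: "holds_up_to M e
        (\<lambda>\<omega>. \<bar>(R t \<omega> - \<alpha> * J t \<omega>) - (R u \<omega> - \<alpha> * J u \<omega>) - Y u \<omega> * (sqrt (A t - A u) * G \<omega>)\<bar> \<le> e * sqrt (A t - A u))"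
        using score_decomposition[OF R L ut D e late(1)] by blast
      note jd = information_decomposition[OF L ut D e late(2)]
      have Y'sq: "(\<lambda>\<omega>. (Y' \<omega>)\<^sup>2) \<in> borel_measurable (F u)" using Y'F by simp
      note w = indep_normal_weighted_moments(3,4)[OF subalg[OF u(1)] G Y'sq Y'm(3)]
      have YG: "integrable M (\<lambda>\<omega>. (Y' \<omega> * G \<omega>)\<^sup>2)" "expectation (\<lambda>\<omega>. (Y' \<omega> * G \<omega>)\<^sup>2) = 1"
        using w Y'm(4) by (auto simp: power_mult_distrib)
      have n1: "holds_up_to M e (\<lambda>\<omega>. \<bar>(sqrt (V u * r) - sqrt L) * (Y' \<omega> * G \<omega>)\<bar> \<le> e)"
      proof (rule holds_up_to_Chebyshev[OF _ e])
        show "integrable M (\<lambda>\<omega>. ((sqrt (V u * r) - sqrt L) * (Y' \<omega> * G \<omega>))\<^sup>2)"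
          using YG(1) by (simp add: power_mult_distrib)
        have "expectation (\<lambda>\<omega>. ((sqrt (V u * r) - sqrt L) * (Y' \<omega> * G \<omega>))\<^sup>2) = (sqrt (V u * r) - sqrt L)\<^sup>2"
          using YG(2) by (simp add: power_mult_distrib)
        also have "\<dots> \<le> \<bar>V u * r - L\<bar>" using u(4) r \<open>0 < L\<close> by (intro sqrt_diff_squared_le) auto
        also have "\<dots> \<le> e ^ 3" using Vr d by linarith
        finally show "expectation (\<lambda>\<omega>. ((sqrt (V u * r) - sqrt L) * (Y' \<omega> * G \<omega>))\<^sup>2) \<le> e\<^sup>2 * e"
          by (simp add: power3_eq_cube power2_eq_square)
      qed
      have n2: "holds_up_to M e (\<lambda>\<omega>. \<bar>V u * r - L\<bar> * (Y' \<omega>)\<^sup>2 < e)"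
        using Y'm(3,4) e Vr d by (intro holds_up_to_Markov) (auto simp: power2_eq_square)
      have "holds_up_to M (e + (e + (e + (e + (e + e))))) (\<lambda>\<omega>.
        \<bar>(R t \<omega> - \<alpha> * J t \<omega>) - (R u \<omega> - \<alpha> * J u \<omega>) - Y u \<omega> * (sqrt (A t - A u) * G \<omega>)\<bar> \<le> e * sqrt (A t - A u) \<and>
        \<bar>J t \<omega> - J u \<omega> - (Y u \<omega>)\<^sup>2 * (A t - A u)\<bar> \<le> e * (A t - A u) \<and>
        \<bar>R u \<omega> - \<alpha> * J u \<omega>\<bar> \<le> C \<and> \<bar>J u \<omega>\<bar> \<le> C' \<and>
        \<bar>(sqrt (V u * r) - sqrt L) * (Y' \<omega> * G \<omega>)\<bar> \<le> e \<and> \<bar>V u * r - L\<bar> * (Y' \<omega>)\<^sup>2 < e)"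
        by (intro holds_up_to_conj sd jd C(2)[OF R] C'(2) n1 n2)
      then have main: "holds_up_to M \<kappa> (\<lambda>\<omega>. \<bar>(R t \<omega> - \<alpha> * J t \<omega>) / sqrt (A t) - sqrt L * (Y' \<omega> * G \<omega>)\<bar> \<le> \<kappa> \<and>
          \<bar>J t \<omega> / A t - L * (Y' \<omega>)\<^sup>2\<bar> \<le> \<kappa>)"
      proof (rule holds_up_to_mono)
        show "e + (e + (e + (e + (e + e)))) \<le> \<kappa>" by (simp add: e_def)
        fix \<omega>
        assume *: "\<bar>(R t \<omega> - \<alpha> * J t \<omega>) - (R u \<omega> - \<alpha> * J u \<omega>) - Y u \<omega> * (sqrt (A t - A u) * G \<omega>)\<bar> \<le> e * sqrt (A t - A u) \<and>
          \<bar>J t \<omega> - J u \<omega> - (Y u \<omega>)\<^sup>2 * (A t - A u)\<bar> \<le> e * (A t - A u) \<and>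
          \<bar>R u \<omega> - \<alpha> * J u \<omega>\<bar> \<le> C \<and> \<bar>J u \<omega>\<bar> \<le> C' \<and>
          \<bar>(sqrt (V u * r) - sqrt L) * (Y' \<omega> * G \<omega>)\<bar> \<le> e \<and> \<bar>V u * r - L\<bar> * (Y' \<omega>)\<^sup>2 < e"
        let ?s = "sqrt a" and ?n = "R t \<omega> - \<alpha> * J t \<omega>" and ?m = "R u \<omega> - \<alpha> * J u \<omega>"
        have s: "0 < ?s" using a by simp
        have split_n: "?n / ?s - sqrt L * (Y' \<omega> * G \<omega>) =
            (?n - ?m - Y u \<omega> * (sqrt (A t - A u) * G \<omega>)) / ?s + ?m / ?s +
            (sqrt (V u * r) - sqrt L) * (Y' \<omega> * G \<omega>)"
        proof -
          have "sqrt (V u * r) * (Y' \<omega> * G \<omega>) = Y u \<omega> * (sqrt (A t - A u) * G \<omega>) / ?s"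
            by (simp add: Yu r_def real_sqrt_mult real_sqrt_divide a_def)
          then show ?thesis by (simp add: diff_divide_distrib left_diff_distrib)
        qed
        have 1: "\<bar>(?n - ?m - Y u \<omega> * (sqrt (A t - A u) * G \<omega>)) / ?s\<bar> \<le> e"
        proof -
          have "\<bar>?n - ?m - Y u \<omega> * (sqrt (A t - A u) * G \<omega>)\<bar> \<le> e * sqrt (A t - A u)" using * by blast
          also have "\<dots> \<le> e * ?s" using e A0 by (intro mult_left_mono) (auto simp: a_def)
          finally show ?thesis using s by (simp add: pos_divide_le_eq)
        qed
        have 2: "\<bar>?m / ?s\<bar> \<le> e"
        proof -
          have "C / e \<le> ?s" using a(3) C(1) e by (intro real_le_rsqrt)
          then have "C \<le> e * ?s" using e by (simp add: pos_divide_le_eq mult.commute)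
          then have "\<bar>?m\<bar> \<le> e * ?s" using * by linarith
          then show ?thesis using s by (simp add: pos_divide_le_eq)
        qed
        have split_j: "J t \<omega> / a - L * (Y' \<omega>)\<^sup>2 =
            (J t \<omega> - J u \<omega> - (Y u \<omega>)\<^sup>2 * (A t - A u)) / a + J u \<omega> / a + (V u * r - L) * (Y' \<omega>)\<^sup>2"
        proof -
          have "V u * r * (Y' \<omega>)\<^sup>2 = (Y u \<omega>)\<^sup>2 * (A t - A u) / a"
            using u(4) by (simp add: Yu r_def power_mult_distrib a_def)
          then show ?thesis by (simp add: diff_divide_distrib left_diff_distrib)
        qed
        have 3: "\<bar>(J t \<omega> - J u \<omega> - (Y u \<omega>)\<^sup>2 * (A t - A u)) / a\<bar> \<le> e"
        proof -
          have "\<bar>J t \<omega> - J u \<omega> - (Y u \<omega>)\<^sup>2 * (A t - A u)\<bar> \<le> e * (A t - A u)" using * by blast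
          also have "\<dots> \<le> e * a" using e A0 by (intro mult_left_mono) (auto simp: a_def)
          finally show ?thesis using a(1) by (simp add: pos_divide_le_eq)
        qed
        have 4: "\<bar>J u \<omega> / a\<bar> \<le> e"
        proof -
          have "C' \<le> e * a" using a(4) e by (simp add: pos_divide_le_eq mult.commute)
          then have "\<bar>J u \<omega>\<bar> \<le> e * a" using * by linarith
          then show ?thesis using a(1) by (simp add: pos_divide_le_eq)
        qed
        have 5: "\<bar>(sqrt (V u * r) - sqrt L) * (Y' \<omega> * G \<omega>)\<bar> \<le> e" using * by blast
        have 6: "\<bar>(V u * r - L) * (Y' \<omega>)\<^sup>2\<bar> \<le> e" using * by (simp add: abs_mult)
        have "\<bar>?n / ?s - sqrt L * (Y' \<omega> * G \<omega>)\<bar> \<le> e + e + e" unfolding split_n using 1 2 5 by linarith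
        moreover have "\<bar>J t \<omega> / a - L * (Y' \<omega>)\<^sup>2\<bar> \<le> e + e + e" unfolding split_j using 3 4 6 by linarith
        moreover have "e + e + e \<le> \<kappa>" using \<kappa> by (simp add: e_def)
        ultimately show "\<bar>?n / sqrt (A t) - sqrt L * (Y' \<omega> * G \<omega>)\<bar> \<le> \<kappa> \<and> \<bar>J t \<omega> / A t - L * (Y' \<omega>)\<^sup>2\<bar> \<le> \<kappa>"
          unfolding a_def by linarith
      qed
      show "\<exists>Y' G. indep_var borel Y' borel G \<and>
          distr M borel Y' = std_normal_distribution \<and> distr M borel G = std_normal_distribution \<and>
          integrable M (\<lambda>\<omega>. (Y' \<omega> * G \<omega>)\<^sup>2) \<and> expectation (\<lambda>\<omega>. (Y' \<omega> * G \<omega>)\<^sup>2) = 1 \<and>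
          holds_up_to M \<kappa> (\<lambda>\<omega>. \<bar>(R t \<omega> - \<alpha> * J t \<omega>) / sqrt (A t) - sqrt L * (Y' \<omega> * G \<omega>)\<bar> \<le> \<kappa> \<and>
            \<bar>J t \<omega> / A t - L * (Y' \<omega>)\<^sup>2\<bar> \<le> \<kappa>)"
      proof (rule exI[of _ Y'], rule exI[of _ G], intro conjI YG main)
        show "indep_var borel Y' borel G"
          using indep_normal_indep_var[OF subalg[OF u(1)] G Y'F, of "\<lambda>x. x"] by simp
        show "distr M borel Y' = std_normal_distribution"
          using indep_normal_distr[OF subalg[OF zero_times] Y'n] unfolding std .
        show "distr M borel G = std_normal_distribution"
          using indep_normal_distr[OF subalg[OF u(1)] G] unfolding std .
      qed
    qed
  qed
qed


section \<open>The estimator\<close>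

text \<open>\<open>Y t\<close> is Gaussian with positive variance, hence almost surely nonzero, and so is the continuous
  integrand of \<open>J t\<close> at its right end point.\<close>

lemma J_pos:
  assumes t: "t \<in> times_upto T" "0 < t" and bt: "b t \<noteq> 0"
  shows "AE \<omega> in M. 0 < J t \<omega>"
proof -
  have Vt: "0 < V t" by (rule V_pos[OF t])
  have "AE x in lborel. x \<noteq> (0 :: real)" by (rule AE_lborel_singleton)
  then have "AE x in std_normal_distribution. x \<noteq> 0"
    by (subst AE_density) auto
  then have "AE x in distr std_normal_distribution borel (\<lambda>x. sqrt (V t) * x). x \<noteq> 0"
    using Vt by (subst AE_distr_iff) auto
  then have "AE x in distr M borel (Y t). x \<noteq> 0"
    unfolding indep_normal_distr[OF subalg[OF zero_times] normal_Y[OF t(1)]] .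
  then have "AE \<omega> in M. Y t \<omega> \<noteq> 0"
    using Y_measurable[OF t(1)] by (subst (asm) AE_distr_iff) auto
  with Y_paths show ?thesis
  proof eventually_elim
    case (elim \<omega>)
    let ?f = "\<lambda>s. (Y s \<omega>)\<^sup>2 * ((h s)\<^sup>2 * (\<sigma> s)\<^sup>2)"
    have c: "continuous_on {0..t} ?f"
      by (intro continuous_on_mult A_cont t continuous_intros on_Icc[OF elim(1)]) auto
    have "h t * \<sigma> t \<noteq> 0" using bt \<sigma>_nz[OF t(1), of t] t(2) by (simp add: h_def)
    then have "?f t \<noteq> 0" using elim(2) by simp
    then have "J t \<omega> \<noteq> 0"
      unfolding J_def using integral_eq_0_iff[OF c t(2)] t(2) by fastforce
    moreover have "0 \<le> J t \<omega>"
      unfolding J_def by (intro integral_nonneg integrable_continuous_interval c) auto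
    ultimately show ?case by simp
  qed
qed

text \<open>The log-likelihood is the concave parabola \<open>\<theta> R - \<theta>\<^sup>2 J / 2\<close>.\<close>

lemma MLE_eq:
  assumes t: "t \<in> times_upto T" "0 < t" and bt: "b t \<noteq> 0"
    and mle: "AE \<omega> in M. is_arg_max (log_likelihood b \<sigma> X R t \<omega>) (\<lambda>\<theta>. True) (est \<omega>)"
  shows "AE \<omega> in M. est \<omega> = R t \<omega> / J t \<omega>"
  using mle J_pos[OF t bt] X_cont
proof eventually_elim
  case (elim \<omega>)
  let ?f = "\<lambda>s. (Y s \<omega>)\<^sup>2 * ((h s)\<^sup>2 * (\<sigma> s)\<^sup>2)"
  have "(LBINT s:{0..t}. (b s)\<^sup>2 * (X s \<omega>)\<^sup>2 / (\<sigma> s)\<^sup>2) = (LBINT s:{0..t}. ?f s)"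
  proof (rule set_lebesgue_integral_cong)
    show "\<forall>s. s \<in> {0..t} \<longrightarrow> (b s)\<^sup>2 * (X s \<omega>)\<^sup>2 / (\<sigma> s)\<^sup>2 = ?f s"
      using \<sigma>_nz[OF t(1)] by (auto simp: h_def Y_def power2_eq_square)
  qed simp
  also have "\<dots> = J t \<omega>"
    unfolding J_def
    by (intro LBINT_continuous continuous_on_mult A_cont t continuous_on_power Y_cont elim(3))
  finally have ll: "log_likelihood b \<sigma> X R t \<omega> \<theta> = \<theta> * R t \<omega> - \<theta>\<^sup>2 / 2 * J t \<omega>" for \<theta>
    by (simp add: log_likelihood_def)
  have square: "\<theta> * R t \<omega> - \<theta>\<^sup>2 / 2 * J t \<omega> = (R t \<omega>)\<^sup>2 / (2 * J t \<omega>) - J t \<omega> / 2 * (\<theta> - R t \<omega> / J t \<omega>)\<^sup>2" for \<theta>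
    using elim(2) by (simp add: power2_eq_square field_simps)
  have "log_likelihood b \<sigma> X R t \<omega> (R t \<omega> / J t \<omega>) \<le> log_likelihood b \<sigma> X R t \<omega> (est \<omega>)"
    using elim(1) by (auto simp: is_arg_max_def not_less)
  then have "J t \<omega> / 2 * (est \<omega> - R t \<omega> / J t \<omega>)\<^sup>2 \<le> 0" unfolding ll square by simp
  then have "(est \<omega> - R t \<omega> / J t \<omega>)\<^sup>2 \<le> 0" using elim(2) by (simp add: mult_le_0_iff)
  then show ?case by simp
qed

end


section \<open>Quotients of independent normal variables\<close>

text \<open>With \<open>c\<^sup>2 = 1 + z\<^sup>2\<close> the product of the two densities is a multiple of the standard normal density at
  \<open>c y\<close>, which reduces the integral to the first absolute moment.\<close>

lemma nn_integral_abs_normal_product: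
  fixes z :: real
  shows "(\<integral>\<^sup>+y. ennreal (std_normal_density y * \<bar>y\<bar> * std_normal_density (y * z)) \<partial>lborel) =
    ennreal (standard_cauchy_density z)"
proof -
  define c where "c = sqrt (1 + z\<^sup>2)"
  have c: "0 < c" "c\<^sup>2 = 1 + z\<^sup>2" by (auto simp: c_def add_pos_nonneg)
  have "has_bochner_integral lborel (\<lambda>x. std_normal_density x * \<bar>x\<bar>) (sqrt (2 / pi))"
    using std_normal_moment_abs_odd[of 0] by simp
  from lborel_has_bochner_integral_real_affine_iff[THEN iffD1, OF _ this, of c 0] c
  have "has_bochner_integral lborel (\<lambda>y. std_normal_density (c * y) * \<bar>c * y\<bar>) (sqrt (2 / pi) / c)"
    by (simp add: divide_inverse mult.commute)
  from has_bochner_integral_mult_right[OF this, of "1 / (c * sqrt (2 * pi))"]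
  have "has_bochner_integral lborel
      (\<lambda>y. 1 / (c * sqrt (2 * pi)) * (std_normal_density (c * y) * \<bar>c * y\<bar>))
      (1 / (c * sqrt (2 * pi)) * (sqrt (2 / pi) / c))" by simp
  moreover have "1 / (c * sqrt (2 * pi)) * (std_normal_density (c * y) * \<bar>c * y\<bar>) =
      std_normal_density y * \<bar>y\<bar> * std_normal_density (y * z)" for y
  proof -
    have "exp (- (c * y)\<^sup>2 / 2) = exp (- y\<^sup>2 / 2) * exp (- (y * z)\<^sup>2 / 2)"
      unfolding power_mult_distrib c(2) by (simp add: exp_add[symmetric] field_simps)
    then show ?thesis using c(1) by (simp add: std_normal_density_def abs_mult)
  qed
  moreover have "1 / (c * sqrt (2 * pi)) * (sqrt (2 / pi) / c) = standard_cauchy_density z"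
  proof -
    have "sqrt (2 / pi) / sqrt (2 * pi) = 1 / pi"
      by (simp add: real_sqrt_divide real_sqrt_mult)
    then show ?thesis
      using c by (simp add: standard_cauchy_density_def power2_eq_square field_simps)
  qed
  ultimately have hb: "has_bochner_integral lborel (\<lambda>y. std_normal_density y * \<bar>y\<bar> * std_normal_density (y * z))
      (standard_cauchy_density z)" by simp
  show ?thesis
    using hb by (subst nn_integral_eq_integral) (auto simp: has_bochner_integral_iff)
qed

text \<open>For \<open>y \<noteq> 0\<close> the condition says \<open>g / y \<le> x\<close>. Substituting \<open>g = y z\<close> and integrating out \<open>y\<close> gives
  the Cauchy density in \<open>z\<close>.\<close>

lemma normal_ratio_Cauchy:
  "emeasure (std_normal_distribution \<Otimes>\<^sub>M std_normal_distribution)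
     {p \<in> space (std_normal_distribution \<Otimes>\<^sub>M std_normal_distribution). fst p * snd p - x * (fst p)\<^sup>2 \<le> 0} =
   (\<integral>\<^sup>+z. ennreal (standard_cauchy_density z) * indicator {..x} z \<partial>lborel)"
proof -
  let ?N = "std_normal_distribution"
  interpret N: prob_space ?N by (rule prob_space_normal_density) simp
  let ?S = "{p \<in> space (?N \<Otimes>\<^sub>M ?N). fst p * snd p - x * (fst p)\<^sup>2 \<le> 0}"
  have "?S \<in> sets (?N \<Otimes>\<^sub>M ?N)" by measurable
  then have "emeasure (?N \<Otimes>\<^sub>M ?N) ?S = (\<integral>\<^sup>+y. emeasure ?N (Pair y -` ?S) \<partial>?N)"
    by (rule N.emeasure_pair_measure_alt)
  also have "\<dots> = (\<integral>\<^sup>+y. emeasure ?N {g. y * g - x * y\<^sup>2 \<le> 0} \<partial>?N)"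
    by (intro nn_integral_cong arg_cong[of _ _ "emeasure ?N"]) (auto simp: space_pair_measure)
  also have "\<dots> = (\<integral>\<^sup>+y. (\<integral>\<^sup>+g. ennreal (std_normal_density g) * indicator {g. y * g - x * y\<^sup>2 \<le> 0} g \<partial>lborel) \<partial>?N)"
    by (intro nn_integral_cong emeasure_density) auto
  also have "\<dots> = (\<integral>\<^sup>+y. ennreal (std_normal_density y) *
      (\<integral>\<^sup>+g. ennreal (std_normal_density g) * indicator {g. y * g - x * y\<^sup>2 \<le> 0} g \<partial>lborel) \<partial>lborel)"
  proof (rule nn_integral_density)
    show "(\<lambda>y. \<integral>\<^sup>+g. ennreal (std_normal_density g) * indicator {g. y * g - x * y\<^sup>2 \<le> 0} g \<partial>lborel) \<in> borel_measurable lborel"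
      by (simp add: indicator_def if_distrib cong: if_cong) measurable
  qed simp
  also have "\<dots> = (\<integral>\<^sup>+y. (\<integral>\<^sup>+z. ennreal (std_normal_density y * \<bar>y\<bar> * std_normal_density (y * z)) * indicator {..x} z \<partial>lborel) \<partial>lborel)"
  proof (rule nn_integral_cong_AE)
    have "AE y in lborel. y \<noteq> (0 :: real)" by (rule AE_lborel_singleton)
    then show "AE y in lborel. ennreal (std_normal_density y) *
        (\<integral>\<^sup>+g. ennreal (std_normal_density g) * indicator {g. y * g - x * y\<^sup>2 \<le> 0} g \<partial>lborel) =
        (\<integral>\<^sup>+z. ennreal (std_normal_density y * \<bar>y\<bar> * std_normal_density (y * z)) * indicator {..x} z \<partial>lborel)"
    proof eventually_elim
      case (elim y)
      have iff: "y * (y * z) - x * y\<^sup>2 \<le> 0 \<longleftrightarrow> z \<le> x" for z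
      proof -
        have "y * (y * z) - x * y\<^sup>2 = y\<^sup>2 * (z - x)" by (simp add: power2_eq_square algebra_simps)
        then show ?thesis using elim by (simp add: mult_le_0_iff)
      qed
      have iff': "y * (y * z) \<le> x * y\<^sup>2 \<longleftrightarrow> z \<le> x" for z using iff[of z] by simp
      have "(\<integral>\<^sup>+g. ennreal (std_normal_density g) * indicator {g. y * g - x * y\<^sup>2 \<le> 0} g \<partial>lborel) =
          ennreal \<bar>y\<bar> * (\<integral>\<^sup>+z. ennreal (std_normal_density (0 + y * z)) *
            indicator {g. y * g - x * y\<^sup>2 \<le> 0} (0 + y * z) \<partial>lborel)"
        using elim by (subst nn_integral_real_affine[where c=y and t=0]) auto
      also have "\<dots> = (\<integral>\<^sup>+z. ennreal (\<bar>y\<bar> * std_normal_density (y * z)) * indicator {..x} z \<partial>lborel)"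
        by (subst nn_integral_cmult[symmetric])
          (auto intro!: nn_integral_cong simp: iff' indicator_def ennreal_mult normal_density_nonneg)
      finally have "ennreal (std_normal_density y) *
          (\<integral>\<^sup>+g. ennreal (std_normal_density g) * indicator {g. y * g - x * y\<^sup>2 \<le> 0} g \<partial>lborel) =
          ennreal (std_normal_density y) *
          (\<integral>\<^sup>+z. ennreal (\<bar>y\<bar> * std_normal_density (y * z)) * indicator {..x} z \<partial>lborel)" by simp
      also have "\<dots> = (\<integral>\<^sup>+z. ennreal (std_normal_density y) *
          (ennreal (\<bar>y\<bar> * std_normal_density (y * z)) * indicator {..x} z) \<partial>lborel)"
        by (rule nn_integral_cmult[symmetric]) measurable
      also have "\<dots> = (\<integral>\<^sup>+z. ennreal (std_normal_density y * \<bar>y\<bar> * std_normal_density (y * z)) * indicator {..x} z \<partial>lborel)"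
        by (intro nn_integral_cong) (simp add: indicator_def ennreal_mult normal_density_nonneg mult.assoc)
      finally show ?case .
    qed
  qed
  also have "\<dots> = (\<integral>\<^sup>+z. (\<integral>\<^sup>+y. ennreal (std_normal_density y * \<bar>y\<bar> * std_normal_density (y * z)) * indicator {..x} z \<partial>lborel) \<partial>lborel)"
    by (rule lborel_pair.Fubini') measurable
  also have "\<dots> = (\<integral>\<^sup>+z. ennreal (standard_cauchy_density z) * indicator {..x} z \<partial>lborel)"
    by (intro nn_integral_cong) (subst nn_integral_multc, auto simp: nn_integral_abs_normal_product)
  finally show ?thesis .
qed

lemma normal_ratio_no_atom:
  "AE p in std_normal_distribution \<Otimes>\<^sub>M std_normal_distribution. fst p * snd p - x * (fst p)\<^sup>2 \<noteq> 0"
proof -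
  let ?N = "std_normal_distribution"
  interpret N: prob_space ?N by (rule prob_space_normal_density) simp
  interpret NN: pair_sigma_finite ?N ?N ..
  have abs: "AE y in ?N. y \<noteq> r" for r
    using AE_lborel_singleton[of r] by (subst AE_density) auto
  have "AE y in ?N. AE g in ?N. y * g - x * y\<^sup>2 \<noteq> 0"
    using abs[of 0]
  proof eventually_elim
    case (elim y)
    show ?case using abs[of "x * y"]
    proof eventually_elim
      case (elim g)
      have "y * g - x * y\<^sup>2 = y * (g - x * y)" by (simp add: power2_eq_square algebra_simps)
      then show ?case using \<open>y \<noteq> 0\<close> elim by simp
    qed
  qed
  moreover have "{p \<in> space (?N \<Otimes>\<^sub>M ?N). fst p * snd p - x * (fst p)\<^sup>2 \<noteq> 0} \<in> sets (?N \<Otimes>\<^sub>M ?N)"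
    by measurable
  ultimately show ?thesis by (intro NN.AE_pair_measure) auto
qed

text \<open>Let \<open>U\<close> be close in probability to variables of law \<open>\<nu>\<close>, which may change with \<open>t\<close>. Then its
  distribution function at \<open>y\<close> is squeezed between values of that of \<open>\<nu>\<close> at points close to \<open>y\<close>.\<close>

lemma (in prob_space) coupled_cdf_limit:
  assumes \<nu>: "real_distribution \<nu>" and atom: "measure \<nu> {y} = 0"
    and E: "\<forall>\<^sub>F t in G. E t \<in> sets M \<and> (AE \<omega> in M. \<omega> \<in> E t \<longleftrightarrow> U t \<omega> \<le> y)"
    and coupling: "\<And>\<delta>. 0 < \<delta> \<Longrightarrow> \<forall>\<^sub>F t in G. \<exists>W. W \<in> borel_measurable M \<and> distr M borel W = \<nu> \<and>
      holds_up_to M \<delta> (\<lambda>\<omega>. \<bar>U t \<omega> - W \<omega>\<bar> \<le> \<delta>)"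
  shows "((\<lambda>t. prob (E t)) \<longlongrightarrow> cdf \<nu> y) G"
proof (rule tendstoI)
  fix \<epsilon> :: real assume \<epsilon>: "0 < \<epsilon>"
  interpret \<nu>: real_distribution \<nu> by (rule \<nu>)
  have "isCont (cdf \<nu>) y" using atom by (simp add: \<nu>.isCont_cdf)
  then obtain s where s: "0 < s" "\<And>z. \<bar>z - y\<bar> < s \<Longrightarrow> \<bar>cdf \<nu> z - cdf \<nu> y\<bar> < \<epsilon> / 2"
    using \<epsilon> unfolding continuous_at_eps_delta dist_real_def by (meson half_gt_zero)
  define \<delta> where "\<delta> = min (s / 2) (\<epsilon> / 3)"
  have \<delta>: "0 < \<delta>" "\<delta> < s" "\<delta> < \<epsilon> / 2" using s(1) \<epsilon> by (auto simp: \<delta>_def min_def)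
  from coupling[OF \<delta>(1)] E show "\<forall>\<^sub>F t in G. dist (prob (E t)) (cdf \<nu> y) < \<epsilon>"
  proof eventually_elim
    case (elim t)
    then obtain W where W [measurable]: "W \<in> borel_measurable M" and law: "distr M borel W = \<nu>"
      and close: "holds_up_to M \<delta> (\<lambda>\<omega>. \<bar>U t \<omega> - W \<omega>\<bar> \<le> \<delta>)" by blast
    have Et [measurable]: "E t \<in> sets M" and ae: "AE \<omega> in M. \<omega> \<in> E t \<longleftrightarrow> U t \<omega> \<le> y" using elim by auto
    have "holds_up_to M \<delta> (\<lambda>\<omega>. \<bar>U t \<omega> - W \<omega>\<bar> \<le> \<delta> \<and> (\<omega> \<in> E t \<longleftrightarrow> U t \<omega> \<le> y))"
      using holds_up_to_conj[OF close AE_holds_up_to[OF ae order_refl]] by simp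
    then obtain A where A [measurable]: "A \<in> sets M" and PA: "prob A \<le> \<delta>"
      and off: "\<And>\<omega>. \<omega> \<in> space M \<Longrightarrow> \<omega> \<notin> A \<Longrightarrow> \<bar>U t \<omega> - W \<omega>\<bar> \<le> \<delta> \<and> (\<omega> \<in> E t \<longleftrightarrow> U t \<omega> \<le> y)"
      unfolding holds_up_to_def by blast
    have cdf_W: "cdf \<nu> z = prob {\<omega>\<in>space M. W \<omega> \<le> z}" for z
      unfolding law[symmetric] cdf_def
      by (subst measure_distr) (auto intro!: arg_cong[of _ _ prob])
    have Esp: "E t \<subseteq> space M" using Et by (rule sets.sets_into_space)
    have "prob (E t) \<le> prob ({\<omega>\<in>space M. W \<omega> \<le> y + \<delta>} \<union> A)"
    proof (rule finite_measure_mono)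
      show "E t \<subseteq> {\<omega>\<in>space M. W \<omega> \<le> y + \<delta>} \<union> A"
      proof
        fix \<omega> assume \<omega>: "\<omega> \<in> E t"
        then have "\<omega> \<in> space M" using Esp by auto
        then show "\<omega> \<in> {\<omega>\<in>space M. W \<omega> \<le> y + \<delta>} \<union> A" using off[of \<omega>] \<omega> by (auto simp: abs_le_iff)
      qed
    qed measurable
    also have "\<dots> \<le> cdf \<nu> (y + \<delta>) + \<delta>"
      using measure_Un_le[of "{\<omega>\<in>space M. W \<omega> \<le> y + \<delta>}" M A] PA by (simp add: cdf_W)
    finally have upper: "prob (E t) \<le> cdf \<nu> (y + \<delta>) + \<delta>" .
    have "prob {\<omega>\<in>space M. W \<omega> \<le> y - \<delta>} \<le> prob (E t \<union> A)"
    proof (rule finite_measure_mono)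
      show "{\<omega>\<in>space M. W \<omega> \<le> y - \<delta>} \<subseteq> E t \<union> A"
      proof
        fix \<omega> assume \<omega>: "\<omega> \<in> {\<omega>\<in>space M. W \<omega> \<le> y - \<delta>}"
        show "\<omega> \<in> E t \<union> A" using off[of \<omega>] \<omega> by (auto simp: abs_le_iff)
      qed
    qed measurable
    also have "\<dots> \<le> prob (E t) + \<delta>" using measure_Un_le[of "E t" M A] PA by simp
    finally have lower: "cdf \<nu> (y - \<delta>) \<le> prob (E t) + \<delta>" by (simp add: cdf_W)
    have "\<bar>cdf \<nu> (y + \<delta>) - cdf \<nu> y\<bar> < \<epsilon> / 2" "\<bar>cdf \<nu> (y - \<delta>) - cdf \<nu> y\<bar> < \<epsilon> / 2"
      using s(2)[of "y + \<delta>"] s(2)[of "y - \<delta>"] \<delta>(1,2) by auto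
    with upper lower \<delta>(3) show ?case unfolding dist_real_def by linarith
  qed
qed


theorem theorem2p8:
  fixes T :: ereal
    and b \<sigma> :: "real \<Rightarrow> real"
    and t0 \<alpha> :: real
    and M :: "'a measure"
    and F :: "real \<Rightarrow> 'a measure"
    and B X :: "real \<Rightarrow> 'a \<Rightarrow> real"
    and \<alpha>_hat :: "real \<Rightarrow> 'a \<Rightarrow> real"
    and N :: "'b measure"
    and \<zeta> :: "'b \<Rightarrow> real"
  assumes "0 < T"
    and "continuous_on (times_upto T) b"
    and "continuous_on (times_upto T) \<sigma>"
    and "\<forall>t\<in>times_upto T. \<sigma> t > 0"
    and "0 < t0" and "ereal t0 < T"
    and "\<forall>t\<in>times_upto T. t0 \<le> t \<longrightarrow> b t \<noteq> 0"
    and "filtered_prob_space M F T"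
    and "usual_conditions M F T"
    and "\<forall>t\<in>times_upto T. sets (F t) = augmented_natural_sets M B t"
    and "sets M = sigma_sets (space M) (\<Union>t\<in>times_upto T. sets (F t))"
    and "wiener_process M F T B"
    and "sde_solution M F T B (\<lambda>t x. \<alpha> * b t * x) (\<lambda>t x. \<sigma> t) 0 X"
    and "\<forall>t\<in>times_upto T. t0 \<le> t \<longrightarrow> is_MLE M F T b \<sigma> X t (\<alpha>_hat t)"
    and "filterlim (fisher_information M b \<sigma> X) at_top (up_to T)"
    and "\<exists>L. ((\<lambda>t. LBINT s:{0..t}. (\<sigma> s)\<^sup>2 * exp (- 2 * \<alpha> * (LBINT v:{0..s}. b v)))
               \<longlongrightarrow> L) (up_to T)"
    and "prob_space N"
    and "distributed N lborel \<zeta> (\<lambda>x. ennreal (standard_cauchy_density x))"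
  shows "converges_in_distribution M
           (\<lambda>t \<omega>. sqrt (fisher_information M b \<sigma> X t) * (\<alpha>_hat t \<omega> - \<alpha>)) (up_to T) N \<zeta>"
proof -
  interpret linear_sde M F T b \<sigma> \<alpha> B X
    unfolding linear_sde_def linear_sde_axioms_def filtered_space_def filtered_space_axioms_def
  proof (intro conjI allI impI)
    show "prob_space M" using assms(8) by (simp add: filtered_prob_space_def)
    show "subalgebra M (F t)" if "t \<in> times_upto T" for t
      using assms(8) that by (simp add: filtered_prob_space_def)
    show "sets (F s) \<subseteq> sets (F t)" if "s \<in> times_upto T" "t \<in> times_upto T" "s \<le> t" for s t
      using assms(8) that by (simp add: filtered_prob_space_def)
    have "0 \<in> times_upto T" using assms(1) by (simp add: times_upto_def zero_ereal_def)
    then have "sets (F 0) \<subseteq> sets M" using assms(8) by (simp add: filtered_prob_space_def subalgebra_def)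
    then show "negligible_sets M \<subseteq> sets M" using assms(9) by (auto simp: usual_conditions_def)
    show "0 < \<sigma> t" if "t \<in> times_upto T" for t using assms(4) that by blast
  qed (rule assms)+
  interpret N: prob_space N by (rule assms(17))
  let ?I = "fisher_information M b \<sigma> X"
  have nt: "up_to T \<noteq> bot" by (rule up_to_nontrivial[OF T_pos])
  have t0: "t0 \<in> times_upto T" using assms(5,6) by (simp add: times_upto_def)
  have ev: "\<forall>\<^sub>F t in up_to T. t \<in> times_upto T \<and> t0 \<le> t" by (rule up_to_eventually_ge[OF t0])
  \<comment> \<open>the limit \<open>L\<close> of the variance of the discounted solution\<close>
  obtain L where L0: "((\<lambda>t. LBINT s:{0..t}. (\<sigma> s)\<^sup>2 * exp (- 2 * \<alpha> * (LBINT v:{0..s}. b v))) \<longlongrightarrow> L) (up_to T)"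
    using assms(16) by blast
  have V_LBINT: "(LBINT s:{0..t}. (\<sigma> s)\<^sup>2 * exp (- 2 * \<alpha> * (LBINT v:{0..s}. b v))) = V t" if t: "t \<in> times_upto T" for t
  proof -
    have "(LBINT s:{0..t}. (\<sigma> s)\<^sup>2 * exp (- 2 * \<alpha> * (LBINT v:{0..s}. b v))) = (LBINT s:{0..t}. (\<mu> s)\<^sup>2 * (\<sigma> s)\<^sup>2)"
    proof (rule set_lebesgue_integral_cong)
      show "\<forall>s. s \<in> {0..t} \<longrightarrow> (\<sigma> s)\<^sup>2 * exp (- 2 * \<alpha> * (LBINT v:{0..s}. b v)) = (\<mu> s)\<^sup>2 * (\<sigma> s)\<^sup>2"
      proof (intro allI impI)
        fix s assume "s \<in> {0..t}"
        then have "(LBINT v:{0..s}. b v) = integral {0..s} b"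
          using t by (intro LBINT_continuous on_Icc[OF b_cont] times_upto_downward[OF t]) auto
        moreover have "exp (- 2 * \<alpha> * integral {0..s} b) = (\<mu> s)\<^sup>2"
          by (simp add: \<mu>_def power2_eq_square exp_add[symmetric])
        ultimately show "(\<sigma> s)\<^sup>2 * exp (- 2 * \<alpha> * (LBINT v:{0..s}. b v)) = (\<mu> s)\<^sup>2 * (\<sigma> s)\<^sup>2"
          by (simp add: mult.commute)
      qed
    qed simp
    also have "\<dots> = V t" unfolding V_def by (rule LBINT_continuous[OF V_cont[OF t]])
    finally show ?thesis .
  qed
  have Vlim: "(V \<longlongrightarrow> L) (up_to T)"
    by (rule Lim_transform_eventually[OF L0]) (use ev in eventually_elim, use V_LBINT in blast)
  have L: "V t \<le> L" if t: "t \<in> times_upto T" for t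
  proof (rule tendsto_lowerbound[OF Vlim _ nt])
    show "\<forall>\<^sub>F s in up_to T. V t \<le> V s"
      using up_to_eventually_ge[OF t] by eventually_elim (use t in \<open>auto intro!: V_mono simp: times_upto_def\<close>)
  qed
  then have bound: "\<forall>t\<in>times_upto T. V t \<le> L" by blast
  have "0 < L" using V_pos[OF t0 assms(5)] L[OF t0] by simp
  have Alim: "filterlim A at_top (up_to T)"
  proof (rule filterlim_at_top_mono)
    show "filterlim (\<lambda>t. ?I t * (1 / L)) at_top (up_to T)"
      using filterlim_tendsto_pos_mult_at_top[OF tendsto_const[of "1 / L"] _ assms(15)] \<open>0 < L\<close>
      by (simp add: mult.commute)
    show "\<forall>\<^sub>F t in up_to T. ?I t * (1 / L) \<le> A t"
      using ev
    proof eventually_elim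
      case (elim t)
      then have "?I t \<le> L * A t"
        using assms(5) by (intro fisher_information_bounds(2)[where u=0, OF L]) auto
      then show ?case using \<open>0 < L\<close> by (simp add: pos_divide_le_eq mult.commute)
    qed
  qed
  have p_lim: "((\<lambda>t. sqrt (?I t / A t)) \<longlongrightarrow> sqrt L) (up_to T)"
    by (intro tendsto_real_sqrt fisher_information_ratio[OF L Vlim Alim])
  \<comment> \<open>each estimator comes with its own version of the score integral\<close>
  have "\<exists>R. \<forall>t\<in>{t\<in>times_upto T. t0 \<le> t}. score_integral (R t) \<and> (AE \<omega> in M. \<alpha>_hat t \<omega> = R t t \<omega> / J t \<omega>)"
  proof (rule bchoice, rule ballI)
    fix t assume "t \<in> {t\<in>times_upto T. t0 \<le> t}"
    then have t: "t \<in> times_upto T" "t0 \<le> t" "0 < t" "b t \<noteq> 0" using assms(5,7) by auto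
    obtain S where "score_integral S"
      "AE \<omega> in M. is_arg_max (log_likelihood b \<sigma> X S t \<omega>) (\<lambda>\<theta>. True) (\<alpha>_hat t \<omega>)"
      using assms(14) t(1,2) unfolding is_MLE_def by blast
    then show "\<exists>S. score_integral S \<and> (AE \<omega> in M. \<alpha>_hat t \<omega> = S t \<omega> / J t \<omega>)"
      using MLE_eq[OF t(1,3,4)] by blast
  qed
  then obtain R where R: "\<And>t. t \<in> times_upto T \<Longrightarrow> t0 \<le> t \<Longrightarrow> score_integral (R t)"
    and est: "\<And>t. t \<in> times_upto T \<Longrightarrow> t0 \<le> t \<Longrightarrow> AE \<omega> in M. \<alpha>_hat t \<omega> = R t t \<omega> / J t \<omega>" by blast
  define Z where "Z t \<omega> = sqrt (?I t) * (\<alpha>_hat t \<omega> - \<alpha>)" for t \<omega>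
  have Z_meas: "Z t \<in> borel_measurable M" if t: "t \<in> times_upto T" "t0 \<le> t" for t
  proof -
    have "R t t \<in> borel_measurable M"
      using R[OF t] F_M[OF _ t(1)] t(1) by (auto simp: is_stochastic_integral_def continuous_adapted_def)
    then have "(\<lambda>\<omega>. R t t \<omega> / J t \<omega>) \<in> borel_measurable M" using J_measurable[OF t(1)] by simp
    from measurable_AE_eq[OF this est[OF t]] show ?thesis unfolding Z_def[abs_def] by simp
  qed
  let ?N = std_normal_distribution
  interpret std: prob_space ?N by (rule prob_space_normal_density) simp
  interpret std2: pair_prob_space ?N ?N ..
  show ?thesis
    unfolding converges_in_distribution_def Z_def[symmetric]
  proof (intro allI impI)
    fix x
    \<comment> \<open>numerator minus \<open>x\<close> times denominator, normalized; it is nonpositive iff the estimation error is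
      at most \<open>x\<close>\<close>
    define U where "U t \<omega> = sqrt (?I t / A t) * ((R t t \<omega> - \<alpha> * J t \<omega>) / sqrt (A t)) - x * (J t \<omega> / A t)" for t \<omega>
    define f where "f p = fst p * snd p - x * (fst p)\<^sup>2" for p :: "real \<times> real"
    have f [measurable]: "f \<in> borel_measurable (borel \<Otimes>\<^sub>M borel)" unfolding f_def by measurable
    have sets_N2: "sets (?N \<Otimes>\<^sub>M ?N) = sets (borel \<Otimes>\<^sub>M borel)" by (intro sets_pair_measure_cong) auto
    have f_N2 [measurable]: "(\<lambda>p. L * f p) \<in> borel_measurable (?N \<Otimes>\<^sub>M ?N)"
      unfolding measurable_cong_sets[OF sets_N2 refl] by measurable
    define \<nu> where "\<nu> = distr (?N \<Otimes>\<^sub>M ?N) borel (\<lambda>p. L * f p)"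
    have \<nu>: "real_distribution \<nu>" unfolding \<nu>_def by (rule std2.real_distribution_distr[OF f_N2])
    have atom: "measure \<nu> {0} = 0"
    proof -
      have "AE p in ?N \<Otimes>\<^sub>M ?N. L * f p \<noteq> 0"
        using normal_ratio_no_atom[of x] by eventually_elim (use \<open>0 < L\<close> in \<open>simp add: f_def\<close>)
      then have "AE y in \<nu>. y \<noteq> 0" unfolding \<nu>_def by (subst AE_distr_iff) auto
      then have "emeasure \<nu> {y \<in> space \<nu>. \<not> y \<noteq> 0} = 0"
        by (subst (asm) AE_iff_measurable[OF _ refl]) (auto simp: \<nu>_def)
      then show ?thesis by (simp add: \<nu>_def measure_def)
    qed
    have cdf_\<nu>: "cdf \<nu> 0 = cdf (distr N borel \<zeta>) x"
    proof -
      have "emeasure \<nu> {..0} = emeasure (?N \<Otimes>\<^sub>M ?N) {p \<in> space (?N \<Otimes>\<^sub>M ?N). fst p * snd p - x * (fst p)\<^sup>2 \<le> 0}"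
        unfolding \<nu>_def using \<open>0 < L\<close> f_N2
        by (subst emeasure_distr) (auto intro!: arg_cong[of _ _ "emeasure (?N \<Otimes>\<^sub>M ?N)"] simp: f_def mult_le_0_iff)
      also have "\<dots> = emeasure (density lborel (\<lambda>z. ennreal (standard_cauchy_density z))) {..x}"
        unfolding normal_ratio_Cauchy
        by (subst emeasure_density) (auto simp: standard_cauchy_density_def)
      also have "density lborel (\<lambda>z. ennreal (standard_cauchy_density z)) = distr N lborel \<zeta>"
        using distributed_distr_eq_density[OF assms(18)] by simp
      also have "emeasure (distr N lborel \<zeta>) {..x} = emeasure (distr N borel \<zeta>) {..x}"
        by (simp cong: distr_cong)
      finally show ?thesis by (simp add: cdf_def measure_def)
    qed
    have E: "\<forall>\<^sub>F t in up_to T. {\<omega>\<in>space M. Z t \<omega> \<le> x} \<in> sets M \<and>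
        (AE \<omega> in M. \<omega> \<in> {\<omega>\<in>space M. Z t \<omega> \<le> x} \<longleftrightarrow> U t \<omega> \<le> 0)"
    proof -
      have "\<forall>\<^sub>F t in up_to T. 1 \<le> A t" using Alim by (simp add: filterlim_at_top)
      with ev show ?thesis
      proof eventually_elim
        case (elim t)
        then have t: "t \<in> times_upto T" "t0 \<le> t" "0 < t" "b t \<noteq> 0" and At: "0 < A t" using assms(5,7) by auto
        have [measurable]: "Z t \<in> borel_measurable M" by (rule Z_meas[OF t(1,2)])
        have "AE \<omega> in M. \<omega> \<in> {\<omega>\<in>space M. Z t \<omega> \<le> x} \<longleftrightarrow> U t \<omega> \<le> 0"
          using est[OF t(1,2)] J_pos[OF t(1,3,4)] AE_space
        proof eventually_elim
          case (elim \<omega>)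
          let ?n = "R t t \<omega> - \<alpha> * J t \<omega>"
          have "Z t \<omega> = sqrt (?I t) * ?n / J t \<omega>"
            using elim by (simp add: Z_def diff_divide_distrib right_diff_distrib)
          then have "Z t \<omega> \<le> x \<longleftrightarrow> sqrt (?I t) * ?n - x * J t \<omega> \<le> 0"
            using elim(2) by (simp add: pos_divide_le_eq)
          also have "\<dots> \<longleftrightarrow> (sqrt (?I t) * ?n - x * J t \<omega>) / A t \<le> 0"
            using At by (simp add: pos_divide_le_eq)
          also have "(sqrt (?I t) * ?n - x * J t \<omega>) / A t = U t \<omega>"
          proof -
            have "sqrt (?I t / A t) * (?n / sqrt (A t)) = sqrt (?I t) * ?n / A t"
              using At by (simp add: real_sqrt_divide)
            then show ?thesis by (simp add: U_def diff_divide_distrib)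
          qed
          finally show ?case using elim(3) by simp
        qed
        then show ?case by simp
      qed
    qed
    have "((\<lambda>t. prob {\<omega>\<in>space M. Z t \<omega> \<le> x}) \<longlongrightarrow> cdf \<nu> 0) (up_to T)"
    proof (rule coupled_cdf_limit[OF \<nu> atom E])
      fix \<delta> :: real assume \<delta>: "0 < \<delta>"
      let ?l = "sqrt L"
      define c where "c = 1 + ?l + \<bar>x\<bar>"
      have c: "0 < c" "0 \<le> ?l" using \<open>0 < L\<close> by (auto simp: c_def intro!: add_pos_nonneg)
      \<comment> \<open>the last bound makes \<open>\<kappa> sqrt L Y' G\<close> small in probability, by its second moment\<close>
      define \<kappa> where "\<kappa> = min (min 1 (\<delta> / 2)) (min (\<delta> / (2 * c)) (sqrt (\<delta> ^ 3 / (8 * L))))"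
      have \<kappa>: "0 < \<kappa>" "\<kappa> \<le> 1" "\<kappa> \<le> \<delta> / 2" "\<kappa> * c \<le> \<delta> / 2" "\<kappa>\<^sup>2 * L \<le> (\<delta> / 2)\<^sup>2 * (\<delta> / 2)"
      proof -
        show pos: "0 < \<kappa>" unfolding \<kappa>_def using \<delta> c \<open>0 < L\<close> by simp
        show "\<kappa> \<le> 1" "\<kappa> \<le> \<delta> / 2" unfolding \<kappa>_def by linarith+
        have "\<kappa> \<le> \<delta> / (2 * c)" "\<kappa> \<le> sqrt (\<delta> ^ 3 / (8 * L))" unfolding \<kappa>_def by linarith+
        then show "\<kappa> * c \<le> \<delta> / 2" using c by (simp add: field_simps)
        have "\<kappa>\<^sup>2 \<le> (sqrt (\<delta> ^ 3 / (8 * L)))\<^sup>2" using \<open>\<kappa> \<le> sqrt _\<close> pos by (intro power_mono) auto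
        also have "\<dots> = \<delta> ^ 3 / (8 * L)" using \<delta> \<open>0 < L\<close> by simp
        finally have "\<kappa>\<^sup>2 * L \<le> \<delta> ^ 3 / 8" using \<open>0 < L\<close> by (simp add: field_simps)
        then show "\<kappa>\<^sup>2 * L \<le> (\<delta> / 2)\<^sup>2 * (\<delta> / 2)" by (simp add: power2_eq_square power3_eq_cube)
      qed
      have "\<forall>\<^sub>F t in up_to T. \<bar>sqrt (?I t / A t) - ?l\<bar> < \<kappa>"
        using p_lim \<kappa>(1) unfolding tendsto_iff dist_real_def by blast
      with ev joint_approx[OF bound \<open>0 < L\<close> Vlim Alim \<kappa>(1)]
      show "\<forall>\<^sub>F t in up_to T. \<exists>W. W \<in> borel_measurable M \<and> distr M borel W = \<nu> \<and>
          holds_up_to M \<delta> (\<lambda>\<omega>. \<bar>U t \<omega> - W \<omega>\<bar> \<le> \<delta>)"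
      proof eventually_elim
        case (elim t)
        have "score_integral (R t)" using R elim(1) by blast
        with elim(2) obtain Y' G where ind: "indep_var borel Y' borel G"
          and law: "distr M borel Y' = ?N" "distr M borel G = ?N"
          and YG: "integrable M (\<lambda>\<omega>. (Y' \<omega> * G \<omega>)\<^sup>2)" "expectation (\<lambda>\<omega>. (Y' \<omega> * G \<omega>)\<^sup>2) = 1"
          and close: "holds_up_to M \<kappa> (\<lambda>\<omega>. \<bar>(R t t \<omega> - \<alpha> * J t \<omega>) / sqrt (A t) - ?l * (Y' \<omega> * G \<omega>)\<bar> \<le> \<kappa> \<and>
            \<bar>J t \<omega> / A t - L * (Y' \<omega>)\<^sup>2\<bar> \<le> \<kappa>)" by blast
        have [measurable]: "Y' \<in> borel_measurable M" "G \<in> borel_measurable M"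
          using indep_var_rv1[OF ind] indep_var_rv2[OF ind] by auto
        define W where "W \<omega> = L * f (Y' \<omega>, G \<omega>)" for \<omega>
        have Wm: "W \<in> borel_measurable M" unfolding W_def f_def by simp
        have "distr M borel W = distr (distr M (borel \<Otimes>\<^sub>M borel) (\<lambda>\<omega>. (Y' \<omega>, G \<omega>))) borel (\<lambda>p. L * f p)"
          unfolding W_def by (subst distr_distr) (auto simp: comp_def)
        also have "distr M (borel \<Otimes>\<^sub>M borel) (\<lambda>\<omega>. (Y' \<omega>, G \<omega>)) = ?N \<Otimes>\<^sub>M ?N"
          using ind unfolding indep_var_distribution_eq law by simp
        finally have W_law: "distr M borel W = \<nu>" unfolding \<nu>_def .
        have small: "holds_up_to M (\<delta> / 2) (\<lambda>\<omega>. \<bar>\<kappa> * ?l * (Y' \<omega> * G \<omega>)\<bar> \<le> \<delta> / 2)"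
        proof (rule holds_up_to_Chebyshev)
          show "integrable M (\<lambda>\<omega>. (\<kappa> * ?l * (Y' \<omega> * G \<omega>))\<^sup>2)"
            using YG(1) by (simp add: power_mult_distrib)
          have "expectation (\<lambda>\<omega>. (\<kappa> * ?l * (Y' \<omega> * G \<omega>))\<^sup>2) = \<kappa>\<^sup>2 * L"
            using YG(2) \<open>0 < L\<close> by (simp add: power_mult_distrib)
          then show "expectation (\<lambda>\<omega>. (\<kappa> * ?l * (Y' \<omega> * G \<omega>))\<^sup>2) \<le> (\<delta> / 2)\<^sup>2 * (\<delta> / 2)"
            using \<kappa>(5) by simp
        qed (use \<delta> in simp)
        have "holds_up_to M \<delta> (\<lambda>\<omega>. \<bar>U t \<omega> - W \<omega>\<bar> \<le> \<delta>)"
        proof (rule holds_up_to_mono[OF holds_up_to_conj[OF close small]])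
          show "\<kappa> + \<delta> / 2 \<le> \<delta>" using \<kappa>(3) by simp
          fix \<omega>
          assume *: "(\<bar>(R t t \<omega> - \<alpha> * J t \<omega>) / sqrt (A t) - ?l * (Y' \<omega> * G \<omega>)\<bar> \<le> \<kappa> \<and>
            \<bar>J t \<omega> / A t - L * (Y' \<omega>)\<^sup>2\<bar> \<le> \<kappa>) \<and> \<bar>\<kappa> * ?l * (Y' \<omega> * G \<omega>)\<bar> \<le> \<delta> / 2"
          define n j g p where "n = (R t t \<omega> - \<alpha> * J t \<omega>) / sqrt (A t)" and "j = J t \<omega> / A t"
            and "g = Y' \<omega> * G \<omega>" and "p = sqrt (?I t / A t)"
          have n: "\<bar>n - ?l * g\<bar> \<le> \<kappa>" and j: "\<bar>j - L * (Y' \<omega>)\<^sup>2\<bar> \<le> \<kappa>" and kg: "\<bar>\<kappa> * ?l * g\<bar> \<le> \<delta> / 2"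
            using * by (auto simp: n_def j_def g_def)
          have p: "\<bar>p - ?l\<bar> \<le> \<kappa>" using elim(3) by (simp add: p_def)
          have LL: "?l * (?l * g) = L * g" using \<open>0 < L\<close> by simp
          have split_U: "U t \<omega> - W \<omega> = (p - ?l) * (n - ?l * g) + (p - ?l) * (?l * g) +
              ?l * (n - ?l * g) - x * (j - L * (Y' \<omega>)\<^sup>2)"
          proof -
            have expand: "p * n - l * (l * g) - x * j + x * q =
                (p - l) * (n - l * g) + (p - l) * (l * g) + l * (n - l * g) - x * (j - q)" for l q
              by (simp add: algebra_simps)
            have "U t \<omega> = p * n - x * j" by (simp add: U_def n_def j_def p_def)
            moreover have "W \<omega> = L * g - x * (L * (Y' \<omega>)\<^sup>2)" by (simp add: W_def f_def g_def algebra_simps)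
            ultimately show ?thesis
              using expand[of ?l "L * (Y' \<omega>)\<^sup>2", unfolded LL] by linarith
          qed
          have 1: "\<bar>(p - ?l) * (n - ?l * g)\<bar> \<le> \<kappa>"
          proof -
            have "\<bar>p - ?l\<bar> * \<bar>n - ?l * g\<bar> \<le> 1 * \<kappa>" using p n \<kappa>(1,2) by (intro mult_mono) auto
            then show ?thesis by (simp add: abs_mult)
          qed
          have 2: "\<bar>(p - ?l) * (?l * g)\<bar> \<le> \<delta> / 2"
          proof -
            have "\<bar>p - ?l\<bar> * \<bar>?l * g\<bar> \<le> \<kappa> * \<bar>?l * g\<bar>" using p by (intro mult_right_mono) auto
            also have "\<dots> = \<bar>\<kappa> * ?l * g\<bar>" using \<kappa>(1) by (simp add: abs_mult)
            finally show ?thesis using kg by (simp add: abs_mult)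
          qed
          have 3: "\<bar>?l * (n - ?l * g)\<bar> \<le> ?l * \<kappa>"
            using n c(2) by (simp add: abs_mult mult_left_mono)
          have 4: "\<bar>x * (j - L * (Y' \<omega>)\<^sup>2)\<bar> \<le> \<bar>x\<bar> * \<kappa>"
            using j by (simp add: abs_mult mult_left_mono)
          have 5: "\<kappa> + ?l * \<kappa> + \<bar>x\<bar> * \<kappa> \<le> \<delta> / 2" using \<kappa>(4) by (simp add: c_def algebra_simps)
          show "\<bar>U t \<omega> - W \<omega>\<bar> \<le> \<delta>" unfolding split_U using 1 2 3 4 5 by linarith
        qed
        with Wm W_law show ?case by blast
      qed
    qed
    moreover have "\<forall>\<^sub>F t in up_to T. prob {\<omega>\<in>space M. Z t \<omega> \<le> x} = cdf (distr M borel (Z t)) x"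
      using ev
    proof eventually_elim
      case (elim t)
      then have [measurable]: "Z t \<in> borel_measurable M" by (intro Z_meas) auto
      show ?case unfolding cdf_def by (subst measure_distr) (auto intro!: arg_cong[of _ _ prob])
    qed
    ultimately show "((\<lambda>t. cdf (distr M borel (Z t)) x) \<longlongrightarrow> cdf (distr N borel \<zeta>) x) (up_to T)"
      unfolding cdf_\<nu> by (rule Lim_transform_eventually)
  qed
qed

end
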